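(* Let $(M^5,g,\xi,\eta,\varphi)$ be a $5$-dimensional almost contact metric manifold. Then the following equivalences hold: $(M^5,g,\xi,\eta,\varphi)$ is of class - $\mathcal{N}_2$ if and only if it is of class $\mathcal{W}_1\oplus\mathcal{W}_3\oplus\mathcal{W}_5\oplus\mathcal{W}_6\oplus\mathcal{W}_8\oplus\mathcal{W}_9$; - $\mathcal{N}_3$ if and only if it is of class $\mathcal{W}_1\oplus\mathcal{W}_3\oplus\mathcal{W}_5\oplus\mathcal{W}_6\oplus\mathcal{W}_8\oplus\mathcal{W}_{10}$; - $\mathcal{N}_4\oplus\mathcal{N}_5$ if and only if it is of class $\mathcal{W}_1\oplus\mathcal{W}_3\oplus\mathcal{W}_4\oplus\mathcal{W}_5\oplus\mathcal{W}_6\oplus\mathcal{W}_7\oplus\mathcal{W}_8$; - $\mathcal{N}_6$ if and only if it is of class $\mathcal{W}_1\oplus\mathcal{W}_2\oplus\mathcal{W}_3\oplus\mathcal{W}_5\oplus\mathcal{W}_6\oplus\mathcal{W}_8$. In particular, the Nijenhuis tensor of $(M^5,g,\xi,\eta,\varphi)$ vanishes if and only if the almost contact metric manifold is of class $\mathcal{W}_1\oplus\mathcal{W}_3\oplus\mathcal{W}_5\oplus\mathcal{W}_6\oplus\mathcal{W}_8$.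
   Context: Local model. $\mathbb{R}^5$ is Euclidean space with scalar product $\langle\cdot,\cdot\rangle$, an orientation and an oriented orthonormal basis $(e_1,\dots,e_5)$; vectors and $1$-forms are identified via $\langle\cdot,\cdot\rangle$; $\Lambda^k$ is the space of $k$-forms on $\mathbb{R}^5$, $*$ the Hodge operator, $\lrcorner$ the interior product, and $(e_1\wedge e_2)(e_1,e_2)=1$. Put $\xi=e_5$, $\eta$ its dual $1$-form, $\varphi$ the endomorphism with $\varphi(e_1)=-e_2$, $\varphi(e_2)=e_1$, $\varphi(e_3)=-e_4$, $\varphi(e_4)=e_3$, $\varphi(\xi)=0$, and $\Phi(X,Y)=\langle X,\varphi(Y)\rangle$, so $\Phi=e_1\wedge e_2+e_3\wedge e_4$. $U(2)=\{B\in O(5): B\xi=\xi,\ B\circ\varphi=\varphi\circ B\}$. Subspaces of forms: $\Lambda^1_1=\mathbb{R}\eta$, $\Lambda^1_2=\{\alpha\in\Lambda^1:\xi\lrcorner\alpha=0\}$; $\Lambda^2_1=\mathbb{R}\Phi$, $\Lambda^2_2=\{\alpha\in\Lambda^2:\Phi\wedge\alpha=0,\ *\alpha=\eta\wedge\alpha\}$, $\Lambda^2_3=\{\alpha\in\Lambda^2:*\alpha=-\eta\wedge\alpha\}$, $\Lambda^2_4=\{\alpha\in\Lambda^2:\eta\wedge\alpha=0\}$; $\Lambda^3_i=*\Lambda^2_i$. Identifying $\mathfrak{so}(5)=\Lambda^2$, $\mathfrak{u}(2)=\Lambda^2_1\oplus\Lambda^2_3$ has orthogonal complement $\mathfrak{m}=\Lambda^2_2\oplus\Lambda^2_4$;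 $\operatorname{pr}_{\mathfrak m}:\Lambda^2\to\mathfrak{m}$ is the orthogonal projection. $\mathcal{A}=\Lambda^1\otimes\Lambda^2=\{A\in\otimes^3\Lambda^1: A(X,Y,Z)+A(X,Z,Y)=0\}$, where $(\alpha\otimes\beta)(X,Y,Z)=\alpha(X)\beta(Y,Z)$; $\mathcal{A}_3=\{A\in\mathcal{A}: A(X,Y,Z)+A(Y,Z,X)+A(Z,X,Y)=0,\ \sum_iA(e_i,e_i,X)=0\}$; $\mathcal{W}=\Lambda^1\otimes\mathfrak{m}$ and $\operatorname{pr}_{\mathcal W}:\mathcal{A}\to\mathcal{W}$, $\operatorname{pr}_{\mathcal W}(\alpha\otimes\beta)=\alpha\otimes\operatorname{pr}_{\mathfrak m}(\beta)$. Put $\theta_1(\alpha)(X,Y,Z)=\alpha(Z)\langle X,Y\rangle-\alpha(Y)\langle X,Z\rangle$ for $\alpha\in\Lambda^1$; $\theta_2(\alpha)=\sum_ie_i\otimes(e_i\lrcorner\alpha)$ for $\alpha\in\Lambda^3$; $\theta_3(\alpha)=3\,\eta\otimes\alpha-\theta_2(\eta\wedge\alpha)$ for $\alpha\in\Lambda^2_1\oplus\Lambda^2_2\oplus\Lambda^2_3$. Then $\mathcal{W}=\mathcal{W}_1\oplus\dots\oplus\mathcal{W}_{10}$ ($U(2)$-irreducible summands) with $\mathcal{W}_1=\theta_1(\Lambda^1_1)$, $\mathcal{W}_2=\operatorname{pr}_{\mathcal W}(\theta_1(\Lambda^1_2))$, $\mathcal{W}_3=\operatorname{pr}_{\mathcal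 W}(\theta_2(\Lambda^3_1))$, $\mathcal{W}_4=\theta_2(\Lambda^3_2)$, $\mathcal{W}_5=\operatorname{pr}_{\mathcal W}(\theta_2(\Lambda^3_3))$, $\mathcal{W}_6=\operatorname{pr}_{\mathcal W}(\theta_2(\Lambda^3_4))$, $\mathcal{W}_7=\theta_3(\Lambda^2_2)$, $\mathcal{W}_8=\{A\in\mathcal{A}_3:A(X,Y,Z)=A(\varphi X,Y,\varphi Z)+A(\varphi X,\varphi Y,Z)\}$, $\mathcal{W}_9=\{A\in\mathcal{A}_3:A(X,Y,Z)=-A(X,\varphi Y,\varphi Z)\}$, $\mathcal{W}_{10}=\{A\in\mathcal{A}_3:A(X,Y,Z)=-A(\varphi X,Y,\varphi Z)-A(\varphi X,\varphi Y,Z)\}$. Manifolds. An almost contact metric $5$-manifold $(M^5,g,\xi,\eta,\varphi)$ is a Riemannian $5$-manifold with a unit vector field $\xi$, its dual $1$-form $\eta$ and an endomorphism $\varphi$ of $TM^5$ with $\varphi(\xi)=0$, $\varphi^2=-\mathrm{Id}+\eta\otimes\xi$, $g(\varphi X,\varphi Y)=g(X,Y)-\eta(X)\eta(Y)$. Its fundamental form is $\Phi(X,Y)=g(X,\varphi(Y))$. Locally there are adapted frames: oriented orthonormal frames $(e_1,\dots,e_5)$ with $\xi=e_5$, $\Phi=e_1\wedge e_2+e_3\wedge e_4$, which identify each tangent space with the local model (all subspaces above are $U(2)$-invariant, hence define subbundles). With $\nabla^g$ the Levi-Civita connection and $\omega^g_{ij}=g(\nabla^ge_i,e_j)$, put $\Omega^g(X)=\sum_{i<j}\omega^g_{ij}(X)\,e_i\wedge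 e_j$. The intrinsic torsion is $\Gamma=\operatorname{pr}_{\mathfrak m}(\Omega^g)$, a section of $\mathcal{W}$. The manifold is of class $\mathcal{W}_{i_1}\oplus\dots\oplus\mathcal{W}_{i_k}$ if $\Gamma\in\mathcal{W}_{i_1}\oplus\dots\oplus\mathcal{W}_{i_k}$. Nijenhuis tensor. $N(X,Y)=[\varphi X,\varphi Y]+\varphi^2([X,Y])-\varphi([\varphi X,Y])-\varphi([X,\varphi Y])+d\eta(X,Y)\,\xi$, with $d\eta(X,Y)=(\nabla^g_X\eta)(Y)-(\nabla^g_Y\eta)(X)$, and, as a $(3,0)$-tensor, $N(X,Y,Z)=g(X,N(Y,Z))$. Chinea–Marrero classes (dimension 5). $N$ always lies in the space $\mathcal{N}$ of tensors $N\in\Lambda^1\otimes\Lambda^2$ satisfying $N(X,Y,Z)=-N(X,\varphi Y,\varphi Z)+\eta(Y)N(X,\xi,Z)+\eta(Z)N(X,Y,\xi)$ and $N(X,Y,Z)=-N(\varphi X,\varphi Y,Z)+\eta(X)N(\xi,Y,Z)-\eta(Y)N(\varphi X,\xi,\varphi Z)$. $\mathcal{N}$ splits into five irreducible $U(2)$-modules $\mathcal{N}=\mathcal{N}_2\oplus\dots\oplus\mathcal{N}_6$, with $\mathcal{N}_4\cong\mathcal{N}_5$ and no other two isomorphic. Explicitly (with $X,Y,Z$ ranging over vectors orthogonal to $\xi$): $\mathcal{N}_2$ is the set of $N\in\mathcal{N}$ with $N(X,\xi,Z)=0$, $N(\xi,Y,Z)=0$, $N(\xi,\xi,Z)=0$;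 $\mathcal{N}_3$ is the set of $N\in\mathcal{N}$ with $N(X,Y,Z)=0$, $N(\xi,Y,Z)=0$, $N(\xi,\xi,Z)=0$, $N(X,\xi,Z)=N(Z,\xi,X)$; $\mathcal{N}_4\oplus\mathcal{N}_5$ is the set of $N\in\mathcal{N}$ with $N(X,Y,Z)=0$, $N(\xi,\xi,Z)=0$, $N(X,\xi,Z)=-N(Z,\xi,X)$; $\mathcal{N}_6$ is the set of $N\in\mathcal{N}$ with $N(X,Y,Z)=0$, $N(X,\xi,Z)=0$, $N(\xi,Y,Z)=0$. The manifold is of class $\mathcal{N}_{i_1}\oplus\dots\oplus\mathcal{N}_{i_k}$ if its Nijenhuis tensor satisfies $N\in\mathcal{N}_{i_1}\oplus\dots\oplus\mathcal{N}_{i_k}$. *)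

theory Defs
  imports
    "HOL-Analysis.Analysis"
    "HOL-Library.Function_Algebras"
    "HOL-Library.Set_Algebras"
begin

text \<open>
  Functions are added and subtracted pointwise (Function_Algebras), and \<open>S + T\<close> for sets of
  functions is the set of all sums (Set_Algebras); the latter renders sums of subspaces.
\<close>

section \<open>The local model\<close>

type_synonym R5 = "real ^ 5"
type_synonym form1 = "R5 \<Rightarrow> real"
type_synonym form2 = "R5 \<Rightarrow> R5 \<Rightarrow> real"
type_synonym form3 = "R5 \<Rightarrow> R5 \<Rightarrow> R5 \<Rightarrow> real"
type_synonym form4 = "R5 \<Rightarrow> R5 \<Rightarrow> R5 \<Rightarrow> R5 \<Rightarrow> real"
type_synonym tensor3 = "R5 \<Rightarrow> R5 \<Rightarrow> R5 \<Rightarrow> real"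

text \<open>The index type \<open>5\<close> has the elements \<open>1, 2, 3, 4, 5\<close>, where \<open>5 = 0\<close>.\<close>

abbreviation ebas :: "5 \<Rightarrow> R5" where
  "ebas i \<equiv> axis i 1"

abbreviation xi0 :: R5 where
  "xi0 \<equiv> ebas 5"

text \<open>The 1-form identified with a vector \<open>v\<close> is \<open>inner v\<close>.\<close>

definition eta0 :: form1 where
  "eta0 = inner xi0"

definition phi0 :: "R5 \<Rightarrow> R5" where
  "phi0 x = vector [x $ 2, - x $ 1, x $ 4, - x $ 3, 0]"

definition Phi0 :: form2 where
  "Phi0 X Y = X \<bullet> phi0 Y"

definition Lambda2 :: "form2 set" where
  "Lambda2 = {\<alpha>. bilinear \<alpha> \<and> (\<forall>X Y. \<alpha> X Y + \<alpha> Y X = 0)}"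

text \<open>The wedge products are normalised so that \<open>(e\<^sub>1 \<and> e\<^sub>2)(e\<^sub>1, e\<^sub>2) = 1\<close>.\<close>

definition wedge11 :: "form1 \<Rightarrow> form1 \<Rightarrow> form2" where
  "wedge11 \<alpha> \<beta> X Y = \<alpha> X * \<beta> Y - \<alpha> Y * \<beta> X"

definition wedge12 :: "form1 \<Rightarrow> form2 \<Rightarrow> form3" where
  "wedge12 \<alpha> \<beta> X Y Z = \<alpha> X * \<beta> Y Z - \<alpha> Y * \<beta> X Z + \<alpha> Z * \<beta> X Y"

definition wedge22 :: "form2 \<Rightarrow> form2 \<Rightarrow> form4" where
  "wedge22 \<alpha> \<beta> X Y Z V =
     \<alpha> X Y * \<beta> Z V - \<alpha> X Z * \<beta> Y V + \<alpha> X V * \<beta> Y Z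
   + \<alpha> Y Z * \<beta> X V - \<alpha> Y V * \<beta> X Z + \<alpha> Z V * \<beta> X Y"

text \<open>The volume form of the orientation given by \<open>(e\<^sub>1, \<dots>, e\<^sub>5)\<close>.\<close>

definition vol5 :: "R5 \<Rightarrow> R5 \<Rightarrow> R5 \<Rightarrow> R5 \<Rightarrow> R5 \<Rightarrow> real" where
  "vol5 v1 v2 v3 v4 v5 = det (vector [v1, v2, v3, v4, v5] :: real ^ 5 ^ 5)"

text \<open>The Hodge operator on 2-forms: \<open>*(e\<^sub>i \<and> e\<^sub>j) = vol(e\<^sub>i, e\<^sub>j, \<cdot>, \<cdot>, \<cdot>)\<close>; the factor \<open>1/2\<close>
  compensates for each pair \<open>i, j\<close> being counted twice.\<close>

definition hodge2 :: "form2 \<Rightarrow> form3" where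
  "hodge2 \<alpha> X Y Z =
     (\<Sum>i\<in>UNIV. \<Sum>j\<in>UNIV. \<alpha> (ebas i) (ebas j) * vol5 (ebas i) (ebas j) X Y Z) / 2"

subsection \<open>Subspaces of forms\<close>

definition Lambda1_1 :: "form1 set" where
  "Lambda1_1 = {\<lambda>X. t * eta0 X | t. True}"

definition Lambda1_2 :: "form1 set" where
  "Lambda1_2 = {\<alpha>. linear \<alpha> \<and> \<alpha> xi0 = 0}"

definition Lambda2_1 :: "form2 set" where
  "Lambda2_1 = {\<lambda>X Y. t * Phi0 X Y | t. True}"

definition Lambda2_2 :: "form2 set" where
  "Lambda2_2 = {\<alpha> \<in> Lambda2. wedge22 Phi0 \<alpha> = 0 \<and> hodge2 \<alpha> = wedge12 eta0 \<alpha>}"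

definition Lambda2_3 :: "form2 set" where
  "Lambda2_3 = {\<alpha> \<in> Lambda2. hodge2 \<alpha> = - wedge12 eta0 \<alpha>}"

definition Lambda2_4 :: "form2 set" where
  "Lambda2_4 = {\<alpha> \<in> Lambda2. wedge12 eta0 \<alpha> = 0}"

definition Lambda3_1 :: "form3 set" where "Lambda3_1 = hodge2 ` Lambda2_1"
definition Lambda3_2 :: "form3 set" where "Lambda3_2 = hodge2 ` Lambda2_2"
definition Lambda3_3 :: "form3 set" where "Lambda3_3 = hodge2 ` Lambda2_3"
definition Lambda3_4 :: "form3 set" where "Lambda3_4 = hodge2 ` Lambda2_4"

text \<open>The orthogonal complement of \<open>u(2)\<close> in \<open>so(5) = \<Lambda>\<^sup>2\<close>, and the orthogonal projection onto it.\<close>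

definition m_space :: "form2 set" where
  "m_space = Lambda2_2 + Lambda2_4"

definition inner2 :: "form2 \<Rightarrow> form2 \<Rightarrow> real" where
  "inner2 \<alpha> \<beta> =
     (\<Sum>(i, j) \<in> {(i, j). i < j}. \<alpha> (ebas i) (ebas j) * \<beta> (ebas i) (ebas j))"

definition pr_m :: "form2 \<Rightarrow> form2" where
  "pr_m \<alpha> = (THE \<beta>. \<beta> \<in> m_space \<and> (\<forall>\<gamma>\<in>m_space. inner2 (\<alpha> - \<beta>) \<gamma> = 0))"

subsection \<open>The space \<open>\<Lambda>\<^sup>1 \<otimes> \<Lambda>\<^sup>2\<close> and the modules of intrinsic torsion\<close>

definition A_space :: "tensor3 set" where
  "A_space = {A. (\<forall>Y Z. linear (\<lambda>X. A X Y Z)) \<and> (\<forall>X. bilinear (A X)) \<and>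
                 (\<forall>X Y Z. A X Y Z + A X Z Y = 0)}"

definition A3 :: "tensor3 set" where
  "A3 = {A \<in> A_space. (\<forall>X Y Z. A X Y Z + A Y Z X + A Z X Y = 0) \<and>
                      (\<forall>X. (\<Sum>i\<in>UNIV. A (ebas i) (ebas i) X) = 0)}"

text \<open>The linear extension of \<open>\<alpha> \<otimes> \<beta> \<mapsto> \<alpha> \<otimes> pr_m \<beta>\<close>.\<close>

definition pr_W :: "tensor3 \<Rightarrow> tensor3" where
  "pr_W A = (\<lambda>X. pr_m (A X))"

definition theta1 :: "form1 \<Rightarrow> tensor3" where
  "theta1 \<alpha> X Y Z = \<alpha> Z * (X \<bullet> Y) - \<alpha> Y * (X \<bullet> Z)"

definition theta2 :: "form3 \<Rightarrow> tensor3" where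
  "theta2 \<alpha> X Y Z = (\<Sum>i\<in>UNIV. (ebas i \<bullet> X) * \<alpha> (ebas i) Y Z)"

definition theta3 :: "form2 \<Rightarrow> tensor3" where
  "theta3 \<alpha> X Y Z = 3 * (eta0 X * \<alpha> Y Z) - theta2 (wedge12 eta0 \<alpha>) X Y Z"

definition W1 :: "tensor3 set" where "W1 = theta1 ` Lambda1_1"
definition W2 :: "tensor3 set" where "W2 = pr_W ` theta1 ` Lambda1_2"
definition W3 :: "tensor3 set" where "W3 = pr_W ` theta2 ` Lambda3_1"
definition W4 :: "tensor3 set" where "W4 = theta2 ` Lambda3_2"
definition W5 :: "tensor3 set" where "W5 = pr_W ` theta2 ` Lambda3_3"
definition W6 :: "tensor3 set" where "W6 = pr_W ` theta2 ` Lambda3_4"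
definition W7 :: "tensor3 set" where "W7 = theta3 ` Lambda2_2"

definition W8 :: "tensor3 set" where
  "W8 = {A \<in> A3. \<forall>X Y Z. A X Y Z = A (phi0 X) Y (phi0 Z) + A (phi0 X) (phi0 Y) Z}"

definition W9 :: "tensor3 set" where
  "W9 = {A \<in> A3. \<forall>X Y Z. A X Y Z = - A X (phi0 Y) (phi0 Z)}"

definition W10 :: "tensor3 set" where
  "W10 = {A \<in> A3. \<forall>X Y Z. A X Y Z = - A (phi0 X) Y (phi0 Z) - A (phi0 X) (phi0 Y) Z}"

subsection \<open>The modules of Nijenhuis tensors\<close>

definition N_space :: "tensor3 set" where
  "N_space = {N \<in> A_space.
     (\<forall>X Y Z. N X Y Z = - N X (phi0 Y) (phi0 Z) + eta0 Y * N X xi0 Z + eta0 Z * N X Y xi0) \<and>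
     (\<forall>X Y Z. N X Y Z = - N (phi0 X) (phi0 Y) Z + eta0 X * N xi0 Y Z
                         - eta0 Y * N (phi0 X) xi0 (phi0 Z))}"

definition H0 :: "R5 set" where
  "H0 = {X. X \<bullet> xi0 = 0}"

definition N2 :: "tensor3 set" where
  "N2 = {N \<in> N_space. (\<forall>X\<in>H0. \<forall>Z\<in>H0. N X xi0 Z = 0) \<and> (\<forall>Y\<in>H0. \<forall>Z\<in>H0. N xi0 Y Z = 0) \<and>
                      (\<forall>Z\<in>H0. N xi0 xi0 Z = 0)}"

definition N3 :: "tensor3 set" where
  "N3 = {N \<in> N_space. (\<forall>X\<in>H0. \<forall>Y\<in>H0. \<forall>Z\<in>H0. N X Y Z = 0) \<and> (\<forall>Y\<in>H0. \<forall>Z\<in>H0. N xi0 Y Z = 0) \<and>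
                      (\<forall>Z\<in>H0. N xi0 xi0 Z = 0) \<and> (\<forall>X\<in>H0. \<forall>Z\<in>H0. N X xi0 Z = N Z xi0 X)}"

text \<open>The sum \<open>N\<^sub>4 \<oplus> N\<^sub>5\<close>; its two isomorphic summands are not needed separately.\<close>

definition N4_5 :: "tensor3 set" where
  "N4_5 = {N \<in> N_space. (\<forall>X\<in>H0. \<forall>Y\<in>H0. \<forall>Z\<in>H0. N X Y Z = 0) \<and> (\<forall>Z\<in>H0. N xi0 xi0 Z = 0) \<and>
                        (\<forall>X\<in>H0. \<forall>Z\<in>H0. N X xi0 Z = - N Z xi0 X)}"

definition N6 :: "tensor3 set" where
  "N6 = {N \<in> N_space. (\<forall>X\<in>H0. \<forall>Y\<in>H0. \<forall>Z\<in>H0. N X Y Z = 0) \<and> (\<forall>X\<in>H0. \<forall>Z\<in>H0. N X xi0 Z = 0) \<and>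
                      (\<forall>Y\<in>H0. \<forall>Z\<in>H0. N xi0 Y Z = 0)}"


section \<open>Smooth 5-manifolds\<close>

text \<open>\<open>C\<^sup>k\<close> and smooth maps; meant for open \<open>S\<close> only.\<close>

primrec Ck_on :: "nat \<Rightarrow> 'a::real_normed_vector set \<Rightarrow> ('a \<Rightarrow> 'b::real_normed_vector) \<Rightarrow> bool" where
  "Ck_on 0 S f \<longleftrightarrow> continuous_on S f"
| "Ck_on (Suc k) S f \<longleftrightarrow> (\<forall>x\<in>S. f differentiable (at x)) \<and>
                        (\<forall>v. Ck_on k S (\<lambda>x. frechet_derivative f (at x) v))"

definition smooth_on :: "'a::real_normed_vector set \<Rightarrow> ('a \<Rightarrow> 'b::real_normed_vector) \<Rightarrow> bool" where
  "smooth_on S f \<longleftrightarrow> (\<forall>k. Ck_on k S f)"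

text \<open>A chart is a pair of its domain and its coordinate map. The points of the manifold are all
  elements of the type \<open>'a\<close>, whose topology is required to be Hausdorff and second countable.\<close>

type_synonym 'a chart = "'a set \<times> ('a \<Rightarrow> R5)"

definition chart_inv :: "'a chart \<Rightarrow> R5 \<Rightarrow> 'a" where
  "chart_inv c = inv_into (fst c) (snd c)"

definition smooth_atlas :: "'a::{t2_space, second_countable_topology} chart set \<Rightarrow> bool" where
  "smooth_atlas \<A> \<longleftrightarrow>
     (\<Union>c\<in>\<A>. fst c) = UNIV \<and>
     (\<forall>c\<in>\<A>. open (fst c) \<and> open (snd c ` fst c) \<and>
             homeomorphism (fst c) (snd c ` fst c) (snd c) (chart_inv c)) \<and>
     (\<forall>c\<in>\<A>. \<forall>d\<in>\<A>. smooth_on (snd c ` (fst c \<inter> fst d)) (snd d \<circ> chart_inv c))"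

definition smooth_fun :: "'a chart set \<Rightarrow> 'a set \<Rightarrow> ('a \<Rightarrow> real) \<Rightarrow> bool" where
  "smooth_fun \<A> U f \<longleftrightarrow> (\<forall>c\<in>\<A>. smooth_on (snd c ` (U \<inter> fst c)) (f \<circ> chart_inv c))"

text \<open>A tangent vector is the family of its coordinate vectors in the charts around its foot point,
  related by the differentials of the coordinate changes; the value in all other charts is \<open>0\<close>,
  so that vectors of \<open>tangent \<A> p\<close> are equal as soon as their coordinates agree.\<close>

type_synonym 'a tvec = "'a chart \<Rightarrow> R5"

definition tscale :: "real \<Rightarrow> 'a tvec \<Rightarrow> 'a tvec" where
  "tscale a v = (\<lambda>c. a *\<^sub>R v c)"

definition tangent :: "'a chart set \<Rightarrow> 'a \<Rightarrow> 'a tvec set" where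
  "tangent \<A> p = {v.
     (\<forall>c. c \<notin> \<A> \<or> p \<notin> fst c \<longrightarrow> v c = 0) \<and>
     (\<forall>c\<in>\<A>. \<forall>d\<in>\<A>. p \<in> fst c \<and> p \<in> fst d \<longrightarrow>
        v d = frechet_derivative (snd d \<circ> chart_inv c) (at (snd c p)) (v c))}"

text \<open>The derivative \<open>v(f)\<close> of a function, for \<open>v \<in> tangent \<A> p\<close>; it does not depend on the chart.\<close>

definition dir_deriv :: "'a chart set \<Rightarrow> 'a \<Rightarrow> 'a tvec \<Rightarrow> ('a \<Rightarrow> real) \<Rightarrow> real" where
  "dir_deriv \<A> p v f =
     (let c = (SOME c. c \<in> \<A> \<and> p \<in> fst c)
      in frechet_derivative (f \<circ> chart_inv c) (at (snd c p)) (v c))"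

text \<open>Local vector fields on an open set \<open>U\<close> are total functions whose values off \<open>U\<close> are irrelevant.\<close>

definition vfield :: "'a chart set \<Rightarrow> 'a set \<Rightarrow> ('a \<Rightarrow> 'a tvec) \<Rightarrow> bool" where
  "vfield \<A> U X \<longleftrightarrow>
     (\<forall>p\<in>U. X p \<in> tangent \<A> p) \<and>
     (\<forall>c\<in>\<A>. smooth_on (snd c ` (U \<inter> fst c)) (\<lambda>x. X (chart_inv c x) c))"

definition lie_bracket ::
    "'a chart set \<Rightarrow> ('a \<Rightarrow> 'a tvec) \<Rightarrow> ('a \<Rightarrow> 'a tvec) \<Rightarrow> 'a \<Rightarrow> 'a tvec" where
  "lie_bracket \<A> X Y p = (\<lambda>c.
     if c \<in> \<A> \<and> p \<in> fst c
     then frechet_derivative (\<lambda>x. Y (chart_inv c x) c) (at (snd c p)) (X p c)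
        - frechet_derivative (\<lambda>x. X (chart_inv c x) c) (at (snd c p)) (Y p c)
     else 0)"

definition riemannian_metric ::
    "'a::topological_space chart set \<Rightarrow> ('a \<Rightarrow> 'a tvec \<Rightarrow> 'a tvec \<Rightarrow> real) \<Rightarrow> bool" where
  "riemannian_metric \<A> g \<longleftrightarrow>
     (\<forall>p. \<forall>u\<in>tangent \<A> p. \<forall>v\<in>tangent \<A> p.
        g p u v = g p v u \<and> (u \<noteq> 0 \<longrightarrow> g p u u > 0) \<and>
        (\<forall>a. g p (tscale a u) v = a * g p u v) \<and>
        (\<forall>w\<in>tangent \<A> p. g p (u + v) w = g p u w + g p v w)) \<and>
     (\<forall>U X Y. open U \<and> vfield \<A> U X \<and> vfield \<A> U Y \<longrightarrow> smooth_fun \<A> U (\<lambda>p. g p (X p) (Y p)))"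

definition endomorphism_field ::
    "'a::topological_space chart set \<Rightarrow> ('a \<Rightarrow> 'a tvec \<Rightarrow> 'a tvec) \<Rightarrow> bool" where
  "endomorphism_field \<A> \<phi> \<longleftrightarrow>
     (\<forall>p. \<forall>u\<in>tangent \<A> p. \<phi> p u \<in> tangent \<A> p \<and>
        (\<forall>a. \<phi> p (tscale a u) = tscale a (\<phi> p u)) \<and>
        (\<forall>v\<in>tangent \<A> p. \<phi> p (u + v) = \<phi> p u + \<phi> p v)) \<and>
     (\<forall>U X. open U \<and> vfield \<A> U X \<longrightarrow> vfield \<A> U (\<lambda>p. \<phi> p (X p)))"

text \<open>Connections: \<open>nabla p v Y\<close> is the covariant derivative of a local vector field \<open>Y\<close>,
  defined near \<open>p\<close>, in the direction \<open>v \<in> tangent \<A> p\<close>. The clause on \<open>Y\<close> and \<open>Y'\<close> says that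
  it depends on the restriction of \<open>Y\<close> to any open neighbourhood of \<open>p\<close> only.\<close>

definition linear_connection ::
    "'a::topological_space chart set \<Rightarrow> ('a \<Rightarrow> 'a tvec \<Rightarrow> ('a \<Rightarrow> 'a tvec) \<Rightarrow> 'a tvec) \<Rightarrow> bool" where
  "linear_connection \<A> nabla \<longleftrightarrow>
     (\<forall>U Y. open U \<and> vfield \<A> U Y \<longrightarrow>
        (\<forall>X. vfield \<A> U X \<longrightarrow> vfield \<A> U (\<lambda>p. nabla p (X p) Y)) \<and>
        (\<forall>p\<in>U. \<forall>u\<in>tangent \<A> p.
           nabla p u Y \<in> tangent \<A> p \<and>
           (\<forall>a. nabla p (tscale a u) Y = tscale a (nabla p u Y)) \<and>
           (\<forall>v\<in>tangent \<A> p. nabla p (u + v) Y = nabla p u Y + nabla p v Y) \<and>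
           (\<forall>Y'. vfield \<A> U Y' \<longrightarrow>
              nabla p u (\<lambda>q. Y q + Y' q) = nabla p u Y + nabla p u Y' \<and>
              ((\<forall>q\<in>U. Y q = Y' q) \<longrightarrow> nabla p u Y = nabla p u Y')) \<and>
           (\<forall>f. smooth_fun \<A> U f \<longrightarrow>
              nabla p u (\<lambda>q. tscale (f q) (Y q)) =
                tscale (dir_deriv \<A> p u f) (Y p) + tscale (f p) (nabla p u Y))))"

definition levi_civita ::
    "'a::topological_space chart set \<Rightarrow> ('a \<Rightarrow> 'a tvec \<Rightarrow> 'a tvec \<Rightarrow> real) \<Rightarrow>
     ('a \<Rightarrow> 'a tvec \<Rightarrow> ('a \<Rightarrow> 'a tvec) \<Rightarrow> 'a tvec) \<Rightarrow> bool" where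
  "levi_civita \<A> g nabla \<longleftrightarrow>
     linear_connection \<A> nabla \<and>
     (\<forall>U X Y. open U \<and> vfield \<A> U X \<and> vfield \<A> U Y \<longrightarrow>
        (\<forall>p\<in>U. nabla p (X p) Y - nabla p (Y p) X = lie_bracket \<A> X Y p) \<and>
        (\<forall>p\<in>U. \<forall>v\<in>tangent \<A> p.
           dir_deriv \<A> p v (\<lambda>q. g q (X q) (Y q)) = g p (nabla p v X) (Y p) + g p (X p) (nabla p v Y)))"


section \<open>Almost contact metric 5-manifolds\<close>

definition almost_contact_metric_5_manifold ::
    "'a::{t2_space, second_countable_topology} chart set \<Rightarrow>
     ('a \<Rightarrow> 'a tvec \<Rightarrow> 'a tvec \<Rightarrow> real) \<Rightarrow> ('a \<Rightarrow> 'a tvec) \<Rightarrow>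
     ('a \<Rightarrow> 'a tvec \<Rightarrow> real) \<Rightarrow> ('a \<Rightarrow> 'a tvec \<Rightarrow> 'a tvec) \<Rightarrow> bool" where
  "almost_contact_metric_5_manifold \<A> g \<xi> \<eta> \<phi> \<longleftrightarrow>
     smooth_atlas \<A> \<and> riemannian_metric \<A> g \<and> vfield \<A> UNIV \<xi> \<and> endomorphism_field \<A> \<phi> \<and>
     (\<forall>p. g p (\<xi> p) (\<xi> p) = 1 \<and> \<phi> p (\<xi> p) = 0 \<and>
        (\<forall>u\<in>tangent \<A> p.
           \<eta> p u = g p (\<xi> p) u \<and>
           \<phi> p (\<phi> p u) = - u + tscale (\<eta> p u) (\<xi> p) \<and>
           (\<forall>v\<in>tangent \<A> p. g p (\<phi> p u) (\<phi> p v) = g p u v - \<eta> p u * \<eta> p v)))"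

text \<open>Adapted local frames. The last condition says \<open>\<Phi> = e\<^sub>1 \<and> e\<^sub>2 + e\<^sub>3 \<and> e\<^sub>4\<close>. Orientedness is not
  a further condition: \<open>M\<close> carries the orientation of \<open>\<Phi> \<and> \<Phi> \<and> \<eta>\<close>, for which every such frame
  is positively oriented.\<close>

definition adapted_frame ::
    "'a::topological_space chart set \<Rightarrow> ('a \<Rightarrow> 'a tvec \<Rightarrow> 'a tvec \<Rightarrow> real) \<Rightarrow>
     ('a \<Rightarrow> 'a tvec) \<Rightarrow> ('a \<Rightarrow> 'a tvec \<Rightarrow> 'a tvec) \<Rightarrow> 'a set \<Rightarrow> (5 \<Rightarrow> 'a \<Rightarrow> 'a tvec) \<Rightarrow> bool" where
  "adapted_frame \<A> g \<xi> \<phi> U E \<longleftrightarrow>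
     open U \<and> (\<forall>i. vfield \<A> U (E i)) \<and>
     (\<forall>p\<in>U. E 5 p = \<xi> p \<and>
        (\<forall>i j. g p (E i p) (E j p) = (if i = j then 1 else 0)) \<and>
        (\<forall>i j. g p (E i p) (\<phi> p (E j p)) =
           (wedge11 (inner (ebas 1)) (inner (ebas 2)) + wedge11 (inner (ebas 3)) (inner (ebas 4)))
             (ebas i) (ebas j)))"

text \<open>The identification of the local model with the tangent space at \<open>p\<close> given by a frame.\<close>

definition frame_vec :: "(5 \<Rightarrow> 'a \<Rightarrow> 'a tvec) \<Rightarrow> R5 \<Rightarrow> 'a \<Rightarrow> 'a tvec" where
  "frame_vec E x p = (\<Sum>i\<in>UNIV. tscale (x $ i) (E i p))"

text \<open>\<open>\<Omega>(X) = \<Sum>\<^sub>i\<^sub><\<^sub>j \<omega>\<^sub>i\<^sub>j(X) e\<^sub>i \<and> e\<^sub>j\<close> with \<open>\<omega>\<^sub>i\<^sub>j(X) = g(\<nabla>\<^sub>X e\<^sub>i, e\<^sub>j)\<close>, read in the local model. The order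
  on the index type is \<open>5 < 1 < 2 < 3 < 4\<close>, which is harmless here (and in \<open>inner2\<close>), since
  each summand is symmetric in \<open>i\<close> and \<open>j\<close>.\<close>

definition connection_form ::
    "('a \<Rightarrow> 'a tvec \<Rightarrow> 'a tvec \<Rightarrow> real) \<Rightarrow> ('a \<Rightarrow> 'a tvec \<Rightarrow> ('a \<Rightarrow> 'a tvec) \<Rightarrow> 'a tvec) \<Rightarrow>
     (5 \<Rightarrow> 'a \<Rightarrow> 'a tvec) \<Rightarrow> 'a \<Rightarrow> tensor3" where
  "connection_form g nabla E p X Y Z =
     (\<Sum>(i, j) \<in> {(i, j). i < j}.
        g p (nabla p (frame_vec E X p) (E i)) (E j p) * wedge11 (inner (ebas i)) (inner (ebas j)) Y Z)"

definition intrinsic_torsion ::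
    "('a \<Rightarrow> 'a tvec \<Rightarrow> 'a tvec \<Rightarrow> real) \<Rightarrow> ('a \<Rightarrow> 'a tvec \<Rightarrow> ('a \<Rightarrow> 'a tvec) \<Rightarrow> 'a tvec) \<Rightarrow>
     (5 \<Rightarrow> 'a \<Rightarrow> 'a tvec) \<Rightarrow> 'a \<Rightarrow> tensor3" where
  "intrinsic_torsion g nabla E p = pr_W (connection_form g nabla E p)"

definition torsion_class ::
    "'a::topological_space chart set \<Rightarrow> ('a \<Rightarrow> 'a tvec \<Rightarrow> 'a tvec \<Rightarrow> real) \<Rightarrow>
     ('a \<Rightarrow> 'a tvec) \<Rightarrow> ('a \<Rightarrow> 'a tvec \<Rightarrow> 'a tvec) \<Rightarrow>
     ('a \<Rightarrow> 'a tvec \<Rightarrow> ('a \<Rightarrow> 'a tvec) \<Rightarrow> 'a tvec) \<Rightarrow> tensor3 set \<Rightarrow> bool" where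
  "torsion_class \<A> g \<xi> \<phi> nabla S \<longleftrightarrow>
     (\<forall>U E. adapted_frame \<A> g \<xi> \<phi> U E \<longrightarrow> (\<forall>p\<in>U. intrinsic_torsion g nabla E p \<in> S))"

subsection \<open>The Nijenhuis tensor\<close>

text \<open>\<open>(\<nabla>\<^sub>X \<eta>)(Y) = X(\<eta>(Y)) - \<eta>(\<nabla>\<^sub>X Y)\<close>\<close>

definition cov_deriv_eta ::
    "'a chart set \<Rightarrow> ('a \<Rightarrow> 'a tvec \<Rightarrow> ('a \<Rightarrow> 'a tvec) \<Rightarrow> 'a tvec) \<Rightarrow> ('a \<Rightarrow> 'a tvec \<Rightarrow> real) \<Rightarrow>
     ('a \<Rightarrow> 'a tvec) \<Rightarrow> ('a \<Rightarrow> 'a tvec) \<Rightarrow> 'a \<Rightarrow> real" where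
  "cov_deriv_eta \<A> nabla \<eta> X Y p =
     dir_deriv \<A> p (X p) (\<lambda>q. \<eta> q (Y q)) - \<eta> p (nabla p (X p) Y)"

definition d_eta ::
    "'a chart set \<Rightarrow> ('a \<Rightarrow> 'a tvec \<Rightarrow> ('a \<Rightarrow> 'a tvec) \<Rightarrow> 'a tvec) \<Rightarrow> ('a \<Rightarrow> 'a tvec \<Rightarrow> real) \<Rightarrow>
     ('a \<Rightarrow> 'a tvec) \<Rightarrow> ('a \<Rightarrow> 'a tvec) \<Rightarrow> 'a \<Rightarrow> real" where
  "d_eta \<A> nabla \<eta> X Y p = cov_deriv_eta \<A> nabla \<eta> X Y p - cov_deriv_eta \<A> nabla \<eta> Y X p"

definition nijenhuis ::
    "'a chart set \<Rightarrow> ('a \<Rightarrow> 'a tvec \<Rightarrow> ('a \<Rightarrow> 'a tvec) \<Rightarrow> 'a tvec) \<Rightarrow> ('a \<Rightarrow> 'a tvec) \<Rightarrow>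
     ('a \<Rightarrow> 'a tvec \<Rightarrow> real) \<Rightarrow> ('a \<Rightarrow> 'a tvec \<Rightarrow> 'a tvec) \<Rightarrow>
     ('a \<Rightarrow> 'a tvec) \<Rightarrow> ('a \<Rightarrow> 'a tvec) \<Rightarrow> 'a \<Rightarrow> 'a tvec" where
  "nijenhuis \<A> nabla \<xi> \<eta> \<phi> X Y p =
     lie_bracket \<A> (\<lambda>q. \<phi> q (X q)) (\<lambda>q. \<phi> q (Y q)) p
     + \<phi> p (\<phi> p (lie_bracket \<A> X Y p))
     - \<phi> p (lie_bracket \<A> (\<lambda>q. \<phi> q (X q)) Y p)
     - \<phi> p (lie_bracket \<A> X (\<lambda>q. \<phi> q (Y q)) p)
     + tscale (d_eta \<A> nabla \<eta> X Y p) (\<xi> p)"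

definition nijenhuis_vanishes ::
    "'a::topological_space chart set \<Rightarrow> ('a \<Rightarrow> 'a tvec \<Rightarrow> ('a \<Rightarrow> 'a tvec) \<Rightarrow> 'a tvec) \<Rightarrow>
     ('a \<Rightarrow> 'a tvec) \<Rightarrow> ('a \<Rightarrow> 'a tvec \<Rightarrow> real) \<Rightarrow> ('a \<Rightarrow> 'a tvec \<Rightarrow> 'a tvec) \<Rightarrow> bool" where
  "nijenhuis_vanishes \<A> nabla \<xi> \<eta> \<phi> \<longleftrightarrow>
     (\<forall>U X Y. open U \<and> vfield \<A> U X \<and> vfield \<A> U Y \<longrightarrow> (\<forall>p\<in>U. nijenhuis \<A> nabla \<xi> \<eta> \<phi> X Y p = 0))"

text \<open>The tensor \<open>N(X, Y, Z) = g(X, N(Y, Z))\<close> at \<open>p\<close>, read in the local model; \<open>Y\<close> and \<open>Z\<close> are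
  extended to local vector fields with constant coefficients in the frame.\<close>

definition nijenhuis_tensor ::
    "'a chart set \<Rightarrow> ('a \<Rightarrow> 'a tvec \<Rightarrow> 'a tvec \<Rightarrow> real) \<Rightarrow>
     ('a \<Rightarrow> 'a tvec \<Rightarrow> ('a \<Rightarrow> 'a tvec) \<Rightarrow> 'a tvec) \<Rightarrow> ('a \<Rightarrow> 'a tvec) \<Rightarrow>
     ('a \<Rightarrow> 'a tvec \<Rightarrow> real) \<Rightarrow> ('a \<Rightarrow> 'a tvec \<Rightarrow> 'a tvec) \<Rightarrow>
     (5 \<Rightarrow> 'a \<Rightarrow> 'a tvec) \<Rightarrow> 'a \<Rightarrow> tensor3" where
  "nijenhuis_tensor \<A> g nabla \<xi> \<eta> \<phi> E p X Y Z =
     g p (frame_vec E X p) (nijenhuis \<A> nabla \<xi> \<eta> \<phi> (frame_vec E Y) (frame_vec E Z) p)"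

definition nijenhuis_class ::
    "'a::topological_space chart set \<Rightarrow> ('a \<Rightarrow> 'a tvec \<Rightarrow> 'a tvec \<Rightarrow> real) \<Rightarrow>
     ('a \<Rightarrow> 'a tvec \<Rightarrow> ('a \<Rightarrow> 'a tvec) \<Rightarrow> 'a tvec) \<Rightarrow> ('a \<Rightarrow> 'a tvec) \<Rightarrow>
     ('a \<Rightarrow> 'a tvec \<Rightarrow> real) \<Rightarrow> ('a \<Rightarrow> 'a tvec \<Rightarrow> 'a tvec) \<Rightarrow> tensor3 set \<Rightarrow> bool" where
  "nijenhuis_class \<A> g nabla \<xi> \<eta> \<phi> S \<longleftrightarrow>
     (\<forall>U E. adapted_frame \<A> g \<xi> \<phi> U E \<longrightarrow> (\<forall>p\<in>U. nijenhuis_tensor \<A> g nabla \<xi> \<eta> \<phi> E p \<in> S))"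

end

theory Submission
  imports Defs
begin

text \<open>
  In an adapted frame both tensors are linear in the connection form \<open>A\<close> at the point: the intrinsic
  torsion is \<open>pr_W A\<close>, and since \<open>\<nabla>\<close> is torsion free, the Nijenhuis tensor is a universal expression
  \<open>nij A\<close>, obtained by rewriting all Lie brackets through
  \<open>\<langle>Z, (\<nabla>\<^sub>V\<phi>)Y\<rangle> = A(V, \<phi>Y, Z) + A(V, Y, \<phi>Z)\<close>.
  The theorem thus becomes linear algebra on \<open>\<Lambda>\<^sup>1 \<otimes> \<Lambda>\<^sup>2\<close>: the kernel of \<open>nij\<close> on \<open>\<W>\<close> is
  \<open>\<W>\<^sub>1 + \<W>\<^sub>3 + \<W>\<^sub>5 + \<W>\<^sub>6 + \<W>\<^sub>8\<close>, and each defining condition of an \<open>\<N>\<^sub>i\<close> says that the components of \<open>A\<close> in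
  \<open>\<W>\<^sub>2\<close>, \<open>\<W>\<^sub>4 + \<W>\<^sub>7\<close>, \<open>\<W>\<^sub>9\<close> or \<open>\<W>\<^sub>1\<^sub>0\<close> vanish.
  For the last equivalence, adapted frames have to exist around every point; they are produced from
  coordinate fields by the Gram-Schmidt process.
\<close>

section \<open>Forms on the local model\<close>

text \<open>Write b(X, Y) = A(X, Y, \<xi>) for X, Y orthogonal to \<xi>. The projection to \<W>
  keeps four pieces of A, of dimensions 16 + 4 + 2 + 8 = 30: the form b, the vector A(\<xi>, -,
  \<xi>), the \<open>Lambda2_2\<close>-part of A(\<xi>), and the \<open>Lambda2_2\<close>-part of
  A(X) for horizontal X. The symmetric part of b splits into trace (\<open>W1\<close>), trace-free
  \<phi>-invariant part (\<open>W8\<close>) and \<phi>-anti-invariant part (\<open>W10\<close>); the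
  skew part has a component along \<open>Phi0\<close> (\<open>W3\<close>), one in
  \<open>Lambda2_3\<close> (\<open>W5\<close>) and one in \<open>Lambda2_2\<close>. The last of the
  four pieces splits by complex type into \<open>W6\<close> and \<open>W9\<close>. Two summands do
  not fit this pattern. \<open>Lambda2_2\<close> occurs both in b and in A(\<xi>), and
  \<open>W4\<close> and \<open>W7\<close> are two diagonal copies in the sum of these; they are
  separated by a 2 by 2 linear system. And \<open>W2\<close> is not just the piece A(\<xi>, -,
  \<xi>): its elements carry a part of the type of \<open>W6\<close>, which has to be subtracted
  again. The four predicates below amount to 4 + 4 + 4 + 6 = 18 scalar equations, which leaves
  dimension 12 = 1 + 1 + 3 + 4 + 3 for the kernel.\<close>

lemma exhaust_5: "x = 1 \<or> x = 2 \<or> x = 3 \<or> x = 4 \<or> x = 5" for x :: 5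
proof (induct x)
  case (of_int z)
  \<comment> \<open>Representatives of the five residues; the residue 0 is the index written
    \<open>5\<close>.\<close>
  then have "z = 0 \<or> z = 1 \<or> z = 2 \<or> z = 3 \<or> z = 4" by fastforce
  then show ?case by auto
qed

lemma index5_neq [simp]:
  "(1::5) \<noteq> 2" "(1::5) \<noteq> 3" "(1::5) \<noteq> 4" "(1::5) \<noteq> 5"
  "(2::5) \<noteq> 1" "(2::5) \<noteq> 3" "(2::5) \<noteq> 4" "(2::5) \<noteq> 5"
  "(3::5) \<noteq> 1" "(3::5) \<noteq> 2" "(3::5) \<noteq> 4" "(3::5) \<noteq> 5"
  "(4::5) \<noteq> 1" "(4::5) \<noteq> 2" "(4::5) \<noteq> 3" "(4::5) \<noteq> 5"
  "(5::5) \<noteq> 1" "(5::5) \<noteq> 2" "(5::5) \<noteq> 3" "(5::5) \<noteq> 4"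
  by simp_all

lemma forall_5: "(\<forall>i::5. P i) \<longleftrightarrow> P 1 \<and> P 2 \<and> P 3 \<and> P 4 \<and> P 5"
  by (metis exhaust_5)

lemma UNIV_5: "UNIV = {1, 2, 3, 4, 5::5}"
  using exhaust_5 by auto

lemma sum_5: "sum f (UNIV::5 set) = f 1 + f 2 + f 3 + f 4 + f 5"
  unfolding UNIV_5 by (simp add: ac_simps)

lemma vector_5:
  "(vector [a,b,c,d,e] :: 'a::zero^5) $ 1 = a"
  "(vector [a,b,c,d,e] :: 'a::zero^5) $ 2 = b"
  "(vector [a,b,c,d,e] :: 'a::zero^5) $ 3 = c"
  "(vector [a,b,c,d,e] :: 'a::zero^5) $ 4 = d"
  "(vector [a,b,c,d,e] :: 'a::zero^5) $ 5 = e"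
  unfolding vector_def by simp_all

lemma phi0_nth [simp]:
  "phi0 x $ 1 = x $ 2" "phi0 x $ 2 = - x $ 1" "phi0 x $ 3 = x $ 4" "phi0 x $ 4 = - x $ 3" "phi0 x $ 5 = 0"
  by (simp_all only: phi0_def vector_5)

lemma eta0_nth: "eta0 X = X $ 5"
  by (simp add: eta0_def inner_axis')

lemma ebas_nth: "ebas i $ j = (if i = j then 1 else 0)"
  by (simp add: axis_def)

lemma phi0_linear: "linear phi0"
  by (rule linearI) (simp_all add: vec_eq_iff forall_5)

lemma phi0_ebas [simp]:
  "phi0 (ebas 1) = - ebas 2" "phi0 (ebas 2) = ebas 1" "phi0 (ebas 3) = - ebas 4" "phi0 (ebas 4) = ebas 3"
  "phi0 (ebas 5) = 0"
  by (simp_all add: vec_eq_iff forall_5 ebas_nth)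

lemma ebas_expand: "X = (\<Sum>i\<in>UNIV. X $ i *\<^sub>R ebas i)" for X :: R5
  by (simp add: vec_eq_iff forall_5 sum_5 ebas_nth)

section \<open>The Hodge operator in coordinates\<close>

text \<open>The 3-form \<open>e\<^sub>a \<and> e\<^sub>b \<and> e\<^sub>c\<close>, as a 3 by 3 minor
  expanded along its first row.\<close>

definition minor3 :: "5 \<Rightarrow> 5 \<Rightarrow> 5 \<Rightarrow> form3" where
  "minor3 a b c X Y Z =
     X $ a * (Y $ b * Z $ c - Y $ c * Z $ b) - X $ b * (Y $ a * Z $ c - Y $ c * Z $ a)
   + X $ c * (Y $ a * Z $ b - Y $ b * Z $ a)"

text \<open>Laplace expansion: with the unit vectors e_i, e_j as the first two rows, the determinant
  is (-1)^(i+j+1) times the minor on the complementary columns.\<close>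

lemma vol5_ebas:
  "vol5 (ebas 1) (ebas 2) X Y Z = minor3 3 4 5 X Y Z"
  "vol5 (ebas 1) (ebas 3) X Y Z = - minor3 2 4 5 X Y Z"
  "vol5 (ebas 1) (ebas 4) X Y Z = minor3 2 3 5 X Y Z"
  "vol5 (ebas 1) (ebas 5) X Y Z = - minor3 2 3 4 X Y Z"
  "vol5 (ebas 2) (ebas 3) X Y Z = minor3 1 4 5 X Y Z"
  "vol5 (ebas 2) (ebas 4) X Y Z = - minor3 1 3 5 X Y Z"
  "vol5 (ebas 2) (ebas 5) X Y Z = minor3 1 3 4 X Y Z"
  "vol5 (ebas 3) (ebas 4) X Y Z = minor3 1 2 5 X Y Z"
  "vol5 (ebas 3) (ebas 5) X Y Z = - minor3 1 2 4 X Y Z"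
  "vol5 (ebas 4) (ebas 5) X Y Z = minor3 1 2 3 X Y Z"
proof -
  have f: "finite {1,2,3,4::5}" "5 \<notin> {1,2,3,4::5}" "finite {1,2,3::5}" "4 \<notin> {1,2,3::5}"
    "finite {1,2::5}" "3 \<notin> {1,2::5}" "finite {1::5}" "2 \<notin> {1::5}" by auto
  have u: "UNIV = {5,4,3,2,1::5}" using exhaust_5 by auto
  note eqs = sum_over_permutations_insert permutes_sing sign_swap_id permutation_swap_id
    sign_compose permutation_compose sign_id vector_5 ebas_nth
  show "vol5 (ebas 1) (ebas 2) X Y Z = minor3 3 4 5 X Y Z"
    unfolding vol5_def det_def u by (simp add: eqs minor3_def algebra_simps)
  show "vol5 (ebas 1) (ebas 3) X Y Z = - minor3 2 4 5 X Y Z"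
    unfolding vol5_def det_def u by (simp add: eqs minor3_def algebra_simps)
  show "vol5 (ebas 1) (ebas 4) X Y Z = minor3 2 3 5 X Y Z"
    unfolding vol5_def det_def u by (simp add: eqs minor3_def algebra_simps)
  show "vol5 (ebas 1) (ebas 5) X Y Z = - minor3 2 3 4 X Y Z"
    unfolding vol5_def det_def u by (simp add: eqs minor3_def algebra_simps)
  show "vol5 (ebas 2) (ebas 3) X Y Z = minor3 1 4 5 X Y Z"
    unfolding vol5_def det_def u by (simp add: eqs minor3_def algebra_simps)
  show "vol5 (ebas 2) (ebas 4) X Y Z = - minor3 1 3 5 X Y Z"
    unfolding vol5_def det_def u by (simp add: eqs minor3_def algebra_simps)
  show "vol5 (ebas 2) (ebas 5) X Y Z = minor3 1 3 4 X Y Z"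
    unfolding vol5_def det_def u by (simp add: eqs minor3_def algebra_simps)
  show "vol5 (ebas 3) (ebas 4) X Y Z = minor3 1 2 5 X Y Z"
    unfolding vol5_def det_def u by (simp add: eqs minor3_def algebra_simps)
  show "vol5 (ebas 3) (ebas 5) X Y Z = - minor3 1 2 4 X Y Z"
    unfolding vol5_def det_def u by (simp add: eqs minor3_def algebra_simps)
  show "vol5 (ebas 4) (ebas 5) X Y Z = minor3 1 2 3 X Y Z"
    unfolding vol5_def det_def u by (simp add: eqs minor3_def algebra_simps)
qed

lemma vol5_swap: "vol5 v u X Y Z = - vol5 u v X Y Z"
proof -
  have "(\<chi> i. (vector [u, v, X, Y, Z] :: real^5^5) $ Transposition.transpose 1 2 i) = vector [v, u, X, Y, Z]"
    by (simp add: vec_eq_iff forall_5 vector_5 transpose_def)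
  with det_permute_rows[of "Transposition.transpose 1 (2::5)" "vector [u, v, X, Y, Z] :: real^5^5"] show ?thesis
    by (simp add: vol5_def permutes_swap_id sign_swap_id)
qed

lemma vol5_same [simp]: "vol5 u u X Y Z = 0"
  using vol5_swap[of u u X Y Z] by simp

lemma bilinear_expand: "\<alpha> Y Z = (\<Sum>i\<in>UNIV. \<Sum>j\<in>UNIV. Y $ i * Z $ j * \<alpha> (ebas i) (ebas j))"
  if "bilinear \<alpha>" for \<alpha> :: form2
proof -
  have "\<alpha> Y Z = \<alpha> (\<Sum>i\<in>UNIV. Y $ i *\<^sub>R ebas i) (\<Sum>i\<in>UNIV. Z $ i *\<^sub>R ebas i)"
    using ebas_expand by metis
  also have "\<dots> = (\<Sum>(i,j)\<in>UNIV \<times> UNIV. \<alpha> (Y $ i *\<^sub>R ebas i) (Z $ j *\<^sub>R ebas j))"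
    by (rule bilinear_sum[OF that])
  also have "\<dots> = (\<Sum>i\<in>UNIV. \<Sum>j\<in>UNIV. Y $ i * Z $ j * \<alpha> (ebas i) (ebas j))"
    by (simp add: sum.cartesian_product bilinear_lmul[OF that] bilinear_rmul[OF that] algebra_simps split_def)
  finally show ?thesis .
qed

lemma Lambda2_skew: "\<alpha> \<in> Lambda2 \<Longrightarrow> \<alpha> Y Z = - \<alpha> Z Y"
  by (force simp: Lambda2_def eq_neg_iff_add_eq_0)

lemma Lambda2_same: "\<alpha> \<in> Lambda2 \<Longrightarrow> \<alpha> Y Y = 0"
  using Lambda2_skew[of \<alpha> Y Y] by simp

definition minor2 :: "5 \<Rightarrow> 5 \<Rightarrow> form2" where
  "minor2 a b Y Z = Y $ a * Z $ b - Y $ b * Z $ a"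

lemma Lambda2_expand:
  assumes "\<alpha> \<in> Lambda2"
  shows "\<alpha> Y Z =
     \<alpha> (ebas 1) (ebas 2) * minor2 1 2 Y Z + \<alpha> (ebas 1) (ebas 3) * minor2 1 3 Y Z + \<alpha> (ebas 1) (ebas 4) * minor2 1 4 Y Z + \<alpha> (ebas 1) (ebas 5) * minor2 1 5 Y Z + \<alpha> (ebas 2) (ebas 3) * minor2 2 3 Y Z + \<alpha> (ebas 2) (ebas 4) * minor2 2 4 Y Z + \<alpha> (ebas 2) (ebas 5) * minor2 2 5 Y Z + \<alpha> (ebas 3) (ebas 4) * minor2 3 4 Y Z + \<alpha> (ebas 3) (ebas 5) * minor2 3 5 Y Z + \<alpha> (ebas 4) (ebas 5) * minor2 4 5 Y Z"
proof -
  have b: "bilinear \<alpha>" using assms by (simp add: Lambda2_def)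
  note sk = Lambda2_skew[OF assms]
  show ?thesis
    unfolding bilinear_expand[OF b, of Y Z] sum_5 minor2_def
    using sk[of "ebas 2" "ebas 1"] sk[of "ebas 3" "ebas 1"] sk[of "ebas 4" "ebas 1"] sk[of "ebas 5" "ebas 1"] sk[of "ebas 3" "ebas 2"] sk[of "ebas 4" "ebas 2"] sk[of "ebas 5" "ebas 2"] sk[of "ebas 4" "ebas 3"] sk[of "ebas 5" "ebas 3"] sk[of "ebas 5" "ebas 4"]
    by (simp add: Lambda2_same[OF assms] algebra_simps)
qed

lemma hodge2_expand:
  assumes "\<alpha> \<in> Lambda2"
  shows "hodge2 \<alpha> X Y Z =
     \<alpha> (ebas 1) (ebas 2) * minor3 3 4 5 X Y Z - \<alpha> (ebas 1) (ebas 3) * minor3 2 4 5 X Y Z + \<alpha> (ebas 1) (ebas 4) * minor3 2 3 5 X Y Z - \<alpha> (ebas 1) (ebas 5) * minor3 2 3 4 X Y Z + \<alpha> (ebas 2) (ebas 3) * minor3 1 4 5 X Y Z - \<alpha> (ebas 2) (ebas 4) * minor3 1 3 5 X Y Z + \<alpha> (ebas 2) (ebas 5) * minor3 1 3 4 X Y Z + \<alpha> (ebas 3) (ebas 4) * minor3 1 2 5 X Y Z - \<alpha> (ebas 3) (ebas 5) * minor3 1 2 4 X Y Z + \<alpha> (ebas 4) (ebas 5) * minor3 1 2 3 X Y Z"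
proof -
  note sk = Lambda2_skew[OF assms]
  note vs = vol5_swap[of _ _ X Y Z]
  show ?thesis
    unfolding hodge2_def sum_5
    using sk[of "ebas 2" "ebas 1"] sk[of "ebas 3" "ebas 1"] sk[of "ebas 4" "ebas 1"] sk[of "ebas 5" "ebas 1"] sk[of "ebas 3" "ebas 2"] sk[of "ebas 4" "ebas 2"] sk[of "ebas 5" "ebas 2"] sk[of "ebas 4" "ebas 3"] sk[of "ebas 5" "ebas 3"] sk[of "ebas 5" "ebas 4"]
      vs[of "ebas 2" "ebas 1"] vs[of "ebas 3" "ebas 1"] vs[of "ebas 4" "ebas 1"] vs[of "ebas 5" "ebas 1"] vs[of "ebas 3" "ebas 2"] vs[of "ebas 4" "ebas 2"] vs[of "ebas 5" "ebas 2"] vs[of "ebas 4" "ebas 3"] vs[of "ebas 5" "ebas 3"] vs[of "ebas 5" "ebas 4"]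
    by (simp add: Lambda2_same[OF assms] vol5_ebas)
qed

text \<open>The order on the index type puts \<open>5\<close> below \<open>1\<close>, so the ordered
  pairs summed on the left are not those listed on the right. For symmetric f only unordered pairs
  matter: the full square without its diagonal counts each of them twice.\<close>

lemma sum_less_symmetric:
  fixes f :: "5 \<Rightarrow> 5 \<Rightarrow> real"
  assumes "\<And>i j. f i j = f j i"
  shows "(\<Sum>(i, j) \<in> {(i, j). i < j}. f i j) =
    f 1 2 + f 1 3 + f 1 4 + f 1 5 + f 2 3 + f 2 4 + f 2 5 + f 3 4 + f 3 5 + f 4 5"
proof -
  let ?S = "{(i, j). i < j} :: (5 \<times> 5) set" and ?S' = "{(i, j). j < i} :: (5 \<times> 5) set"
    and ?D = "{(i, j). i = j} :: (5 \<times> 5) set" and ?f = "\<lambda>(i, j). f i j"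
  have "sum ?f ?S' = sum ?f ?S"
    by (rule sum.reindex_bij_witness[of _ prod.swap prod.swap]) (use assms in auto)
  moreover have "sum ?f ?D = (\<Sum>i\<in>UNIV. f i i)"
    by (rule sum.reindex_bij_witness[of _ "\<lambda>i. (i, i)" fst]) auto
  moreover have "sum ?f UNIV = sum ?f ?S + sum ?f ?S' + sum ?f ?D"
  proof -
    have "sum ?f (?S \<union> ?S' \<union> ?D) = sum ?f (?S \<union> ?S') + sum ?f ?D"
      by (rule sum.union_disjoint) auto
    also have "sum ?f (?S \<union> ?S') = sum ?f ?S + sum ?f ?S'"
      by (rule sum.union_disjoint) auto
    also have "?S \<union> ?S' \<union> ?D = UNIV" by auto
    finally show ?thesis .
  qed
  moreover have "sum ?f UNIV = (\<Sum>i\<in>UNIV. \<Sum>j\<in>UNIV. f i j)"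
    by (simp add: sum.cartesian_product flip: UNIV_Times_UNIV)
  ultimately have "2 * sum ?f ?S = (\<Sum>i\<in>UNIV. \<Sum>j\<in>UNIV. f i j) - (\<Sum>i\<in>UNIV. f i i)"
    by simp
  then show ?thesis
    using assms[of 2 1] assms[of 3 1] assms[of 4 1] assms[of 5 1] assms[of 3 2] assms[of 4 2]
      assms[of 5 2] assms[of 4 3] assms[of 5 3] assms[of 5 4]
    by (simp add: sum_5)
qed

section \<open>2-forms by coefficients and the subspaces of \<Lambda>^2\<close>

text \<open>Ten coefficients in lexicographic order of the index pairs. Subspaces of 2-forms turn
  into patterns of arguments, and identities between forms into polynomial identities for the
  simplifier.\<close>

definition comb2 :: "real \<Rightarrow> real \<Rightarrow> real \<Rightarrow> real \<Rightarrow> real \<Rightarrow> real \<Rightarrow> real \<Rightarrow> real \<Rightarrow> real \<Rightarrow> real \<Rightarrow> form2" where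
  "comb2 c12 c13 c14 c15 c23 c24 c25 c34 c35 c45 Y Z =
     c12 * minor2 1 2 Y Z + c13 * minor2 1 3 Y Z + c14 * minor2 1 4 Y Z + c15 * minor2 1 5 Y Z
   + c23 * minor2 2 3 Y Z + c24 * minor2 2 4 Y Z + c25 * minor2 2 5 Y Z + c34 * minor2 3 4 Y Z
   + c35 * minor2 3 5 Y Z + c45 * minor2 4 5 Y Z"

lemma comb2_Lambda2 [simp]: "comb2 c12 c13 c14 c15 c23 c24 c25 c34 c35 c45 \<in> Lambda2"
  unfolding Lambda2_def bilinear_def mem_Collect_eq
  by (intro conjI allI linearI) (simp_all add: comb2_def minor2_def algebra_simps)

lemma comb2_ebas:
  "comb2 c12 c13 c14 c15 c23 c24 c25 c34 c35 c45 (ebas 1) (ebas 2) = c12"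
  "comb2 c12 c13 c14 c15 c23 c24 c25 c34 c35 c45 (ebas 1) (ebas 3) = c13"
  "comb2 c12 c13 c14 c15 c23 c24 c25 c34 c35 c45 (ebas 1) (ebas 4) = c14"
  "comb2 c12 c13 c14 c15 c23 c24 c25 c34 c35 c45 (ebas 1) (ebas 5) = c15"
  "comb2 c12 c13 c14 c15 c23 c24 c25 c34 c35 c45 (ebas 2) (ebas 3) = c23"
  "comb2 c12 c13 c14 c15 c23 c24 c25 c34 c35 c45 (ebas 2) (ebas 4) = c24"
  "comb2 c12 c13 c14 c15 c23 c24 c25 c34 c35 c45 (ebas 2) (ebas 5) = c25"
  "comb2 c12 c13 c14 c15 c23 c24 c25 c34 c35 c45 (ebas 3) (ebas 4) = c34"
  "comb2 c12 c13 c14 c15 c23 c24 c25 c34 c35 c45 (ebas 3) (ebas 5) = c35"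
  "comb2 c12 c13 c14 c15 c23 c24 c25 c34 c35 c45 (ebas 4) (ebas 5) = c45"
  by (simp_all add: comb2_def minor2_def ebas_nth)

lemma Lambda2_eq_comb2:
  assumes "\<alpha> \<in> Lambda2"
  shows "\<alpha> = comb2 (\<alpha> (ebas 1) (ebas 2)) (\<alpha> (ebas 1) (ebas 3)) (\<alpha> (ebas 1) (ebas 4)) (\<alpha> (ebas 1) (ebas 5))
    (\<alpha> (ebas 2) (ebas 3)) (\<alpha> (ebas 2) (ebas 4)) (\<alpha> (ebas 2) (ebas 5)) (\<alpha> (ebas 3) (ebas 4))
    (\<alpha> (ebas 3) (ebas 5)) (\<alpha> (ebas 4) (ebas 5))"
  by (intro ext) (unfold comb2_def, rule Lambda2_expand[OF assms])

lemma hodge2_comb2: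
  "hodge2 (comb2 c12 c13 c14 c15 c23 c24 c25 c34 c35 c45) X Y Z =
     c12 * minor3 3 4 5 X Y Z - c13 * minor3 2 4 5 X Y Z + c14 * minor3 2 3 5 X Y Z
   - c15 * minor3 2 3 4 X Y Z + c23 * minor3 1 4 5 X Y Z - c24 * minor3 1 3 5 X Y Z
   + c25 * minor3 1 3 4 X Y Z + c34 * minor3 1 2 5 X Y Z - c35 * minor3 1 2 4 X Y Z
   + c45 * minor3 1 2 3 X Y Z"
  by (simp add: hodge2_expand comb2_ebas)

lemma Phi0_nth: "Phi0 X Y = X $ 1 * Y $ 2 - X $ 2 * Y $ 1 + X $ 3 * Y $ 4 - X $ 4 * Y $ 3"
  by (simp add: Phi0_def inner_vec_def sum_5)

lemma Lambda2_1_eq: "Lambda2_1 = {comb2 t 0 0 0 0 0 0 t 0 0 | t. True}"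
proof -
  have "(\<lambda>X Y. t * Phi0 X Y) = comb2 t 0 0 0 0 0 0 t 0 0" for t
    by (intro ext) (simp add: Phi0_nth comb2_def minor2_def algebra_simps)
  then show ?thesis by (simp add: Lambda2_1_def)
qed

lemma Lambda2_2_eq: "Lambda2_2 = {comb2 0 a b 0 b (- a) 0 0 0 0 | a b. True}"
proof (intro set_eqI iffI)
  fix \<alpha> assume "\<alpha> \<in> Lambda2_2"
  then have \<alpha>: "\<alpha> \<in> Lambda2" and w: "wedge22 Phi0 \<alpha> = 0" and h: "hodge2 \<alpha> = wedge12 eta0 \<alpha>"
    by (auto simp: Lambda2_2_def)
  have h': "hodge2 \<alpha> (ebas i) (ebas j) (ebas k) = wedge12 eta0 \<alpha> (ebas i) (ebas j) (ebas k)" for i j k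
    by (simp add: h)
  have "wedge22 Phi0 \<alpha> (ebas 1) (ebas 2) (ebas 3) (ebas 4) = 0"
    by (simp add: w)
  then have "\<alpha> (ebas 1) (ebas 2) + \<alpha> (ebas 3) (ebas 4) = 0"
    by (simp add: wedge22_def Phi0_nth ebas_nth)
  \<comment> \<open>Triples containing \<open>5\<close> compare complementary coefficients, so those
    at 12 and 34 agree and, having sum 0, vanish. On the other triples \<eta> \<and> \<alpha> is 0,
    which kills the coefficients at all pairs i5.\<close>
  with h'[of 1 2 5] h'[of 1 3 5] h'[of 1 4 5] h'[of 2 3 4] h'[of 1 3 4] h'[of 1 2 4] h'[of 1 2 3]
  have "\<alpha> (ebas 1) (ebas 2) = 0" "\<alpha> (ebas 3) (ebas 4) = 0" "\<alpha> (ebas 2) (ebas 4) = - \<alpha> (ebas 1) (ebas 3)"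
    "\<alpha> (ebas 2) (ebas 3) = \<alpha> (ebas 1) (ebas 4)" "\<alpha> (ebas 1) (ebas 5) = 0" "\<alpha> (ebas 2) (ebas 5) = 0"
    "\<alpha> (ebas 3) (ebas 5) = 0" "\<alpha> (ebas 4) (ebas 5) = 0"
    by (simp_all add: hodge2_expand[OF \<alpha>] minor3_def wedge12_def eta0_nth ebas_nth)
  then have "\<alpha> = comb2 0 (\<alpha> (ebas 1) (ebas 3)) (\<alpha> (ebas 1) (ebas 4)) 0 (\<alpha> (ebas 1) (ebas 4))
      (- \<alpha> (ebas 1) (ebas 3)) 0 0 0 0"
    using Lambda2_eq_comb2[OF \<alpha>] by metis
  then show "\<alpha> \<in> {comb2 0 a b 0 b (- a) 0 0 0 0 | a b. True}" by blast
next
  fix \<alpha> assume "\<alpha> \<in> {comb2 0 a b 0 b (- a) 0 0 0 0 | a b. True}"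
  then obtain a b where \<alpha>: "\<alpha> = comb2 0 a b 0 b (- a) 0 0 0 0" by blast
  have "hodge2 \<alpha> = wedge12 eta0 \<alpha>"
    by (intro ext) (simp add: \<alpha> hodge2_comb2 wedge12_def eta0_nth comb2_def minor2_def minor3_def algebra_simps)
  moreover have "wedge22 Phi0 \<alpha> = 0"
    by (intro ext) (simp add: \<alpha> wedge22_def Phi0_nth comb2_def minor2_def algebra_simps)
  ultimately show "\<alpha> \<in> Lambda2_2" by (simp add: Lambda2_2_def \<alpha>)
qed

lemma Lambda2_3_eq: "Lambda2_3 = {comb2 a b c 0 (- c) b 0 (- a) 0 0 | a b c. True}"
proof (intro set_eqI iffI)
  fix \<alpha> assume "\<alpha> \<in> Lambda2_3"
  then have \<alpha>: "\<alpha> \<in> Lambda2" and h: "hodge2 \<alpha> = - wedge12 eta0 \<alpha>"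
    by (auto simp: Lambda2_3_def)
  have h': "hodge2 \<alpha> (ebas i) (ebas j) (ebas k) = - wedge12 eta0 \<alpha> (ebas i) (ebas j) (ebas k)" for i j k
    by (simp add: h)
  from h'[of 1 2 5] h'[of 1 3 5] h'[of 1 4 5] h'[of 2 3 4] h'[of 1 3 4] h'[of 1 2 4] h'[of 1 2 3]
  have "\<alpha> = comb2 (\<alpha> (ebas 1) (ebas 2)) (\<alpha> (ebas 1) (ebas 3)) (\<alpha> (ebas 1) (ebas 4)) 0
      (- \<alpha> (ebas 1) (ebas 4)) (\<alpha> (ebas 1) (ebas 3)) 0 (- \<alpha> (ebas 1) (ebas 2)) 0 0"
    by (subst Lambda2_eq_comb2[OF \<alpha>])
       (simp add: hodge2_expand[OF \<alpha>] minor3_def wedge12_def eta0_nth ebas_nth)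
  then show "\<alpha> \<in> {comb2 a b c 0 (- c) b 0 (- a) 0 0 | a b c. True}" by blast
next
  fix \<alpha> assume "\<alpha> \<in> {comb2 a b c 0 (- c) b 0 (- a) 0 0 | a b c. True}"
  then obtain a b c where \<alpha>: "\<alpha> = comb2 a b c 0 (- c) b 0 (- a) 0 0" by blast
  have "hodge2 \<alpha> = - wedge12 eta0 \<alpha>"
    by (intro ext) (simp add: \<alpha> hodge2_comb2 wedge12_def eta0_nth comb2_def minor2_def minor3_def algebra_simps)
  then show "\<alpha> \<in> Lambda2_3" by (simp add: Lambda2_3_def \<alpha>)
qed

lemma Lambda2_4_eq: "Lambda2_4 = {comb2 0 0 0 a 0 0 b 0 c d | a b c d. True}"
proof (intro set_eqI iffI)
  fix \<alpha> assume "\<alpha> \<in> Lambda2_4"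
  then have \<alpha>: "\<alpha> \<in> Lambda2" and w: "wedge12 eta0 \<alpha> = 0"
    by (auto simp: Lambda2_4_def)
  have w': "wedge12 eta0 \<alpha> (ebas i) (ebas j) (ebas 5) = 0" for i j
    by (simp add: w)
  from w'[of 1 2] w'[of 1 3] w'[of 1 4] w'[of 2 3] w'[of 2 4] w'[of 3 4]
  have "\<alpha> = comb2 0 0 0 (\<alpha> (ebas 1) (ebas 5)) 0 0 (\<alpha> (ebas 2) (ebas 5)) 0 (\<alpha> (ebas 3) (ebas 5)) (\<alpha> (ebas 4) (ebas 5))"
    by (subst Lambda2_eq_comb2[OF \<alpha>]) (simp add: wedge12_def eta0_nth ebas_nth)
  then show "\<alpha> \<in> {comb2 0 0 0 a 0 0 b 0 c d | a b c d. True}" by blast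
next
  fix \<alpha> assume "\<alpha> \<in> {comb2 0 0 0 a 0 0 b 0 c d | a b c d. True}"
  then obtain a b c d where \<alpha>: "\<alpha> = comb2 0 0 0 a 0 0 b 0 c d" by blast
  have "wedge12 eta0 \<alpha> = 0"
    by (intro ext) (simp add: \<alpha> wedge12_def eta0_nth comb2_def minor2_def algebra_simps)
  then show "\<alpha> \<in> Lambda2_4" by (simp add: Lambda2_4_def \<alpha>)
qed

lemma m_space_eq: "m_space = {comb2 0 a b r1 b (- a) r2 0 r3 r4 | a b r1 r2 r3 r4. True}"
proof -
  have "comb2 0 a b 0 b (- a) 0 0 0 0 + comb2 0 0 0 r1 0 0 r2 0 r3 r4 = comb2 0 a b r1 b (- a) r2 0 r3 r4"
    for a b r1 r2 r3 r4
    by (intro ext) (simp add: comb2_def)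
  then show ?thesis
    unfolding m_space_def Lambda2_2_eq Lambda2_4_eq set_plus_def
    by (auto; metis)
qed

lemma inner2_Lambda2:
  assumes "\<alpha> \<in> Lambda2" "\<beta> \<in> Lambda2"
  shows "inner2 \<alpha> \<beta> =
    \<alpha> (ebas 1) (ebas 2) * \<beta> (ebas 1) (ebas 2) + \<alpha> (ebas 1) (ebas 3) * \<beta> (ebas 1) (ebas 3)
  + \<alpha> (ebas 1) (ebas 4) * \<beta> (ebas 1) (ebas 4) + \<alpha> (ebas 1) (ebas 5) * \<beta> (ebas 1) (ebas 5)
  + \<alpha> (ebas 2) (ebas 3) * \<beta> (ebas 2) (ebas 3) + \<alpha> (ebas 2) (ebas 4) * \<beta> (ebas 2) (ebas 4)
  + \<alpha> (ebas 2) (ebas 5) * \<beta> (ebas 2) (ebas 5) + \<alpha> (ebas 3) (ebas 4) * \<beta> (ebas 3) (ebas 4)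
  + \<alpha> (ebas 3) (ebas 5) * \<beta> (ebas 3) (ebas 5) + \<alpha> (ebas 4) (ebas 5) * \<beta> (ebas 4) (ebas 5)"
  unfolding inner2_def
proof (rule sum_less_symmetric)
  show "\<alpha> (ebas i) (ebas j) * \<beta> (ebas i) (ebas j) = \<alpha> (ebas j) (ebas i) * \<beta> (ebas j) (ebas i)" for i j
    using Lambda2_skew[OF assms(1), of "ebas i" "ebas j"] Lambda2_skew[OF assms(2), of "ebas i" "ebas j"]
    by simp
qed

lemma comb2_diff:
  "comb2 c12 c13 c14 c15 c23 c24 c25 c34 c35 c45 - comb2 d12 d13 d14 d15 d23 d24 d25 d34 d35 d45 =
   comb2 (c12 - d12) (c13 - d13) (c14 - d14) (c15 - d15) (c23 - d23) (c24 - d24) (c25 - d25)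
     (c34 - d34) (c35 - d35) (c45 - d45)"
  by (intro ext) (simp add: comb2_def algebra_simps)

section \<open>The orthogonal projection onto the complement of u(2)\<close>

lemma pr_m_comb2:
  "pr_m (comb2 c12 c13 c14 c15 c23 c24 c25 c34 c35 c45) =
   comb2 0 ((c13 - c24) / 2) ((c14 + c23) / 2) c15 ((c14 + c23) / 2) (- ((c13 - c24) / 2)) c25 0 c35 c45"
  (is "pr_m ?\<alpha> = ?\<beta>")
  unfolding pr_m_def
proof (rule the_equality)
  show "?\<beta> \<in> m_space \<and> (\<forall>\<gamma>\<in>m_space. inner2 (?\<alpha> - ?\<beta>) \<gamma> = 0)"
  proof
    show "?\<beta> \<in> m_space" unfolding m_space_eq by blast
    show "\<forall>\<gamma>\<in>m_space. inner2 (?\<alpha> - ?\<beta>) \<gamma> = 0"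
      by (auto simp: m_space_eq comb2_diff inner2_Lambda2 comb2_ebas field_simps)
  qed
next
  fix \<beta> assume \<beta>: "\<beta> \<in> m_space \<and> (\<forall>\<gamma>\<in>m_space. inner2 (?\<alpha> - \<beta>) \<gamma> = 0)"
  then obtain a b r1 r2 r3 r4 where ab: "\<beta> = comb2 0 a b r1 b (- a) r2 0 r3 r4"
    by (auto simp: m_space_eq)
  have "inner2 (?\<alpha> - \<beta>) (comb2 0 a' b' s1 b' (- a') s2 0 s3 s4) = 0" for a' b' s1 s2 s3 s4
    using \<beta> unfolding m_space_eq by blast
  \<comment> \<open>Orthogonality is tested on the six basis vectors of \<open>m_space\<close>. The
    two in \<open>Lambda2_2\<close> have squared norm 2, whence the halves.\<close>
  from this[of 1 0 0 0 0 0] this[of 0 1 0 0 0 0] this[of 0 0 1 0 0 0] this[of 0 0 0 1 0 0]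
    this[of 0 0 0 0 1 0] this[of 0 0 0 0 0 1]
  have "a = (c13 - c24) / 2" "b = (c14 + c23) / 2" "r1 = c15" "r2 = c25" "r3 = c35" "r4 = c45"
    by (simp_all add: ab comb2_diff inner2_Lambda2 comb2_ebas)
  then show "\<beta> = ?\<beta>" by (simp only: ab)
qed

lemma pr_m_Lambda2:
  assumes "\<alpha> \<in> Lambda2"
  shows "pr_m \<alpha> =
    comb2 0 ((\<alpha> (ebas 1) (ebas 3) - \<alpha> (ebas 2) (ebas 4)) / 2)
      ((\<alpha> (ebas 1) (ebas 4) + \<alpha> (ebas 2) (ebas 3)) / 2) (\<alpha> (ebas 1) (ebas 5))
      ((\<alpha> (ebas 1) (ebas 4) + \<alpha> (ebas 2) (ebas 3)) / 2)
      (- ((\<alpha> (ebas 1) (ebas 3) - \<alpha> (ebas 2) (ebas 4)) / 2))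
      (\<alpha> (ebas 2) (ebas 5)) 0 (\<alpha> (ebas 3) (ebas 5)) (\<alpha> (ebas 4) (ebas 5))"
  by (subst Lambda2_eq_comb2[OF assms]) (simp only: pr_m_comb2)

section \<open>Components of intrinsic torsion\<close>

abbreviation comp3 :: "tensor3 \<Rightarrow> 5 \<Rightarrow> 5 \<Rightarrow> 5 \<Rightarrow> real" where
  "comp3 A k i j \<equiv> A (ebas k) (ebas i) (ebas j)"

text \<open>
  The predicates \<open>no_Wi A\<close> say that the component of \<open>pr_W A\<close> in \<open>\<W>\<^sub>i\<close> vanishes; \<open>\<W>\<^sub>4\<close> and \<open>\<W>\<^sub>7\<close> are isomorphic
  and only occur together. The equations come from solving for the coefficients of \<open>A\<close> with respect
  to explicit bases of the ten summands.
\<close>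

definition no_W2 :: "tensor3 \<Rightarrow> bool" where
  "no_W2 A \<longleftrightarrow> comp3 A 5 1 5 = 0 \<and> comp3 A 5 2 5 = 0 \<and> comp3 A 5 3 5 = 0 \<and> comp3 A 5 4 5 = 0"

text \<open>The two copies of \<open>Lambda2_2\<close>: the first line says that A(\<xi>) has no
  part in it, the other two lines say the same of the skew-symmetrisation A(X, Y, \<xi>) - A(Y, X,
  \<xi>), which for a connection form is - d\<eta>(X, Y).\<close>

definition no_W47 :: "tensor3 \<Rightarrow> bool" where
  "no_W47 A \<longleftrightarrow> comp3 A 5 1 3 = comp3 A 5 2 4 \<and> comp3 A 5 1 4 = - comp3 A 5 2 3
    \<and> comp3 A 1 4 5 + comp3 A 2 3 5 - comp3 A 3 2 5 - comp3 A 4 1 5 = 0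
    \<and> - comp3 A 1 3 5 + comp3 A 2 4 5 + comp3 A 3 1 5 - comp3 A 4 2 5 = 0"

text \<open>With p = A_13 - A_24, q = A_14 + A_23 and f = p + i q, these are the Cauchy-Riemann
  equations f(e_4) = i f(e_3) and f(e_2) = i f(e_1). They hold on \<open>W6\<close>, while
  \<open>W9\<close> has the opposite type.\<close>

definition no_W9 :: "tensor3 \<Rightarrow> bool" where
  "no_W9 A \<longleftrightarrow> comp3 A 3 1 3 - comp3 A 3 2 4 = comp3 A 4 1 4 + comp3 A 4 2 3
    \<and> comp3 A 3 1 4 + comp3 A 3 2 3 = - (comp3 A 4 1 3 - comp3 A 4 2 4)
    \<and> comp3 A 1 1 3 - comp3 A 1 2 4 = comp3 A 2 1 4 + comp3 A 2 2 3
    \<and> comp3 A 1 1 4 + comp3 A 1 2 3 = - (comp3 A 2 1 3 - comp3 A 2 2 4)"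

text \<open>Says that the symmetric part s of (X, Y) |-> A(X, Y, \<xi>) on horizontal vectors is
  \<phi>-invariant: s(\<phi>X, \<phi>Y) = s(X, Y).\<close>

definition no_W10 :: "tensor3 \<Rightarrow> bool" where
  "no_W10 A \<longleftrightarrow> comp3 A 1 1 5 = comp3 A 2 2 5 \<and> comp3 A 3 3 5 = comp3 A 4 4 5
    \<and> comp3 A 1 2 5 + comp3 A 2 1 5 = 0 \<and> comp3 A 3 4 5 + comp3 A 4 3 5 = 0
    \<and> comp3 A 1 4 5 + comp3 A 2 3 5 + comp3 A 3 2 5 + comp3 A 4 1 5 = 0
    \<and> comp3 A 1 3 5 - comp3 A 2 4 5 + comp3 A 3 1 5 - comp3 A 4 2 5 = 0"

lemmas no_W_defs = no_W2_def no_W47_def no_W9_def no_W10_def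

lemma no_W_add:
  "no_W2 A \<Longrightarrow> no_W2 B \<Longrightarrow> no_W2 (A + B)"
  "no_W47 A \<Longrightarrow> no_W47 B \<Longrightarrow> no_W47 (A + B)"
  "no_W9 A \<Longrightarrow> no_W9 B \<Longrightarrow> no_W9 (A + B)"
  "no_W10 A \<Longrightarrow> no_W10 B \<Longrightarrow> no_W10 (A + B)"
  by (auto simp: no_W_defs)

lemma A_space_Lambda2: "A \<in> A_space \<Longrightarrow> A X \<in> Lambda2"
  by (simp add: A_space_def Lambda2_def)

lemma A_space_linear: "A \<in> A_space \<Longrightarrow> linear (\<lambda>X. A X Y Z)"
  by (simp add: A_space_def)

lemma A_space_expand: "A \<in> A_space \<Longrightarrow> A X Y Z = (\<Sum>i\<in>UNIV. X $ i * A (ebas i) Y Z)"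
proof -
  assume "A \<in> A_space"
  then have l: "linear (\<lambda>X. A X Y Z)" by (simp add: A_space_def)
  have "A X Y Z = A (\<Sum>i\<in>UNIV. X $ i *\<^sub>R ebas i) Y Z"
    using ebas_expand by metis
  also have "\<dots> = (\<Sum>i\<in>UNIV. X $ i * A (ebas i) Y Z)"
    by (simp add: linear_sum[OF l] linear_cmul[OF l])
  finally show ?thesis .
qed

text \<open>
  The general element of \<open>\<W>\<close>: \<open>p\<close> and \<open>q\<close> are the coefficients along the basis
  \<open>e\<^sub>1 \<and> e\<^sub>3 - e\<^sub>2 \<and> e\<^sub>4\<close>, \<open>e\<^sub>1 \<and> e\<^sub>4 + e\<^sub>2 \<and> e\<^sub>3\<close> of \<open>\<Lambda>\<^sup>2\<^sub>2\<close>, and \<open>ri\<close> the one along \<open>e\<^sub>i \<and> e\<^sub>5\<close>.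
\<close>

definition tor :: "form1 \<Rightarrow> form1 \<Rightarrow> form1 \<Rightarrow> form1 \<Rightarrow> form1 \<Rightarrow> form1 \<Rightarrow> tensor3" where
  "tor p q r1 r2 r3 r4 X = comb2 0 (p X) (q X) (r1 X) (q X) (- p X) (r2 X) 0 (r3 X) (r4 X)"

lemma pr_W_eq_tor:
  assumes "A \<in> A_space"
  shows "pr_W A = tor (\<lambda>X. (A X (ebas 1) (ebas 3) - A X (ebas 2) (ebas 4)) / 2)
    (\<lambda>X. (A X (ebas 1) (ebas 4) + A X (ebas 2) (ebas 3)) / 2)
    (\<lambda>X. A X (ebas 1) (ebas 5)) (\<lambda>X. A X (ebas 2) (ebas 5)) (\<lambda>X. A X (ebas 3) (ebas 5))
    (\<lambda>X. A X (ebas 4) (ebas 5))"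
  unfolding pr_W_def tor_def by (intro ext) (simp only: pr_m_Lambda2[OF A_space_Lambda2[OF assms]])

text \<open>The predicates only involve the coefficients at i5, which \<open>pr_m\<close> keeps, and
  the combinations A_13 - A_24 and A_14 + A_23, which it preserves. Hence they can be read off the
  connection form as well as off the torsion.\<close>

lemma no_W_pr_W:
  assumes "A \<in> A_space"
  shows "no_W2 (pr_W A) = no_W2 A" "no_W47 (pr_W A) = no_W47 A" "no_W9 (pr_W A) = no_W9 A" "no_W10 (pr_W A) = no_W10 A"
  by (simp_all add: no_W_defs pr_W_eq_tor[OF assms] tor_def comb2_ebas) linarith

lemma A_spaceI:
  assumes "\<And>X. A X \<in> Lambda2" "\<And>Y Z. linear (\<lambda>X. A X Y Z)"
  shows "A \<in> A_space"
  using assms by (simp add: A_space_def Lambda2_def)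

lemma theta1_A_space: "linear \<alpha> \<Longrightarrow> theta1 \<alpha> \<in> A_space"
  unfolding A_space_def bilinear_def mem_Collect_eq
  by (intro conjI allI linearI) (simp_all add: theta1_def linear_add linear_cmul algebra_simps)

text \<open>The sum over i merely expands the first argument in the basis, so \<theta>_2 is the
  inclusion of 3-forms into the trilinear maps.\<close>

lemma theta2_hodge2_comb2:
  "theta2 (hodge2 (comb2 c12 c13 c14 c15 c23 c24 c25 c34 c35 c45)) =
   hodge2 (comb2 c12 c13 c14 c15 c23 c24 c25 c34 c35 c45)"
  by (intro ext) (simp add: theta2_def hodge2_comb2 sum_5 inner_axis' minor3_def ebas_nth algebra_simps)

lemma hodge2_comb2_A_space: "hodge2 (comb2 c12 c13 c14 c15 c23 c24 c25 c34 c35 c45) \<in> A_space"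
  unfolding A_space_def bilinear_def mem_Collect_eq
  by (intro conjI allI linearI) (simp_all add: hodge2_comb2 minor3_def algebra_simps)

section \<open>Which conditions hold on each of the ten summands\<close>

lemma W1_components: "A \<in> W1 \<Longrightarrow> no_W2 A \<and> no_W47 A \<and> no_W9 A \<and> no_W10 A"
  by (auto simp: W1_def Lambda1_1_def theta1_def eta0_nth no_W_defs inner_axis' ebas_nth)

lemma W2_components: "A \<in> W2 \<Longrightarrow> no_W47 A \<and> no_W9 A \<and> no_W10 A"
  by (auto simp: W2_def Lambda1_2_def no_W_pr_W theta1_A_space)
     (simp_all add: theta1_def no_W_defs inner_axis' ebas_nth)

text \<open>A table restricted to the pairs 13, 24, 14, 23 and i5 in the last two slots, the only
  ones occurring in the \<open>no_W\<close> predicates.\<close>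

lemma hodge2_comb2_ebas:
  "hodge2 (comb2 c12 c13 c14 c15 c23 c24 c25 c34 c35 c45) (ebas 1) (ebas 1) (ebas 3) = 0"
  "hodge2 (comb2 c12 c13 c14 c15 c23 c24 c25 c34 c35 c45) (ebas 1) (ebas 2) (ebas 4) = - c35"
  "hodge2 (comb2 c12 c13 c14 c15 c23 c24 c25 c34 c35 c45) (ebas 1) (ebas 1) (ebas 4) = 0"
  "hodge2 (comb2 c12 c13 c14 c15 c23 c24 c25 c34 c35 c45) (ebas 1) (ebas 2) (ebas 3) = c45"
  "hodge2 (comb2 c12 c13 c14 c15 c23 c24 c25 c34 c35 c45) (ebas 1) (ebas 1) (ebas 5) = 0"
  "hodge2 (comb2 c12 c13 c14 c15 c23 c24 c25 c34 c35 c45) (ebas 1) (ebas 2) (ebas 5) = c34"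
  "hodge2 (comb2 c12 c13 c14 c15 c23 c24 c25 c34 c35 c45) (ebas 1) (ebas 3) (ebas 5) = - c24"
  "hodge2 (comb2 c12 c13 c14 c15 c23 c24 c25 c34 c35 c45) (ebas 1) (ebas 4) (ebas 5) = c23"
  "hodge2 (comb2 c12 c13 c14 c15 c23 c24 c25 c34 c35 c45) (ebas 2) (ebas 1) (ebas 3) = - c45"
  "hodge2 (comb2 c12 c13 c14 c15 c23 c24 c25 c34 c35 c45) (ebas 2) (ebas 2) (ebas 4) = 0"
  "hodge2 (comb2 c12 c13 c14 c15 c23 c24 c25 c34 c35 c45) (ebas 2) (ebas 1) (ebas 4) = c35"
  "hodge2 (comb2 c12 c13 c14 c15 c23 c24 c25 c34 c35 c45) (ebas 2) (ebas 2) (ebas 3) = 0"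
  "hodge2 (comb2 c12 c13 c14 c15 c23 c24 c25 c34 c35 c45) (ebas 2) (ebas 1) (ebas 5) = - c34"
  "hodge2 (comb2 c12 c13 c14 c15 c23 c24 c25 c34 c35 c45) (ebas 2) (ebas 2) (ebas 5) = 0"
  "hodge2 (comb2 c12 c13 c14 c15 c23 c24 c25 c34 c35 c45) (ebas 2) (ebas 3) (ebas 5) = c14"
  "hodge2 (comb2 c12 c13 c14 c15 c23 c24 c25 c34 c35 c45) (ebas 2) (ebas 4) (ebas 5) = - c13"
  "hodge2 (comb2 c12 c13 c14 c15 c23 c24 c25 c34 c35 c45) (ebas 3) (ebas 1) (ebas 3) = 0"
  "hodge2 (comb2 c12 c13 c14 c15 c23 c24 c25 c34 c35 c45) (ebas 3) (ebas 2) (ebas 4) = c15"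
  "hodge2 (comb2 c12 c13 c14 c15 c23 c24 c25 c34 c35 c45) (ebas 3) (ebas 1) (ebas 4) = - c25"
  "hodge2 (comb2 c12 c13 c14 c15 c23 c24 c25 c34 c35 c45) (ebas 3) (ebas 2) (ebas 3) = 0"
  "hodge2 (comb2 c12 c13 c14 c15 c23 c24 c25 c34 c35 c45) (ebas 3) (ebas 1) (ebas 5) = c24"
  "hodge2 (comb2 c12 c13 c14 c15 c23 c24 c25 c34 c35 c45) (ebas 3) (ebas 2) (ebas 5) = - c14"
  "hodge2 (comb2 c12 c13 c14 c15 c23 c24 c25 c34 c35 c45) (ebas 3) (ebas 3) (ebas 5) = 0"
  "hodge2 (comb2 c12 c13 c14 c15 c23 c24 c25 c34 c35 c45) (ebas 3) (ebas 4) (ebas 5) = c12"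
  "hodge2 (comb2 c12 c13 c14 c15 c23 c24 c25 c34 c35 c45) (ebas 4) (ebas 1) (ebas 3) = c25"
  "hodge2 (comb2 c12 c13 c14 c15 c23 c24 c25 c34 c35 c45) (ebas 4) (ebas 2) (ebas 4) = 0"
  "hodge2 (comb2 c12 c13 c14 c15 c23 c24 c25 c34 c35 c45) (ebas 4) (ebas 1) (ebas 4) = 0"
  "hodge2 (comb2 c12 c13 c14 c15 c23 c24 c25 c34 c35 c45) (ebas 4) (ebas 2) (ebas 3) = - c15"
  "hodge2 (comb2 c12 c13 c14 c15 c23 c24 c25 c34 c35 c45) (ebas 4) (ebas 1) (ebas 5) = - c23"
  "hodge2 (comb2 c12 c13 c14 c15 c23 c24 c25 c34 c35 c45) (ebas 4) (ebas 2) (ebas 5) = c13"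
  "hodge2 (comb2 c12 c13 c14 c15 c23 c24 c25 c34 c35 c45) (ebas 4) (ebas 3) (ebas 5) = - c12"
  "hodge2 (comb2 c12 c13 c14 c15 c23 c24 c25 c34 c35 c45) (ebas 4) (ebas 4) (ebas 5) = 0"
  "hodge2 (comb2 c12 c13 c14 c15 c23 c24 c25 c34 c35 c45) (ebas 5) (ebas 1) (ebas 3) = - c24"
  "hodge2 (comb2 c12 c13 c14 c15 c23 c24 c25 c34 c35 c45) (ebas 5) (ebas 2) (ebas 4) = - c13"
  "hodge2 (comb2 c12 c13 c14 c15 c23 c24 c25 c34 c35 c45) (ebas 5) (ebas 1) (ebas 4) = c23"
  "hodge2 (comb2 c12 c13 c14 c15 c23 c24 c25 c34 c35 c45) (ebas 5) (ebas 2) (ebas 3) = c14"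
  "hodge2 (comb2 c12 c13 c14 c15 c23 c24 c25 c34 c35 c45) (ebas 5) (ebas 1) (ebas 5) = 0"
  "hodge2 (comb2 c12 c13 c14 c15 c23 c24 c25 c34 c35 c45) (ebas 5) (ebas 2) (ebas 5) = 0"
  "hodge2 (comb2 c12 c13 c14 c15 c23 c24 c25 c34 c35 c45) (ebas 5) (ebas 3) (ebas 5) = 0"
  "hodge2 (comb2 c12 c13 c14 c15 c23 c24 c25 c34 c35 c45) (ebas 5) (ebas 4) (ebas 5) = 0"
  by (simp_all add: hodge2_comb2 minor3_def ebas_nth)

lemma W3_components:
  assumes "A \<in> W3"
  shows "no_W2 A \<and> no_W47 A \<and> no_W9 A \<and> no_W10 A"
proof -
  obtain t where "A = pr_W (theta2 (hodge2 (comb2 t 0 0 0 0 0 0 t 0 0)))"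
    using assms unfolding W3_def Lambda3_1_def Lambda2_1_eq by blast
  then have A: "A = pr_W (hodge2 (comb2 t 0 0 0 0 0 0 t 0 0))"
    by (simp only: theta2_hodge2_comb2)
  show ?thesis
    unfolding A no_W_pr_W[OF hodge2_comb2_A_space]
    by (simp add: no_W_defs hodge2_comb2_ebas)
qed

lemma W4_components:
  assumes "A \<in> W4"
  shows "no_W2 A \<and> no_W9 A \<and> no_W10 A"
proof -
  obtain a b where "A = theta2 (hodge2 (comb2 0 a b 0 b (- a) 0 0 0 0))"
    using assms unfolding W4_def Lambda3_2_def Lambda2_2_eq by blast
  then have A: "A = hodge2 (comb2 0 a b 0 b (- a) 0 0 0 0)"
    by (simp only: theta2_hodge2_comb2)
  show ?thesis
    unfolding A by (simp add: no_W_defs hodge2_comb2_ebas)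
qed

lemma W5_components:
  assumes "A \<in> W5"
  shows "no_W2 A \<and> no_W47 A \<and> no_W9 A \<and> no_W10 A"
proof -
  obtain a b c where "A = pr_W (theta2 (hodge2 (comb2 a b c 0 (- c) b 0 (- a) 0 0)))"
    using assms unfolding W5_def Lambda3_3_def Lambda2_3_eq by blast
  then have A: "A = pr_W (hodge2 (comb2 a b c 0 (- c) b 0 (- a) 0 0))"
    by (simp only: theta2_hodge2_comb2)
  show ?thesis
    unfolding A no_W_pr_W[OF hodge2_comb2_A_space]
    by (simp add: no_W_defs hodge2_comb2_ebas)
qed

lemma W6_components:
  assumes "A \<in> W6"
  shows "no_W2 A \<and> no_W47 A \<and> no_W9 A \<and> no_W10 A"
proof -
  obtain a b c d where "A = pr_W (theta2 (hodge2 (comb2 0 0 0 a 0 0 b 0 c d)))"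
    using assms unfolding W6_def Lambda3_4_def Lambda2_4_eq by blast
  then have A: "A = pr_W (hodge2 (comb2 0 0 0 a 0 0 b 0 c d))"
    by (simp only: theta2_hodge2_comb2)
  show ?thesis
    unfolding A no_W_pr_W[OF hodge2_comb2_A_space]
    by (simp add: no_W_defs hodge2_comb2_ebas)
qed

lemma theta3_comb2:
  "theta3 (comb2 0 a b 0 b (- a) 0 0 0 0) X Y Z =
    3 * X $ 5 * comb2 0 a b 0 b (- a) 0 0 0 0 Y Z
    - (X $ 5 * comb2 0 a b 0 b (- a) 0 0 0 0 Y Z - Y $ 5 * comb2 0 a b 0 b (- a) 0 0 0 0 X Z
      + Z $ 5 * comb2 0 a b 0 b (- a) 0 0 0 0 X Y)"
  by (simp add: theta3_def theta2_def wedge12_def eta0_nth sum_5 inner_axis' ebas_nth comb2_def minor2_def algebra_simps)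

lemma W7_components:
  assumes "A \<in> W7"
  shows "no_W2 A \<and> no_W9 A \<and> no_W10 A"
proof -
  obtain a b where A: "A = theta3 (comb2 0 a b 0 b (- a) 0 0 0 0)"
    using assms unfolding W7_def Lambda2_2_eq by blast
  show ?thesis
    unfolding A no_W_defs theta3_comb2 comb2_def minor2_def by (simp add: ebas_nth)
qed

lemma A_space_bilinear: "A \<in> A_space \<Longrightarrow> bilinear (A X)"
  by (simp add: A_space_def)

lemma A_space_zero:
  assumes "A \<in> A_space"
  shows "A 0 Y Z = 0" "A X 0 Z = 0" "A X Y 0 = 0"
  using linear_0[OF A_space_linear[OF assms]] bilinear_lzero[OF A_space_bilinear[OF assms]]
    bilinear_rzero[OF A_space_bilinear[OF assms]] by blast+

lemma A_space_neg:
  assumes "A \<in> A_space"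
  shows "A (- X) Y Z = - A X Y Z" "A X (- Y) Z = - A X Y Z" "A X Y (- Z) = - A X Y Z"
  using linear_neg[OF A_space_linear[OF assms]] bilinear_lneg[OF A_space_bilinear[OF assms]]
    bilinear_rneg[OF A_space_bilinear[OF assms]] by blast+

lemma A_space_skew: "A \<in> A_space \<Longrightarrow> A X Z Y = - A X Y Z"
  by (force simp: A_space_def eq_neg_iff_add_eq_0)

lemma A_space_same: "A \<in> A_space \<Longrightarrow> A X Y Y = 0"
  using A_space_skew[of A X Y Y] by simp

lemma comp3_sort:
  assumes "A \<in> A_space"
  shows "comp3 A k 2 1 = - comp3 A k 1 2" "comp3 A k 3 1 = - comp3 A k 1 3" "comp3 A k 4 1 = - comp3 A k 1 4"
    "comp3 A k 5 1 = - comp3 A k 1 5" "comp3 A k 3 2 = - comp3 A k 2 3" "comp3 A k 4 2 = - comp3 A k 2 4"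
    "comp3 A k 5 2 = - comp3 A k 2 5" "comp3 A k 4 3 = - comp3 A k 3 4" "comp3 A k 5 3 = - comp3 A k 3 5"
    "comp3 A k 5 4 = - comp3 A k 4 5"
  by (rule A_space_skew[OF assms])+

text \<open>Since \<open>phi0\<close> permutes the basis vectors up to sign and kills \<xi>, the
  defining relation on basis triples becomes a linear system for the components of A.\<close>

lemma W8_components:
  assumes "A \<in> W8"
  shows "no_W2 A \<and> no_W47 A \<and> no_W9 A \<and> no_W10 A"
proof -
  have A: "A \<in> A_space" and c: "\<And>X Y Z. A X Y Z = A (phi0 X) Y (phi0 Z) + A (phi0 X) (phi0 Y) Z"
    using assms unfolding W8_def A3_def by blast+
  note s = A_space_zero[OF A] A_space_neg[OF A]  A_space_same[OF A] comp3_sort[OF A]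
  have h: "comp3 A i j k = A (phi0 (ebas i)) (ebas j) (phi0 (ebas k)) + A (phi0 (ebas i)) (phi0 (ebas j)) (ebas k)" for i j k
    by (rule c)
  have "no_W2 A" using h[of 5 1 5] h[of 5 2 5] h[of 5 3 5] h[of 5 4 5] by (simp add: s no_W2_def)
  moreover have "no_W47 A"
    using h[of 5 1 3] h[of 5 2 4] h[of 5 1 4] h[of 5 2 3] h[of 1 4 5] h[of 3 2 5] h[of 1 3 5] h[of 3 1 5]
    unfolding no_W47_def by (intro conjI; simp (no_asm_use) add: s; linarith)
  \<comment> \<open>If L = R is one of the four equations of \<open>no_W9_def\<close>, the relation
    yields L = 2 R and R = 2 L, so both sides vanish.\<close>
  moreover have "no_W9 A"
    using h[of 3 1 3] h[of 3 2 4] h[of 4 1 4] h[of 4 2 3] h[of 3 1 4] h[of 3 2 3] h[of 4 1 3] h[of 4 2 4]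
     h[of 1 1 3] h[of 1 2 4] h[of 2 1 4] h[of 2 2 3] h[of 1 1 4] h[of 1 2 3] h[of 2 1 3] h[of 2 2 4]
    unfolding no_W9_def by (intro conjI; simp (no_asm_use) add: s; linarith)
  moreover have "no_W10 A"
    using h[of 1 1 5] h[of 3 3 5] h[of 1 2 5] h[of 3 4 5] h[of 1 4 5] h[of 3 2 5] h[of 1 3 5] h[of 3 1 5]
    unfolding no_W10_def by (intro conjI; simp (no_asm_use) add: s; linarith)
  ultimately show ?thesis by blast
qed

lemma W9_components:
  assumes "A \<in> W9"
  shows "no_W2 A \<and> no_W47 A \<and> no_W10 A"
proof -
  have A: "A \<in> A_space" and c: "\<And>X Y Z. A X Y Z = - A X (phi0 Y) (phi0 Z)"
    and cyc: "\<And>X Y Z. A X Y Z + A Y Z X + A Z X Y = 0"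
    using assms unfolding W9_def A3_def by blast+
  note s = A_space_zero[OF A] A_space_neg[OF A]  A_space_same[OF A] comp3_sort[OF A]
  \<comment> \<open>From \<phi>\<xi> = 0 the components A(X, Y, \<xi>) vanish; the cyclic identity
    then removes A(\<xi>, Y, Z), so that A is purely horizontal.\<close>
  have r: "A X Y (ebas 5) = 0" for X Y
    by (subst c) (simp add: s)
  have "A (ebas 5) Y Z = 0" for Y Z
    using cyc[of "ebas 5" Y Z] A_space_skew[OF A, of Z Y "ebas 5"] by (simp add: r)
  then show ?thesis by (simp add: r no_W_defs)
qed

lemma W10_components:
  assumes "A \<in> W10"
  shows "no_W2 A \<and> no_W47 A \<and> no_W9 A"
proof -
  have A: "A \<in> A_space" and c: "\<And>X Y Z. A X Y Z = - A (phi0 X) Y (phi0 Z) - A (phi0 X) (phi0 Y) Z"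
    and cyc: "\<And>X Y Z. A X Y Z + A Y Z X + A Z X Y = 0"
    using assms unfolding W10_def A3_def by blast+
  note s = A_space_zero[OF A] A_space_neg[OF A]  A_space_same[OF A] comp3_sort[OF A]
  have h: "comp3 A i j k = - A (phi0 (ebas i)) (ebas j) (phi0 (ebas k)) - A (phi0 (ebas i)) (phi0 (ebas j)) (ebas k)" for i j k
    by (rule c)
  have r: "A (ebas 5) Y Z = 0" for Y Z
    by (subst c) (simp add: s)
  \<comment> \<open>As A(\<xi>, Y, Z) = 0, the cyclic identity makes A(X, Y, \<xi>) symmetric in X
    and Y.\<close>
  have "no_W47 A"
    using cyc[of "ebas 5" "ebas 4" "ebas 1"] cyc[of "ebas 5" "ebas 3" "ebas 2"]
      cyc[of "ebas 5" "ebas 3" "ebas 1"] cyc[of "ebas 5" "ebas 4" "ebas 2"]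
    unfolding no_W47_def by (intro conjI; simp (no_asm_use) add: s r; linarith)
  \<comment> \<open>As for \<open>W8\<close>, here with L = - 2 R and R = - 2 L.\<close>
  moreover have "no_W9 A"
    using h[of 3 1 3] h[of 3 2 4] h[of 4 1 4] h[of 4 2 3] h[of 3 1 4] h[of 3 2 3] h[of 4 1 3] h[of 4 2 4]
     h[of 1 1 3] h[of 1 2 4] h[of 2 1 4] h[of 2 2 3] h[of 1 1 4] h[of 1 2 3] h[of 2 1 3] h[of 2 2 4]
    unfolding no_W9_def by (intro conjI; simp (no_asm_use) add: s; linarith)
  ultimately show ?thesis by (simp add: r no_W2_def)
qed

section \<open>The Nijenhuis tensor in terms of the connection form\<close>

text \<open>
  With \<open>A(X, Y, Z) = \<langle>\<nabla>\<^sub>XY, Z\<rangle>\<close> in a frame, the first eight terms are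
  \<open>\<langle>X, (\<nabla>\<^bsub>\<phi>Y\<^esub>\<phi>)Z - (\<nabla>\<^bsub>\<phi>Z\<^esub>\<phi>)Y - \<phi>(\<nabla>\<^sub>Y\<phi>)Z + \<phi>(\<nabla>\<^sub>Z\<phi>)Y\<rangle>\<close> and the last one is \<open>\<eta>(X) d\<eta>(Y, Z)\<close>.
\<close>

definition nij :: "tensor3 \<Rightarrow> tensor3" where
  "nij A X Y Z =
     A (phi0 Y) (phi0 Z) X + A (phi0 Y) Z (phi0 X) - A (phi0 Z) (phi0 Y) X - A (phi0 Z) Y (phi0 X)
   + A Y (phi0 Z) (phi0 X) + A Y Z (phi0 (phi0 X)) - A Z (phi0 Y) (phi0 X) - A Z Y (phi0 (phi0 X))
   + eta0 X * (A Y xi0 Z - A Z xi0 Y)"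

lemma A_space_add:
  assumes "A \<in> A_space"
  shows "A (X + X') Y Z = A X Y Z + A X' Y Z" "A X (Y + Y') Z = A X Y Z + A X Y' Z"
    "A X Y (Z + Z') = A X Y Z + A X Y Z'"
  using linear_add[OF A_space_linear[OF assms]] bilinear_ladd[OF A_space_bilinear[OF assms]]
    bilinear_radd[OF A_space_bilinear[OF assms]] by blast+

lemma A_space_scale:
  assumes "A \<in> A_space"
  shows "A (c *\<^sub>R X) Y Z = c * A X Y Z" "A X (c *\<^sub>R Y) Z = c * A X Y Z" "A X Y (c *\<^sub>R Z) = c * A X Y Z"
  using linear_cmul[OF A_space_linear[OF assms]] bilinear_lmul[OF A_space_bilinear[OF assms]]
    bilinear_rmul[OF A_space_bilinear[OF assms]] by (metis real_scaleR_def)+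

lemmas phi0_add = linear_add[OF phi0_linear] and phi0_scale = linear_cmul[OF phi0_linear]
  and phi0_neg = linear_neg[OF phi0_linear] and phi0_zero = linear_0[OF phi0_linear]

lemma nij_A_space:
  assumes A: "A \<in> A_space"
  shows "nij A \<in> A_space"
proof -
  note lin = phi0_add phi0_scale A_space_add[OF A] A_space_scale[OF A]
  have "linear (\<lambda>X. nij A X Y Z)" for Y Z
    by (rule linearI) (simp_all only: nij_def lin eta0_nth vector_add_component vector_scaleR_component real_scaleR_def, simp_all add: algebra_simps)
  moreover have "linear (\<lambda>Y. nij A X Y Z)" for X Z
    by (rule linearI) (simp_all only: nij_def lin real_scaleR_def, simp_all add: algebra_simps)
  moreover have "linear (\<lambda>Z. nij A X Y Z)" for X Y
    by (rule linearI) (simp_all only: nij_def lin real_scaleR_def, simp_all add: algebra_simps)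
  moreover have "nij A X Y Z + nij A X Z Y = 0" for X Y Z
    by (simp add: nij_def algebra_simps)
  ultimately show ?thesis
    unfolding A_space_def bilinear_def by blast
qed

text \<open>Every entry is a linear combination of the expressions that the \<open>no_W\<close>
  predicates set to 0; the repetitions up to sign are the symmetries required by
  \<open>N_space\<close>.\<close>

lemma nij_ebas:
  assumes A: "A \<in> A_space"
  shows
    "comp3 (nij A) 1 1 2 = 0"
    "comp3 (nij A) 1 1 3 = comp3 A 1 1 3 - comp3 A 1 2 4 - comp3 A 2 1 4 - comp3 A 2 2 3"
    "comp3 (nij A) 1 1 4 = comp3 A 1 1 4 + comp3 A 1 2 3 + comp3 A 2 1 3 - comp3 A 2 2 4"
    "comp3 (nij A) 1 1 5 = comp3 A 1 1 5 - comp3 A 2 2 5"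
    "comp3 (nij A) 1 2 3 = comp3 A 1 1 4 + comp3 A 1 2 3 + comp3 A 2 1 3 - comp3 A 2 2 4"
    "comp3 (nij A) 1 2 4 = - comp3 A 1 1 3 + comp3 A 1 2 4 + comp3 A 2 1 4 + comp3 A 2 2 3"
    "comp3 (nij A) 1 2 5 = comp3 A 1 2 5 + comp3 A 2 1 5"
    "comp3 (nij A) 1 3 4 = 0"
    "comp3 (nij A) 1 3 5 = comp3 A 3 1 5 - comp3 A 4 2 5 - comp3 A 5 1 3 + comp3 A 5 2 4"
    "comp3 (nij A) 1 4 5 = comp3 A 3 2 5 + comp3 A 4 1 5 - comp3 A 5 1 4 - comp3 A 5 2 3"
    "comp3 (nij A) 2 1 2 = 0"
    "comp3 (nij A) 2 1 3 = comp3 A 1 1 4 + comp3 A 1 2 3 + comp3 A 2 1 3 - comp3 A 2 2 4"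
    "comp3 (nij A) 2 1 4 = - comp3 A 1 1 3 + comp3 A 1 2 4 + comp3 A 2 1 4 + comp3 A 2 2 3"
    "comp3 (nij A) 2 1 5 = comp3 A 1 2 5 + comp3 A 2 1 5"
    "comp3 (nij A) 2 2 3 = - comp3 A 1 1 3 + comp3 A 1 2 4 + comp3 A 2 1 4 + comp3 A 2 2 3"
    "comp3 (nij A) 2 2 4 = - comp3 A 1 1 4 - comp3 A 1 2 3 - comp3 A 2 1 3 + comp3 A 2 2 4"
    "comp3 (nij A) 2 2 5 = - comp3 A 1 1 5 + comp3 A 2 2 5"
    "comp3 (nij A) 2 3 4 = 0"
    "comp3 (nij A) 2 3 5 = comp3 A 3 2 5 + comp3 A 4 1 5 - comp3 A 5 1 4 - comp3 A 5 2 3"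
    "comp3 (nij A) 2 4 5 = - comp3 A 3 1 5 + comp3 A 4 2 5 + comp3 A 5 1 3 - comp3 A 5 2 4"
    "comp3 (nij A) 3 1 2 = 0"
    "comp3 (nij A) 3 1 3 = comp3 A 3 1 3 - comp3 A 3 2 4 - comp3 A 4 1 4 - comp3 A 4 2 3"
    "comp3 (nij A) 3 1 4 = comp3 A 3 1 4 + comp3 A 3 2 3 + comp3 A 4 1 3 - comp3 A 4 2 4"
    "comp3 (nij A) 3 1 5 = comp3 A 1 3 5 - comp3 A 2 4 5 + comp3 A 5 1 3 - comp3 A 5 2 4"
    "comp3 (nij A) 3 2 3 = comp3 A 3 1 4 + comp3 A 3 2 3 + comp3 A 4 1 3 - comp3 A 4 2 4"
    "comp3 (nij A) 3 2 4 = - comp3 A 3 1 3 + comp3 A 3 2 4 + comp3 A 4 1 4 + comp3 A 4 2 3"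
    "comp3 (nij A) 3 2 5 = comp3 A 1 4 5 + comp3 A 2 3 5 + comp3 A 5 1 4 + comp3 A 5 2 3"
    "comp3 (nij A) 3 3 4 = 0"
    "comp3 (nij A) 3 3 5 = comp3 A 3 3 5 - comp3 A 4 4 5"
    "comp3 (nij A) 3 4 5 = comp3 A 3 4 5 + comp3 A 4 3 5"
    "comp3 (nij A) 4 1 2 = 0"
    "comp3 (nij A) 4 1 3 = comp3 A 3 1 4 + comp3 A 3 2 3 + comp3 A 4 1 3 - comp3 A 4 2 4"
    "comp3 (nij A) 4 1 4 = - comp3 A 3 1 3 + comp3 A 3 2 4 + comp3 A 4 1 4 + comp3 A 4 2 3"
    "comp3 (nij A) 4 1 5 = comp3 A 1 4 5 + comp3 A 2 3 5 + comp3 A 5 1 4 + comp3 A 5 2 3"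
    "comp3 (nij A) 4 2 3 = - comp3 A 3 1 3 + comp3 A 3 2 4 + comp3 A 4 1 4 + comp3 A 4 2 3"
    "comp3 (nij A) 4 2 4 = - comp3 A 3 1 4 - comp3 A 3 2 3 - comp3 A 4 1 3 + comp3 A 4 2 4"
    "comp3 (nij A) 4 2 5 = - comp3 A 1 3 5 + comp3 A 2 4 5 - comp3 A 5 1 3 + comp3 A 5 2 4"
    "comp3 (nij A) 4 3 4 = 0"
    "comp3 (nij A) 4 3 5 = comp3 A 3 4 5 + comp3 A 4 3 5"
    "comp3 (nij A) 4 4 5 = - comp3 A 3 3 5 + comp3 A 4 4 5"
    "comp3 (nij A) 5 1 2 = 0"
    "comp3 (nij A) 5 1 3 = - comp3 A 1 3 5 + comp3 A 2 4 5 + comp3 A 3 1 5 - comp3 A 4 2 5"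
    "comp3 (nij A) 5 1 4 = - comp3 A 1 4 5 - comp3 A 2 3 5 + comp3 A 3 2 5 + comp3 A 4 1 5"
    "comp3 (nij A) 5 1 5 = comp3 A 5 1 5"
    "comp3 (nij A) 5 2 3 = - comp3 A 1 4 5 - comp3 A 2 3 5 + comp3 A 3 2 5 + comp3 A 4 1 5"
    "comp3 (nij A) 5 2 4 = comp3 A 1 3 5 - comp3 A 2 4 5 - comp3 A 3 1 5 + comp3 A 4 2 5"
    "comp3 (nij A) 5 2 5 = comp3 A 5 2 5"
    "comp3 (nij A) 5 3 4 = 0"
    "comp3 (nij A) 5 3 5 = comp3 A 5 3 5"
    "comp3 (nij A) 5 4 5 = comp3 A 5 4 5"
  by (simp_all add: nij_def phi0_neg phi0_zero A_space_zero[OF A] A_space_neg[OF A] A_space_same[OF A] comp3_sort[OF A] eta0_nth ebas_nth)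

section \<open>Reduction of the conditions on N to basis vectors\<close>

text \<open>Only indices in the supports of X and Y are tested, so that the criterion also serves
  horizontal vectors.\<close>

lemma bilinear_zeroI:
  assumes "bilinear B" "\<And>i j. X $ i \<noteq> 0 \<Longrightarrow> Y $ j \<noteq> 0 \<Longrightarrow> B (ebas i) (ebas j) = 0"
  shows "B X Y = (0 :: real)"
  unfolding bilinear_expand[OF assms(1), of X Y]
  by (intro sum.neutral ballI) (use assms(2) in fastforce)

text \<open>Meant for the differences of the two sides of the identities in
  \<open>N_space_def\<close>; the second of these is not visibly skew in its last two arguments, so
  skewness is not assumed.\<close>

lemma trilinear_zeroI:
  fixes B :: tensor3
  assumes z: "\<forall>i j k. comp3 B i j k = 0" and b: "\<And>X. bilinear (B X)" and l: "\<And>Y Z. linear (\<lambda>X. B X Y Z)"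
  shows "B X Y Z = 0"
proof -
  have "B X Y Z = B (\<Sum>i\<in>UNIV. X $ i *\<^sub>R ebas i) Y Z"
    using ebas_expand by metis
  also have "\<dots> = (\<Sum>i\<in>UNIV. X $ i * B (ebas i) Y Z)"
    by (simp add: linear_sum[OF l] linear_cmul[OF l])
  also have "\<dots> = 0"
    by (intro sum.neutral ballI) (simp add: bilinear_zeroI[OF b] z)
  finally show ?thesis .
qed

lemma A_space_zeroI:
  assumes A: "A \<in> A_space"
    and z: "\<And>i j k. X $ i \<noteq> 0 \<Longrightarrow> Y $ j \<noteq> 0 \<Longrightarrow> Z $ k \<noteq> 0 \<Longrightarrow> comp3 A i j k = 0"
  shows "A X Y Z = 0"
  unfolding A_space_expand[OF A, of X Y Z]
proof (intro sum.neutral ballI)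
  fix i
  show "X $ i * A (ebas i) Y Z = 0"
  proof (cases "X $ i = 0")
    case False
    then show ?thesis
      using bilinear_zeroI[OF A_space_bilinear[OF A], of Y Z "ebas i"] z by simp
  qed simp
qed

lemma H0_iff: "X \<in> H0 \<longleftrightarrow> X $ 5 = 0"
  by (simp add: H0_def inner_axis)

definition horizontal :: "5 set" where "horizontal = - {5}"

lemma ball_horizontal: "(\<forall>i\<in>horizontal. P i) \<longleftrightarrow> P 1 \<and> P 2 \<and> P 3 \<and> P 4"
  unfolding horizontal_def using exhaust_5 by (auto simp: Ball_def) metis

lemma H0_nth: "X \<in> H0 \<Longrightarrow> X $ i \<noteq> 0 \<Longrightarrow> i \<in> horizontal"
  by (auto simp: H0_iff horizontal_def)

lemma ebas_H0: "i \<in> horizontal \<Longrightarrow> ebas i \<in> H0"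
  by (simp add: H0_iff ebas_nth horizontal_def)

lemma bilinear_zero_on_H0:
  assumes "bilinear B"
  shows "(\<forall>X\<in>H0. \<forall>Y\<in>H0. B X Y = (0::real)) \<longleftrightarrow> (\<forall>i\<in>horizontal. \<forall>j\<in>horizontal. B (ebas i) (ebas j) = 0)"
proof (intro iffI ballI)
  fix X Y assume r: "\<forall>i\<in>horizontal. \<forall>j\<in>horizontal. B (ebas i) (ebas j) = 0" and "X \<in> H0" "Y \<in> H0"
  show "B X Y = 0"
  proof (rule bilinear_zeroI[OF assms])
    fix i j assume "X $ i \<noteq> 0" "Y $ j \<noteq> 0"
    then show "B (ebas i) (ebas j) = 0"
      using bspec[OF bspec[OF r H0_nth] H0_nth] \<open>X \<in> H0\<close> \<open>Y \<in> H0\<close> by metis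
  qed
next
  fix i j :: 5
  assume "\<forall>X\<in>H0. \<forall>Y\<in>H0. B X Y = 0" and "i \<in> horizontal" "j \<in> horizontal"
  then show "B (ebas i) (ebas j) = 0" using ebas_H0 by metis
qed

lemma A_space_on_H0:
  assumes A: "N \<in> A_space"
  shows "(\<forall>X\<in>H0. \<forall>Y\<in>H0. \<forall>Z\<in>H0. N X Y Z = 0) \<longleftrightarrow> (\<forall>i\<in>horizontal. \<forall>j\<in>horizontal. \<forall>k\<in>horizontal. comp3 N i j k = 0)"
    and "(\<forall>X\<in>H0. \<forall>Z\<in>H0. N X xi0 Z = 0) \<longleftrightarrow> (\<forall>i\<in>horizontal. \<forall>k\<in>horizontal. comp3 N i 5 k = 0)"
    and "(\<forall>Y\<in>H0. \<forall>Z\<in>H0. N xi0 Y Z = 0) \<longleftrightarrow> (\<forall>j\<in>horizontal. \<forall>k\<in>horizontal. comp3 N 5 j k = 0)"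
    and "(\<forall>Z\<in>H0. N xi0 xi0 Z = 0) \<longleftrightarrow> (\<forall>k\<in>horizontal. comp3 N 5 5 k = 0)"
    and "(\<forall>X\<in>H0. \<forall>Z\<in>H0. N X xi0 Z = N Z xi0 X) \<longleftrightarrow> (\<forall>i\<in>horizontal. \<forall>k\<in>horizontal. comp3 N i 5 k = comp3 N k 5 i)"
    and "(\<forall>X\<in>H0. \<forall>Z\<in>H0. N X xi0 Z = - N Z xi0 X) \<longleftrightarrow> (\<forall>i\<in>horizontal. \<forall>k\<in>horizontal. comp3 N i 5 k = - comp3 N k 5 i)"
proof -
  note s = A_space_add[OF A] A_space_scale[OF A]
  show "(\<forall>X\<in>H0. \<forall>Y\<in>H0. \<forall>Z\<in>H0. N X Y Z = 0) \<longleftrightarrow> (\<forall>i\<in>horizontal. \<forall>j\<in>horizontal. \<forall>k\<in>horizontal. comp3 N i j k = 0)" (is "?L \<longleftrightarrow> ?R")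
  proof (intro iffI ballI)
    fix X Y Z assume r: ?R and H: "X \<in> H0" "Y \<in> H0" "Z \<in> H0"
    show "N X Y Z = 0"
    proof (rule A_space_zeroI[OF A])
      fix i j k assume "X $ i \<noteq> 0" "Y $ j \<noteq> 0" "Z $ k \<noteq> 0"
      then have "i \<in> horizontal" "j \<in> horizontal" "k \<in> horizontal" using H H0_nth by simp_all
      with r show "comp3 N i j k = 0" by simp
    qed
  next
    fix i j k assume l: ?L and "i \<in> horizontal" "j \<in> horizontal" "k \<in> horizontal"
    then have "ebas i \<in> H0" "ebas j \<in> H0" "ebas k \<in> H0" by (simp_all only: ebas_H0)
    with l show "comp3 N i j k = 0" by simp
  qed
  have b1: "bilinear (\<lambda>X Z. N X xi0 Z)"
    unfolding bilinear_def by (intro conjI allI linearI) (simp_all only: s real_scaleR_def)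
  show "(\<forall>X\<in>H0. \<forall>Z\<in>H0. N X xi0 Z = 0) \<longleftrightarrow> (\<forall>i\<in>horizontal. \<forall>k\<in>horizontal. comp3 N i 5 k = 0)"
    by (rule bilinear_zero_on_H0[OF b1])
  show "(\<forall>Y\<in>H0. \<forall>Z\<in>H0. N xi0 Y Z = 0) \<longleftrightarrow> (\<forall>j\<in>horizontal. \<forall>k\<in>horizontal. comp3 N 5 j k = 0)"
    by (rule bilinear_zero_on_H0[OF A_space_bilinear[OF A]])
  show "(\<forall>Z\<in>H0. N xi0 xi0 Z = 0) \<longleftrightarrow> (\<forall>k\<in>horizontal. comp3 N 5 5 k = 0)"  (is "?L \<longleftrightarrow> ?R")
  proof (intro iffI ballI)
    fix Z assume r: ?R and Z: "Z \<in> H0"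
    show "N xi0 xi0 Z = 0"
    proof (rule A_space_zeroI[OF A])
      fix i j k assume "xi0 $ i \<noteq> 0" "xi0 $ j \<noteq> 0" "Z $ k \<noteq> 0"
      then have "i = 5" "j = 5" "k \<in> horizontal" using H0_nth[OF Z] by (simp_all add: ebas_nth split: if_splits)
      with r show "comp3 N i j k = 0" by simp
    qed
  next
    fix k assume l: ?L and "k \<in> horizontal"
    then have "ebas k \<in> H0" by (simp only: ebas_H0)
    with l show "comp3 N 5 5 k = 0" by simp
  qed
  \<comment> \<open>Symmetry and skew-symmetry are the vanishing of the bilinear maps
    \<open>b2\<close> and \<open>b3\<close>, which can be tested on a basis.\<close>
  have b2: "bilinear (\<lambda>X Z. N X xi0 Z - N Z xi0 X)"
    unfolding bilinear_def by (intro conjI allI linearI) (simp_all only: s real_scaleR_def, simp_all add: algebra_simps)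
  show "(\<forall>X\<in>H0. \<forall>Z\<in>H0. N X xi0 Z = N Z xi0 X) \<longleftrightarrow> (\<forall>i\<in>horizontal. \<forall>k\<in>horizontal. comp3 N i 5 k = comp3 N k 5 i)"
    using bilinear_zero_on_H0[OF b2] by (simp only: right_minus_eq)
  have b3: "bilinear (\<lambda>X Z. N X xi0 Z + N Z xi0 X)"
    unfolding bilinear_def by (intro conjI allI linearI) (simp_all only: s real_scaleR_def, simp_all add: algebra_simps)
  show "(\<forall>X\<in>H0. \<forall>Z\<in>H0. N X xi0 Z = - N Z xi0 X) \<longleftrightarrow> (\<forall>i\<in>horizontal. \<forall>k\<in>horizontal. comp3 N i 5 k = - comp3 N k 5 i)"
    using bilinear_zero_on_H0[OF b3] by (simp only: eq_neg_iff_add_eq_0)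
qed

lemma nij_N_space:
  assumes A: "A \<in> A_space"
  shows "nij A \<in> N_space"
proof -
  let ?N = "nij A"
  have N: "?N \<in> A_space" by (rule nij_A_space[OF A])
  note lin = A_space_add[OF N] A_space_scale[OF N] phi0_add phi0_scale eta0_nth
    vector_add_component vector_scaleR_component real_scaleR_def
  note ev = phi0_neg phi0_zero A_space_zero[OF N] A_space_neg[OF N] A_space_same[OF N] comp3_sort[OF N] eta0_nth ebas_nth nij_ebas[OF A]
  have 1: "?N X Y Z + ?N X (phi0 Y) (phi0 Z) - eta0 Y * ?N X xi0 Z - eta0 Z * ?N X Y xi0 = 0" for X Y Z
  proof -
    let ?B = "\<lambda>X Y Z. ?N X Y Z + ?N X (phi0 Y) (phi0 Z) - eta0 Y * ?N X xi0 Z - eta0 Z * ?N X Y xi0"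
    \<comment> \<open>125 evaluations by the table \<open>nij_ebas\<close>; multilinearity does the
      rest.\<close>
    have "\<forall>i j k. comp3 ?B i j k = 0"
      unfolding forall_5 by (simp add: ev)
    moreover have "bilinear (?B X)" for X
      unfolding bilinear_def by (intro conjI allI linearI) (simp_all only: lin, simp_all add: algebra_simps)
    moreover have "linear (\<lambda>X. ?B X Y Z)" for Y Z
      by (intro linearI) (simp_all only: lin, simp_all add: algebra_simps)
    ultimately show ?thesis by (rule trilinear_zeroI)
  qed
  have 2: "?N X Y Z + ?N (phi0 X) (phi0 Y) Z - eta0 X * ?N xi0 Y Z + eta0 Y * ?N (phi0 X) xi0 (phi0 Z) = 0" for X Y Z
  proof -
    let ?B = "\<lambda>X Y Z. ?N X Y Z + ?N (phi0 X) (phi0 Y) Z - eta0 X * ?N xi0 Y Z + eta0 Y * ?N (phi0 X) xi0 (phi0 Z)"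
    have "\<forall>i j k. comp3 ?B i j k = 0"
      unfolding forall_5 by (simp add: ev)
    moreover have "bilinear (?B X)" for X
      unfolding bilinear_def by (intro conjI allI linearI) (simp_all only: lin, simp_all add: algebra_simps)
    moreover have "linear (\<lambda>X. ?B X Y Z)" for Y Z
      by (intro linearI) (simp_all only: lin, simp_all add: algebra_simps)
    ultimately show ?thesis by (rule trilinear_zeroI)
  qed
  have "?N X Y Z = - ?N X (phi0 Y) (phi0 Z) + eta0 Y * ?N X xi0 Z + eta0 Z * ?N X Y xi0"
    "?N X Y Z = - ?N (phi0 X) (phi0 Y) Z + eta0 X * ?N xi0 Y Z - eta0 Y * ?N (phi0 X) xi0 (phi0 Z)" for X Y Z
    using 1[of X Y Z] 2[of X Y Z] by linarith+
  with N show ?thesis unfolding N_space_def by blast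
qed

text \<open>The dictionary between the classes of N and the components of A. The last line joins two
  conditions because N(X, \<xi>, Z) has a skew part mixing both copies of \<open>Lambda2_2\<close>:
  its vanishing is one relation between them, and N(\<xi>, Y, Z) = 0 isolates the copy in
  d\<eta>.\<close>

lemma nij_conditions:
  assumes A: "A \<in> A_space"
  shows "(\<forall>X\<in>H0. \<forall>Y\<in>H0. \<forall>Z\<in>H0. nij A X Y Z = 0) \<longleftrightarrow> no_W9 A"
    and "(\<forall>Z\<in>H0. nij A xi0 xi0 Z = 0) \<longleftrightarrow> no_W2 A"
    and "(\<forall>X\<in>H0. \<forall>Z\<in>H0. nij A X xi0 Z = - nij A Z xi0 X) \<longleftrightarrow> no_W10 A"
    and "(\<forall>X\<in>H0. \<forall>Z\<in>H0. nij A X xi0 Z = nij A Z xi0 X) \<and> (\<forall>Y\<in>H0. \<forall>Z\<in>H0. nij A xi0 Y Z = 0) \<longleftrightarrow> no_W47 A"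
  unfolding A_space_on_H0[OF nij_A_space[OF A]]
  by (simp_all add: ball_horizontal comp3_sort[OF nij_A_space[OF A]] A_space_same[OF nij_A_space[OF A]] nij_ebas[OF A] no_W_defs;
      rule iffI; (elim conjE)?; intro conjI; linarith)+

lemma nij_zero_iff: "A \<in> A_space \<Longrightarrow> nij A = 0 \<longleftrightarrow> no_W2 A \<and> no_W47 A \<and> no_W9 A \<and> no_W10 A"
proof
  assume A: "A \<in> A_space" and z: "nij A = 0"
  show "no_W2 A \<and> no_W47 A \<and> no_W9 A \<and> no_W10 A"
    unfolding nij_conditions[OF A, symmetric] z by simp
next
  assume A: "A \<in> A_space" and K: "no_W2 A \<and> no_W47 A \<and> no_W9 A \<and> no_W10 A"
  note N = nij_A_space[OF A] and c = nij_conditions[OF A]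
  have 1: "nij A X Y Z = 0" if "X \<in> H0" "Y \<in> H0" "Z \<in> H0" for X Y Z
    using K c that by blast
  have 4: "nij A xi0 Y Z = 0" if "Y \<in> H0" "Z \<in> H0" for Y Z
    using K c that by blast
  have 2: "nij A X xi0 Z = 0" if "X \<in> H0" "Z \<in> H0" for X Z
  proof -
    have "nij A X xi0 Z = nij A Z xi0 X" "nij A X xi0 Z = - nij A Z xi0 X"
      using K c that by blast+
    then show ?thesis by linarith
  qed
  have 3: "nij A xi0 xi0 Z = 0" if "Z \<in> H0" for Z
    using K c that by blast
  have H: "ebas i \<in> H0" if "i \<noteq> 5" for i
    using that by (intro ebas_H0) (simp add: horizontal_def)
  have 5: "comp3 (nij A) i 5 k = 0" if "k \<noteq> 5" for i k
    using 2[OF H H[OF that], of i] 3[OF H[OF that]] by (cases "i = 5") simp_all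
  have z: "comp3 (nij A) i j k = 0" for i j k
  proof -
    consider "j = k" | "j = 5" "k \<noteq> 5" | "j \<noteq> 5" "k = 5" | "j \<noteq> 5" "k \<noteq> 5" by blast
    then show ?thesis
    proof cases
      case 1
      show ?thesis unfolding 1 by (rule A_space_same[OF N])
    next
      case 2
      show ?thesis unfolding 2(1) by (rule 5[OF 2(2)])
    next
      case 3
      show ?thesis
        using 5[OF 3(1), of i] A_space_skew[OF N, of "ebas i" "ebas j" "ebas 5"] unfolding 3(2) by linarith
    next
      case jk: 4
      show ?thesis
      proof (cases "i = 5")
        case True
        show ?thesis unfolding True by (rule 4[OF H[OF jk(1)] H[OF jk(2)]])
      next
        case False
        show ?thesis by (rule 1[OF H[OF False] H[OF jk(1)] H[OF jk(2)]])
      qed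
    qed
  qed
  have "nij A X Y Z = 0" for X Y Z
    by (rule A_space_zeroI[OF N]) (rule z)
  then show "nij A = 0" by (intro ext) simp
qed

lemma nij_classes:
  assumes A: "A \<in> A_space"
  shows "nij A \<in> N2 \<longleftrightarrow> no_W2 A \<and> no_W47 A \<and> no_W10 A"
    and "nij A \<in> N3 \<longleftrightarrow> no_W2 A \<and> no_W47 A \<and> no_W9 A"
    and "nij A \<in> N4_5 \<longleftrightarrow> no_W2 A \<and> no_W9 A \<and> no_W10 A"
    and "nij A \<in> N6 \<longleftrightarrow> no_W47 A \<and> no_W9 A \<and> no_W10 A"
proof -
  \<comment> \<open>A form vanishes iff it is both symmetric and skew; this brings the condition
    N(X, \<xi>, Z) = 0 into the shape of \<open>nij_conditions\<close>.\<close>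
  have z: "(\<forall>X\<in>H0. \<forall>Z\<in>H0. nij A X xi0 Z = 0) \<longleftrightarrow>
    (\<forall>X\<in>H0. \<forall>Z\<in>H0. nij A X xi0 Z = nij A Z xi0 X) \<and> (\<forall>X\<in>H0. \<forall>Z\<in>H0. nij A X xi0 Z = - nij A Z xi0 X)"
    by (smt (verit))
  note c = nij_conditions[OF A] z
  show "nij A \<in> N2 \<longleftrightarrow> no_W2 A \<and> no_W47 A \<and> no_W10 A" "nij A \<in> N3 \<longleftrightarrow> no_W2 A \<and> no_W47 A \<and> no_W9 A"
    "nij A \<in> N4_5 \<longleftrightarrow> no_W2 A \<and> no_W9 A \<and> no_W10 A" "nij A \<in> N6 \<longleftrightarrow> no_W47 A \<and> no_W9 A \<and> no_W10 A"
    unfolding N2_def N3_def N4_5_def N6_def using nij_N_space[OF A] c by blast+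
qed

section \<open>Decomposition of the intrinsic torsion\<close>

lemma tor_cong:
  assumes "\<And>X. p X = p' X" "\<And>X. q X = q' X" "\<And>X. r1 X = r1' X" "\<And>X. r2 X = r2' X"
    "\<And>X. r3 X = r3' X" "\<And>X. r4 X = r4' X"
  shows "tor p q r1 r2 r3 r4 = tor p' q' r1' r2' r3' r4'"
  by (intro ext) (simp add: tor_def assms)

lemma tor_add:
  "tor p q r1 r2 r3 r4 + tor p' q' r1' r2' r3' r4' =
   tor (\<lambda>X. p X + p' X) (\<lambda>X. q X + q' X) (\<lambda>X. r1 X + r1' X) (\<lambda>X. r2 X + r2' X) (\<lambda>X. r3 X + r3' X) (\<lambda>X. r4 X + r4' X)"
  by (intro ext) (simp add: tor_def comb2_def algebra_simps)

lemma tor_zero: "tor (\<lambda>X. 0) (\<lambda>X. 0) (\<lambda>X. 0) (\<lambda>X. 0) (\<lambda>X. 0) (\<lambda>X. 0) = 0"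
  by (intro ext) (simp add: tor_def comb2_def)

section \<open>Explicit families in the ten summands\<close>

text \<open>For i up to 7 the arguments of \<open>wi\<close> are the coefficients of the form from
  which the element of \<W>_i is built; the functions in \<open>tor\<close> result from evaluating
  \<theta>_1, \<theta>_2 or \<theta>_3 and projecting.\<close>

definition w1 :: "real \<Rightarrow> tensor3" where
  "w1 a = tor (\<lambda>X. 0) (\<lambda>X. 0) (\<lambda>X. a * X$1) (\<lambda>X. a * X$2) (\<lambda>X. a * X$3) (\<lambda>X. a * X$4)"

text \<open>The part along \<open>Lambda2_2\<close> is the one of \<open>w6 a b c d\<close>; it is
  what remains of the horizontal components of \<theta>_1 after the projection.\<close>

definition w2 :: "real \<Rightarrow> real \<Rightarrow> real \<Rightarrow> real \<Rightarrow> tensor3" where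
  "w2 a b c d = tor (\<lambda>X. (c * X$1 - d * X$2 - a * X$3 + b * X$4) / 2) (\<lambda>X. (d * X$1 + c * X$2 - b * X$3 - a * X$4) / 2)
     (\<lambda>X. - a * X$5) (\<lambda>X. - b * X$5) (\<lambda>X. - c * X$5) (\<lambda>X. - d * X$5)"

definition w3 :: "real \<Rightarrow> tensor3" where
  "w3 t = tor (\<lambda>X. 0) (\<lambda>X. 0) (\<lambda>X. - t * X$2) (\<lambda>X. t * X$1) (\<lambda>X. - t * X$4) (\<lambda>X. t * X$3)"

definition w4 :: "real \<Rightarrow> real \<Rightarrow> tensor3" where
  "w4 a b = tor (\<lambda>X. a * X$5) (\<lambda>X. b * X$5) (\<lambda>X. - a * X$3 - b * X$4) (\<lambda>X. a * X$4 - b * X$3)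
     (\<lambda>X. a * X$1 + b * X$2) (\<lambda>X. b * X$1 - a * X$2)"

definition w5 :: "real \<Rightarrow> real \<Rightarrow> real \<Rightarrow> tensor3" where
  "w5 a b c = tor (\<lambda>X. 0) (\<lambda>X. 0) (\<lambda>X. a * X$2 + b * X$3 + c * X$4) (\<lambda>X. - a * X$1 + b * X$4 - c * X$3)
     (\<lambda>X. - a * X$4 - b * X$1 + c * X$2) (\<lambda>X. a * X$3 - b * X$2 - c * X$1)"

definition w6 :: "real \<Rightarrow> real \<Rightarrow> real \<Rightarrow> real \<Rightarrow> tensor3" where
  "w6 a b c d = tor (\<lambda>X. (c * X$1 - d * X$2 - a * X$3 + b * X$4) / 2) (\<lambda>X. (d * X$1 + c * X$2 - b * X$3 - a * X$4) / 2)
     (\<lambda>X. 0) (\<lambda>X. 0) (\<lambda>X. 0) (\<lambda>X. 0)"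

definition w7 :: "real \<Rightarrow> real \<Rightarrow> tensor3" where
  "w7 a b = tor (\<lambda>X. 2 * a * X$5) (\<lambda>X. 2 * b * X$5) (\<lambda>X. a * X$3 + b * X$4) (\<lambda>X. - a * X$4 + b * X$3)
     (\<lambda>X. - a * X$1 - b * X$2) (\<lambda>X. - b * X$1 + a * X$2)"

text \<open>Has the shape s(X, Y) \<eta>(Z) - s(X, Z) \<eta>(Y) with s the general trace-free,
  \<phi>-invariant symmetric form on horizontal vectors; symmetry gives the cyclic identity.\<close>

definition w8 :: "real \<Rightarrow> real \<Rightarrow> real \<Rightarrow> tensor3" where
  "w8 x y z = tor (\<lambda>X. 0) (\<lambda>X. 0) (\<lambda>X. x * X$4 + y * X$3 - z * X$1) (\<lambda>X. - x * X$3 + y * X$4 - z * X$2)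
     (\<lambda>X. - x * X$2 + y * X$1 + z * X$3) (\<lambda>X. x * X$1 + y * X$2 + z * X$4)"

text \<open>Here f = p + i q satisfies f(e_2) = - i f(e_1) and f(e_4) = - i f(e_3), the type
  opposite to that of \<open>w6\<close>.\<close>

definition w9 :: "real \<Rightarrow> real \<Rightarrow> real \<Rightarrow> real \<Rightarrow> tensor3" where
  "w9 a b c d = tor (\<lambda>X. - a * X$1 - b * X$2 - c * X$3 - d * X$4) (\<lambda>X. a * X$2 - b * X$1 + c * X$4 - d * X$3)
     (\<lambda>X. 0) (\<lambda>X. 0) (\<lambda>X. 0) (\<lambda>X. 0)"

text \<open>The same shape as \<open>w8\<close>, with s the general \<phi>-anti-invariant symmetric
  form.\<close>

definition w10 :: "real \<Rightarrow> real \<Rightarrow> real \<Rightarrow> real \<Rightarrow> real \<Rightarrow> real \<Rightarrow> tensor3" where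
  "w10 a b c d e f = tor (\<lambda>X. 0) (\<lambda>X. 0) (\<lambda>X. - b * X$1 + a * X$2 + e * X$3 + f * X$4)
     (\<lambda>X. a * X$1 + b * X$2 + f * X$3 - e * X$4)
     (\<lambda>X. e * X$1 + f * X$2 - d * X$3 + c * X$4) (\<lambda>X. f * X$1 - e * X$2 + c * X$3 + d * X$4)"

lemma inner_R5: "X \<bullet> Y = X$1 * Y$1 + X$2 * Y$2 + X$3 * Y$3 + X$4 * Y$4 + X$5 * Y$5" for X Y :: R5
  by (simp add: inner_vec_def sum_5)

lemma w1_mem: "w1 a \<in> W1"
proof -
  have "w1 a = theta1 (\<lambda>X. a * eta0 X)"
    by (intro ext) (simp add: w1_def tor_def comb2_def minor2_def theta1_def inner_R5 eta0_nth algebra_simps)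
  then show ?thesis unfolding W1_def Lambda1_1_def by blast
qed

lemma w2_mem: "w2 a b c d \<in> W2"
proof -
  let ?\<alpha> = "\<lambda>X :: R5. a * X$1 + b * X$2 + c * X$3 + d * X$4"
  have l: "linear ?\<alpha>"
    by (rule linearI) (simp_all add: algebra_simps)
  have "w2 a b c d = pr_W (theta1 ?\<alpha>)"
    unfolding w2_def pr_W_eq_tor[OF theta1_A_space[OF l]]
    by (rule tor_cong) (simp_all add: theta1_def inner_axis ebas_nth algebra_simps)
  moreover have "?\<alpha> \<in> Lambda1_2"
    using l by (simp add: Lambda1_2_def ebas_nth)
  ultimately show ?thesis unfolding W2_def by blast
qed


lemma w3_mem: "w3 t \<in> W3"
proof -
  have "w3 t = pr_W (theta2 (hodge2 (comb2 t 0 0 0 0 0 0 t 0 0)))"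
    unfolding w3_def theta2_hodge2_comb2 pr_W_eq_tor[OF hodge2_comb2_A_space]
    by (rule tor_cong) (simp_all add: hodge2_comb2 minor3_def ebas_nth algebra_simps)
  then show ?thesis unfolding W3_def Lambda3_1_def Lambda2_1_eq by blast
qed

lemma w4_mem: "w4 a b \<in> W4"
proof -
  have "w4 a b = theta2 (hodge2 (comb2 0 a b 0 b (- a) 0 0 0 0))"
    unfolding theta2_hodge2_comb2
    by (intro ext) (simp add: w4_def tor_def comb2_def minor2_def hodge2_comb2 minor3_def algebra_simps)
  then show ?thesis unfolding W4_def Lambda3_2_def Lambda2_2_eq by blast
qed

lemma w5_mem: "w5 a b c \<in> W5"
proof -
  have "w5 a b c = pr_W (theta2 (hodge2 (comb2 a b c 0 (- c) b 0 (- a) 0 0)))"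
    unfolding w5_def theta2_hodge2_comb2 pr_W_eq_tor[OF hodge2_comb2_A_space]
    by (rule tor_cong) (simp_all add: hodge2_comb2 minor3_def ebas_nth algebra_simps)
  then show ?thesis unfolding W5_def Lambda3_3_def Lambda2_3_eq by blast
qed

lemma w6_mem: "w6 a b c d \<in> W6"
proof -
  have "w6 a b c d = pr_W (theta2 (hodge2 (comb2 0 0 0 a 0 0 b 0 c d)))"
    unfolding w6_def theta2_hodge2_comb2 pr_W_eq_tor[OF hodge2_comb2_A_space]
    by (rule tor_cong) (simp_all add: hodge2_comb2 minor3_def ebas_nth algebra_simps)
  then show ?thesis unfolding W6_def Lambda3_4_def Lambda2_4_eq by blast
qed

lemma w7_mem: "w7 a b \<in> W7"
proof -
  have "w7 a b = theta3 (comb2 0 a b 0 b (- a) 0 0 0 0)"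
    by (intro ext) (simp add: w7_def tor_def theta3_comb2 comb2_def minor2_def algebra_simps)
  then show ?thesis unfolding W7_def Lambda2_2_eq by blast
qed

lemma tor_A_space:
  assumes "linear p" "linear q" "linear r1" "linear r2" "linear r3" "linear r4"
  shows "tor p q r1 r2 r3 r4 \<in> A_space"
proof (rule A_spaceI)
  show "linear (\<lambda>X. tor p q r1 r2 r3 r4 X Y Z)" for Y Z
    by (rule linearI) (simp_all add: tor_def comb2_def assms[THEN linear_add] assms[THEN linear_cmul] algebra_simps)
qed (simp add: tor_def)

lemma w8_mem: "w8 x y z \<in> W8"
proof -
  note defs = w8_def tor_def comb2_def minor2_def
  have "w8 x y z \<in> A_space"
    unfolding w8_def by (intro tor_A_space linearI) (simp_all add: algebra_simps)
  moreover have "w8 x y z X Y Z + w8 x y z Y Z X + w8 x y z Z X Y = 0" for X Y Z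
    unfolding defs by (simp add: algebra_simps)
  moreover have "(\<Sum>i\<in>UNIV. w8 x y z (ebas i) (ebas i) X) = 0" for X
    unfolding defs by (simp add: sum_5 ebas_nth)
  moreover have "w8 x y z X Y Z = w8 x y z (phi0 X) Y (phi0 Z) + w8 x y z (phi0 X) (phi0 Y) Z" for X Y Z
    unfolding defs by (simp add: algebra_simps)
  ultimately show ?thesis unfolding W8_def A3_def by blast
qed

lemma w9_mem: "w9 a b c d \<in> W9"
proof -
  note defs = w9_def tor_def comb2_def minor2_def
  have "w9 a b c d \<in> A_space"
    unfolding w9_def by (intro tor_A_space linearI) (simp_all add: algebra_simps)
  moreover have "w9 a b c d X Y Z + w9 a b c d Y Z X + w9 a b c d Z X Y = 0" for X Y Z
    unfolding defs by (simp add: algebra_simps)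
  moreover have "(\<Sum>i\<in>UNIV. w9 a b c d (ebas i) (ebas i) X) = 0" for X
    unfolding defs by (simp add: sum_5 ebas_nth)
  moreover have "w9 a b c d X Y Z = - w9 a b c d X (phi0 Y) (phi0 Z)" for X Y Z
    unfolding defs by (simp add: algebra_simps)
  ultimately show ?thesis unfolding W9_def A3_def by blast
qed

lemma w10_mem: "w10 a b c d e f \<in> W10"
proof -
  note defs = w10_def tor_def comb2_def minor2_def
  have "w10 a b c d e f \<in> A_space"
    unfolding w10_def by (intro tor_A_space linearI) (simp_all add: algebra_simps)
  moreover have "w10 a b c d e f X Y Z + w10 a b c d e f Y Z X + w10 a b c d e f Z X Y = 0" for X Y Z
    unfolding defs by (simp add: algebra_simps)
  moreover have "(\<Sum>i\<in>UNIV. w10 a b c d e f (ebas i) (ebas i) X) = 0" for X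
    unfolding defs by (simp add: sum_5 ebas_nth)
  moreover have "w10 a b c d e f X Y Z = - w10 a b c d e f (phi0 X) Y (phi0 Z) - w10 a b c d e f (phi0 X) (phi0 Y) Z" for X Y Z
    unfolding defs by (simp add: algebra_simps)
  ultimately show ?thesis unfolding W10_def A3_def by blast
qed

text \<open>The coefficients of the ten components are found by solving for them in terms of the 30
  numbers P k, Q k, r i k; those of \<open>W2\<close>, \<open>W4\<close>, \<open>W7\<close>,
  \<open>W9\<close> and \<open>W10\<close> are combinations of the quantities in the corresponding
  predicate.\<close>

lemma pr_W_decomposition:
  assumes A: "A \<in> A_space"
  obtains v1 v2 v3 v4 v5 v6 v7 v8 v9 v10
  where "pr_W A = v1 + v2 + v3 + v4 + v5 + v6 + v7 + v8 + v9 + v10"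
    and "v1 \<in> W1" "v2 \<in> W2" "v3 \<in> W3" "v4 \<in> W4" "v5 \<in> W5" "v6 \<in> W6" "v7 \<in> W7" "v8 \<in> W8" "v9 \<in> W9" "v10 \<in> W10"
    and "no_W2 A \<longrightarrow> v2 = 0" "no_W47 A \<longrightarrow> v4 = 0" "no_W47 A \<longrightarrow> v7 = 0" "no_W9 A \<longrightarrow> v9 = 0" "no_W10 A \<longrightarrow> v10 = 0"
proof -
  define P where "P k = (comp3 A k 1 3 - comp3 A k 2 4) / 2" for k
  define Q where "Q k = (comp3 A k 1 4 + comp3 A k 2 3) / 2" for k
  define r where "r i k = comp3 A k i 5" for i k
  \<comment> \<open>Coefficients of the skew part of (X, Y) |-> A(X, Y, \<xi>) along the basis
    \<open>e\<^sub>1 \<and> e\<^sub>3 - e\<^sub>2 \<and> e\<^sub>4\<close>,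
    \<open>e\<^sub>1 \<and> e\<^sub>4 + e\<^sub>2 \<and> e\<^sub>3\<close> of
    \<open>Lambda2_2\<close>.\<close>
  define u where "u = (r 3 1 - r 4 2 - r 1 3 + r 2 4) / 4"
  define v where "v = (r 4 1 + r 3 2 - r 2 3 - r 1 4) / 4"
  let ?v1 = "w1 ((r 1 1 + r 2 2 + r 3 3 + r 4 4) / 4)"
  let ?v2 = "w2 (- r 1 5) (- r 2 5) (- r 3 5) (- r 4 5)"
  let ?v3 = "w3 ((r 2 1 - r 1 2 + r 4 3 - r 3 4) / 4)"
  \<comment> \<open>\<open>w4 a b\<close> has u = a and P 5 = a, whereas \<open>w7 a' b'\<close> has
    u = - a' and P 5 = 2 a'. Solving u = a - a', P 5 = a + 2 a' gives the thirds here and in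
    \<open>?v7\<close>; likewise for v and Q 5.\<close>
  let ?v4 = "w4 ((2 * u + P 5) / 3) ((2 * v + Q 5) / 3)"
  let ?v5 = "w5 ((- r 2 1 + r 1 2 + r 4 3 - r 3 4) / 4) ((- r 3 1 - r 4 2 + r 1 3 + r 2 4) / 4) ((- r 4 1 + r 3 2 - r 2 3 + r 1 4) / 4)"
  \<comment> \<open>The sums of P and Q are the Cauchy-Riemann part of p + i q; the terms r i 5
    cancel what \<open>?v2\<close> contributes to that part.\<close>
  let ?v6 = "w6 (- (P 3 + Q 4) + r 1 5) (P 4 - Q 3 + r 2 5) (P 1 + Q 2 + r 3 5) (Q 1 - P 2 + r 4 5)"
  let ?v7 = "w7 ((P 5 - u) / 3) ((Q 5 - v) / 3)"
  let ?v8 = "w8 ((r 4 1 - r 3 2 - r 2 3 + r 1 4) / 4) ((r 3 1 + r 4 2 + r 1 3 + r 2 4) / 4) ((r 3 3 + r 4 4 - r 1 1 - r 2 2) / 4)"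
  let ?v9 = "w9 ((Q 2 - P 1) / 2) (- ((P 2 + Q 1) / 2)) ((Q 4 - P 3) / 2) (- ((P 4 + Q 3) / 2))"
  let ?v10 = "w10 ((r 2 1 + r 1 2) / 2) ((r 2 2 - r 1 1) / 2) ((r 4 3 + r 3 4) / 2) ((r 4 4 - r 3 3) / 2)
    ((r 3 1 - r 4 2 + r 1 3 - r 2 4) / 4) ((r 4 1 + r 3 2 + r 2 3 + r 1 4) / 4)"
  have PX: "(A X (ebas 1) (ebas 3) - A X (ebas 2) (ebas 4)) / 2 = X$1 * P 1 + X$2 * P 2 + X$3 * P 3 + X$4 * P 4 + X$5 * P 5"
    and QX: "(A X (ebas 1) (ebas 4) + A X (ebas 2) (ebas 3)) / 2 = X$1 * Q 1 + X$2 * Q 2 + X$3 * Q 3 + X$4 * Q 4 + X$5 * Q 5"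
    and rX: "A X (ebas i) (ebas 5) = X$1 * r i 1 + X$2 * r i 2 + X$3 * r i 3 + X$4 * r i 4 + X$5 * r i 5" for X i
    unfolding A_space_expand[OF A, of X] sum_5 P_def Q_def r_def by (simp_all add: field_simps)
  have "pr_W A = ?v1 + ?v2 + ?v3 + ?v4 + ?v5 + ?v6 + ?v7 + ?v8 + ?v9 + ?v10"
    unfolding w1_def w2_def w3_def w4_def w5_def w6_def w7_def w8_def w9_def w10_def tor_add
      pr_W_eq_tor[OF A] PX QX rX
    by (rule tor_cong) (simp_all add: u_def v_def field_simps)
  moreover have "?v2 = 0" if "no_W2 A"
    using that by (simp add: no_W2_def r_def w2_def tor_zero)
  moreover have "P 5 = 0 \<and> Q 5 = 0 \<and> u = 0 \<and> v = 0" if "no_W47 A"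
    using that unfolding no_W47_def P_def Q_def r_def u_def v_def by (auto simp: field_simps)
  then have "?v4 = 0" "?v7 = 0" if "no_W47 A"
    using that by (simp_all add: w4_def w7_def tor_zero)
  moreover have "?v9 = 0" if "no_W9 A"
  proof -
    have "Q 2 - P 1 = 0" "P 2 + Q 1 = 0" "Q 4 - P 3 = 0" "P 4 + Q 3 = 0"
      using that unfolding no_W9_def P_def Q_def by (auto simp: field_simps)
    then show ?thesis by (simp only:) (simp add: w9_def tor_zero)
  qed
  moreover have "?v10 = 0" if "no_W10 A"
  proof -
    have "r 2 1 + r 1 2 = 0" "r 2 2 - r 1 1 = 0" "r 4 3 + r 3 4 = 0" "r 4 4 - r 3 3 = 0"
      "r 3 1 - r 4 2 + r 1 3 - r 2 4 = 0" "r 4 1 + r 3 2 + r 2 3 + r 1 4 = 0"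
      using that unfolding no_W10_def r_def by (auto simp: field_simps)
    then show ?thesis by (simp only:) (simp add: w10_def tor_zero)
  qed
  ultimately show thesis
    by (intro that[of ?v1 ?v2 ?v3 ?v4 ?v5 ?v6 ?v7 ?v8 ?v9 ?v10])
       (auto intro: w1_mem w2_mem w3_mem w4_mem w5_mem w6_mem w7_mem w8_mem w9_mem w10_mem)
qed

text \<open>Left to right, every listed summand satisfies the stated conditions, and these are
  closed under sums. Right to left, the conditions annihilate in the decomposition of
  \<open>pr_W A\<close> exactly the components whose summands are not listed.\<close>

lemma torsion_classes:
  assumes A: "A \<in> A_space"
  shows "pr_W A \<in> W1 + W3 + W5 + W6 + W8 + W9 \<longleftrightarrow> no_W2 A \<and> no_W47 A \<and> no_W10 A"
    and "pr_W A \<in> W1 + W3 + W5 + W6 + W8 + W10 \<longleftrightarrow> no_W2 A \<and> no_W47 A \<and> no_W9 A"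
    and "pr_W A \<in> W1 + W3 + W4 + W5 + W6 + W7 + W8 \<longleftrightarrow> no_W2 A \<and> no_W9 A \<and> no_W10 A"
    and "pr_W A \<in> W1 + W2 + W3 + W5 + W6 + W8 \<longleftrightarrow> no_W47 A \<and> no_W9 A \<and> no_W10 A"
    and "pr_W A \<in> W1 + W3 + W5 + W6 + W8 \<longleftrightarrow> no_W2 A \<and> no_W47 A \<and> no_W9 A \<and> no_W10 A"
proof -
  obtain v1 v2 v3 v4 v5 v6 v7 v8 v9 v10
    where s: "pr_W A = v1 + v2 + v3 + v4 + v5 + v6 + v7 + v8 + v9 + v10"
      and m: "v1 \<in> W1" "v2 \<in> W2" "v3 \<in> W3" "v4 \<in> W4" "v5 \<in> W5" "v6 \<in> W6" "v7 \<in> W7" "v8 \<in> W8" "v9 \<in> W9" "v10 \<in> W10"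
      and z: "no_W2 A \<longrightarrow> v2 = 0" "no_W47 A \<longrightarrow> v4 = 0" "no_W47 A \<longrightarrow> v7 = 0" "no_W9 A \<longrightarrow> v9 = 0" "no_W10 A \<longrightarrow> v10 = 0"
    by (rule pr_W_decomposition[OF A])
  note Ks = W1_components W2_components W3_components W4_components W5_components W6_components W7_components W8_components W9_components W10_components
  show "pr_W A \<in> W1 + W3 + W5 + W6 + W8 + W9 \<longleftrightarrow> no_W2 A \<and> no_W47 A \<and> no_W10 A"
  proof
    assume "pr_W A \<in> W1 + W3 + W5 + W6 + W8 + W9"
    then have "no_W2 (pr_W A) \<and> no_W47 (pr_W A) \<and> no_W10 (pr_W A)"
      by (elim set_plus_elim) (use Ks no_W_add in simp)
    then show "no_W2 A \<and> no_W47 A \<and> no_W10 A" by (simp add: no_W_pr_W[OF A])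
  next
    assume "no_W2 A \<and> no_W47 A \<and> no_W10 A"
    then have "pr_W A = v1 + v3 + v5 + v6 + v8 + v9" by (simp add: s z)
    then show "pr_W A \<in> W1 + W3 + W5 + W6 + W8 + W9" using m by (simp add: set_plus_intro)
  qed
  show "pr_W A \<in> W1 + W3 + W5 + W6 + W8 + W10 \<longleftrightarrow> no_W2 A \<and> no_W47 A \<and> no_W9 A"
  proof
    assume "pr_W A \<in> W1 + W3 + W5 + W6 + W8 + W10"
    then have "no_W2 (pr_W A) \<and> no_W47 (pr_W A) \<and> no_W9 (pr_W A)"
      by (elim set_plus_elim) (use Ks no_W_add in simp)
    then show "no_W2 A \<and> no_W47 A \<and> no_W9 A" by (simp add: no_W_pr_W[OF A])
  next
    assume "no_W2 A \<and> no_W47 A \<and> no_W9 A"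
    then have "pr_W A = v1 + v3 + v5 + v6 + v8 + v10" by (simp add: s z)
    then show "pr_W A \<in> W1 + W3 + W5 + W6 + W8 + W10" using m by (simp add: set_plus_intro)
  qed
  show "pr_W A \<in> W1 + W3 + W4 + W5 + W6 + W7 + W8 \<longleftrightarrow> no_W2 A \<and> no_W9 A \<and> no_W10 A"
  proof
    assume "pr_W A \<in> W1 + W3 + W4 + W5 + W6 + W7 + W8"
    then have "no_W2 (pr_W A) \<and> no_W9 (pr_W A) \<and> no_W10 (pr_W A)"
      by (elim set_plus_elim) (use Ks no_W_add in simp)
    then show "no_W2 A \<and> no_W9 A \<and> no_W10 A" by (simp add: no_W_pr_W[OF A])
  next
    assume "no_W2 A \<and> no_W9 A \<and> no_W10 A"
    then have "pr_W A = v1 + v3 + v4 + v5 + v6 + v7 + v8" by (simp add: s z)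
    then show "pr_W A \<in> W1 + W3 + W4 + W5 + W6 + W7 + W8" using m by (simp add: set_plus_intro)
  qed
  show "pr_W A \<in> W1 + W2 + W3 + W5 + W6 + W8 \<longleftrightarrow> no_W47 A \<and> no_W9 A \<and> no_W10 A"
  proof
    assume "pr_W A \<in> W1 + W2 + W3 + W5 + W6 + W8"
    then have "no_W47 (pr_W A) \<and> no_W9 (pr_W A) \<and> no_W10 (pr_W A)"
      by (elim set_plus_elim) (use Ks no_W_add in simp)
    then show "no_W47 A \<and> no_W9 A \<and> no_W10 A" by (simp add: no_W_pr_W[OF A])
  next
    assume "no_W47 A \<and> no_W9 A \<and> no_W10 A"
    then have "pr_W A = v1 + v2 + v3 + v5 + v6 + v8" by (simp add: s z)
    then show "pr_W A \<in> W1 + W2 + W3 + W5 + W6 + W8" using m by (simp add: set_plus_intro)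
  qed
  show "pr_W A \<in> W1 + W3 + W5 + W6 + W8 \<longleftrightarrow> no_W2 A \<and> no_W47 A \<and> no_W9 A \<and> no_W10 A"
  proof
    assume "pr_W A \<in> W1 + W3 + W5 + W6 + W8"
    then have "no_W2 (pr_W A) \<and> no_W47 (pr_W A) \<and> no_W9 (pr_W A) \<and> no_W10 (pr_W A)"
      by (elim set_plus_elim) (use Ks no_W_add in simp)
    then show "no_W2 A \<and> no_W47 A \<and> no_W9 A \<and> no_W10 A" by (simp add: no_W_pr_W[OF A])
  next
    assume "no_W2 A \<and> no_W47 A \<and> no_W9 A \<and> no_W10 A"
    then have "pr_W A = v1 + v3 + v5 + v6 + v8" by (simp add: s z)
    then show "pr_W A \<in> W1 + W3 + W5 + W6 + W8" using m by (simp add: set_plus_intro)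
  qed
qed

section \<open>Smooth maps\<close>

text \<open>The derivative is a choice among all D with \<open>has_derivative\<close>; f and g admit
  the same D at x, so the choices agree even where nothing is differentiable.\<close>

lemma frechet_derivative_cong_open:
  assumes "open S" "x \<in> S" "\<And>y. y \<in> S \<Longrightarrow> f y = g y"
  shows "frechet_derivative f (at x) = frechet_derivative g (at x)"
proof -
  have "(f has_derivative D) (at x) \<longleftrightarrow> (g has_derivative D) (at x)" for D
    using has_derivative_transform_within_open[of f D x UNIV S g]
      has_derivative_transform_within_open[of g D x UNIV S f] assms by auto
  then show ?thesis by (simp add: frechet_derivative_def)
qed

lemma differentiable_cong_open:
  assumes "open S" "x \<in> S" "\<And>y. y \<in> S \<Longrightarrow> f y = g y"
  shows "f differentiable (at x) \<longleftrightarrow> g differentiable (at x)"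
proof -
  have "(f has_derivative D) (at x) \<longleftrightarrow> (g has_derivative D) (at x)" for D
    using has_derivative_transform_within_open[of f D x UNIV S g]
      has_derivative_transform_within_open[of g D x UNIV S f] assms by auto
  then show ?thesis by (simp add: differentiable_def)
qed

lemma Ck_on_cong:
  assumes "open S" "\<And>y. y \<in> S \<Longrightarrow> f y = g y"
  shows "Ck_on k S f \<longleftrightarrow> Ck_on k S g"
  using assms(2)
proof (induction k arbitrary: f g)
  case 0
  then show ?case by (simp cong: continuous_on_cong)
next
  case (Suc k)
  have d: "f differentiable (at x) \<longleftrightarrow> g differentiable (at x)" if "x \<in> S" for x
    using differentiable_cong_open[OF assms(1) that Suc.prems] .
  have "frechet_derivative f (at x) = frechet_derivative g (at x)" if "x \<in> S" for x
    using frechet_derivative_cong_open[OF assms(1) that Suc.prems] .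
  then have "Ck_on k S (\<lambda>x. frechet_derivative f (at x) v) = Ck_on k S (\<lambda>x. frechet_derivative g (at x) v)" for v
    by (intro Suc.IH) simp
  then show ?case using d by simp
qed

lemma Ck_on_subset: "Ck_on k S f \<Longrightarrow> T \<subseteq> S \<Longrightarrow> Ck_on k T f"
proof (induction k arbitrary: f)
  case 0
  then show ?case by (simp add: continuous_on_subset)
next
  case (Suc k)
  then show ?case by (simp add: subset_iff)
qed

lemma Ck_on_Suc_imp: "Ck_on (Suc k) S f \<Longrightarrow> Ck_on k S f"
proof (induction k arbitrary: f)
  case 0
  then show ?case
    by (simp add: continuous_at_imp_continuous_on differentiable_imp_continuous_within)
next
  case (Suc k)
  have "Ck_on (Suc k) S (\<lambda>x. frechet_derivative f (at x) v)" for v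
    using Suc.prems by simp
  then have "Ck_on k S (\<lambda>x. frechet_derivative f (at x) v)" for v
    by (rule Suc.IH)
  then show ?case using Suc.prems by simp
qed

lemma Ck_on_const: "Ck_on k S (\<lambda>x. c)"
  by (induction k arbitrary: c) simp_all

lemma Ck_on_bounded_linear:
  assumes "open S" "bounded_linear L" "Ck_on k S f"
  shows "Ck_on k S (\<lambda>x. L (f x))"
  using assms(3)
proof (induction k arbitrary: f)
  case 0
  then show ?case by (simp add: bounded_linear.continuous_on[OF assms(2)])
next
  case (Suc k)
  have d: "((\<lambda>x. L (f x)) has_derivative (\<lambda>v. L (frechet_derivative f (at x) v))) (at x)" if "x \<in> S" for x
    using Suc.prems that
    by (intro bounded_linear.has_derivative[OF assms(2)]) (auto simp: frechet_derivative_works[symmetric])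
  have "Ck_on k S (\<lambda>x. L (frechet_derivative f (at x) v))" for v
    using Suc by simp
  moreover have "frechet_derivative (\<lambda>x. L (f x)) (at x) v = L (frechet_derivative f (at x) v)" if "x \<in> S" for x v
    by (rule frechet_derivative_at[OF d[OF that], THEN fun_cong, symmetric])
  ultimately have "Ck_on k S (\<lambda>x. frechet_derivative (\<lambda>x. L (f x)) (at x) v)" for v
    by (subst Ck_on_cong[OF assms(1), of _ "\<lambda>x. L (frechet_derivative f (at x) v)"]) auto
  then show ?case using d by (auto simp: differentiable_def)
qed

lemma Ck_on_add:
  assumes "open S" "Ck_on k S f" "Ck_on k S g"
  shows "Ck_on k S (\<lambda>x. f x + g x)"
  using assms(2,3)
proof (induction k arbitrary: f g)
  case 0
  then show ?case by (simp add: continuous_on_add)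
next
  case (Suc k)
  have d: "((\<lambda>x. f x + g x) has_derivative (\<lambda>v. frechet_derivative f (at x) v + frechet_derivative g (at x) v)) (at x)"
    if "x \<in> S" for x
    using Suc.prems that by (intro has_derivative_add) (auto simp: frechet_derivative_works[symmetric])
  have "Ck_on k S (\<lambda>x. frechet_derivative f (at x) v + frechet_derivative g (at x) v)" for v
    using Suc by simp
  moreover have "frechet_derivative (\<lambda>x. f x + g x) (at x) v = frechet_derivative f (at x) v + frechet_derivative g (at x) v"
    if "x \<in> S" for x v
    by (rule frechet_derivative_at[OF d[OF that], THEN fun_cong, symmetric])
  ultimately have "Ck_on k S (\<lambda>x. frechet_derivative (\<lambda>x. f x + g x) (at x) v)" for v
    by (subst Ck_on_cong[OF assms(1), of _ "\<lambda>x. frechet_derivative f (at x) v + frechet_derivative g (at x) v"]) auto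
  then show ?case using d by (auto simp: differentiable_def)
qed

lemma Ck_on_sum:
  assumes "open S" "finite I" "\<And>i. i \<in> I \<Longrightarrow> Ck_on k S (f i)"
  shows "Ck_on k S (\<lambda>x. \<Sum>i\<in>I. f i x)"
  using assms(2,3) by (induction I rule: finite_induct) (simp_all add: Ck_on_const Ck_on_add assms(1))

lemma Ck_on_scaleR:
  fixes f :: "'a::real_normed_vector \<Rightarrow> real" and g :: "'a \<Rightarrow> 'b::real_normed_vector"
  assumes "open S" "Ck_on k S f" "Ck_on k S g"
  shows "Ck_on k S (\<lambda>x. f x *\<^sub>R g x)"
  using assms(2,3)
proof (induction k arbitrary: f g)
  case 0
  then show ?case by (simp add: continuous_on_scaleR)
next
  case (Suc k)
  have d: "((\<lambda>x. f x *\<^sub>R g x) has_derivative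
      (\<lambda>v. f x *\<^sub>R frechet_derivative g (at x) v + frechet_derivative f (at x) v *\<^sub>R g x)) (at x)"
    if "x \<in> S" for x
    using Suc.prems that by (intro has_derivative_scaleR) (auto simp: frechet_derivative_works[symmetric])
  \<comment> \<open>The product rule also contains the undifferentiated factors, for which the lower
    order of smoothness is needed.\<close>
  have "Ck_on k S f" "Ck_on k S g"
    using Suc.prems Ck_on_Suc_imp by blast+
  then have "Ck_on k S (\<lambda>x. f x *\<^sub>R frechet_derivative g (at x) v + frechet_derivative f (at x) v *\<^sub>R g x)" for v
    using Suc.prems by (intro Ck_on_add[OF assms(1)] Suc.IH) auto
  moreover have "frechet_derivative (\<lambda>x. f x *\<^sub>R g x) (at x) v =
      f x *\<^sub>R frechet_derivative g (at x) v + frechet_derivative f (at x) v *\<^sub>R g x"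
    if "x \<in> S" for x v
    by (rule frechet_derivative_at[OF d[OF that], THEN fun_cong, symmetric])
  ultimately have "Ck_on k S (\<lambda>x. frechet_derivative (\<lambda>x. f x *\<^sub>R g x) (at x) v)" for v
    by (subst Ck_on_cong[OF assms(1),
          of _ "\<lambda>x. f x *\<^sub>R frechet_derivative g (at x) v + frechet_derivative f (at x) v *\<^sub>R g x"]) auto
  then show ?case using d by (auto simp: differentiable_def)
qed

text \<open>\<open>Ck_on\<close> controls derivatives in fixed directions only, but the chain rule
  differentiates f in the direction Dg(x)v, which varies with x. Expanding this vector over
  \<open>Basis\<close> leaves fixed directions with scalar coefficients, to which sum, product and
  induction hypothesis apply.\<close>

lemma Ck_on_compose:
  fixes f :: "'b::euclidean_space \<Rightarrow> 'c::real_normed_vector" and g :: "'a::real_normed_vector \<Rightarrow> 'b"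
  assumes "open S" "open T" "g ` S \<subseteq> T" "Ck_on k T f" "Ck_on k S g"
  shows "Ck_on k S (\<lambda>x. f (g x))"
  using assms(4,5)
proof (induction k arbitrary: f)
  case 0
  then show ?case using continuous_on_compose2[of T f S g] assms(3) by simp
next
  case (Suc k)
  let ?D = "\<lambda>v x. \<Sum>b\<in>Basis. (frechet_derivative g (at x) v \<bullet> b) *\<^sub>R frechet_derivative f (at (g x)) b"
  have d: "((\<lambda>x. f (g x)) has_derivative (\<lambda>v. ?D v x)) (at x)" if "x \<in> S" for x
  proof -
    have f: "(f has_derivative frechet_derivative f (at (g x))) (at (g x))"
      using Suc.prems that assms(3) by (auto simp: frechet_derivative_works[symmetric])
    have "(g has_derivative frechet_derivative g (at x)) (at x)"
      using Suc.prems that by (auto simp: frechet_derivative_works[symmetric])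
    from diff_chain_at[OF this f]
    have h: "((\<lambda>x. f (g x)) has_derivative (\<lambda>v. frechet_derivative f (at (g x)) (frechet_derivative g (at x) v))) (at x)"
      by (simp add: o_def)
    have "frechet_derivative f (at (g x)) w = (\<Sum>b\<in>Basis. (w \<bullet> b) *\<^sub>R frechet_derivative f (at (g x)) b)" for w
    proof -
      have l: "linear (frechet_derivative f (at (g x)))"
        using f has_derivative_linear by blast
      have "frechet_derivative f (at (g x)) (\<Sum>b\<in>Basis. (w \<bullet> b) *\<^sub>R b) =
          (\<Sum>b\<in>Basis. (w \<bullet> b) *\<^sub>R frechet_derivative f (at (g x)) b)"
        by (simp only: linear_sum[OF l] linear_cmul[OF l])
      then show ?thesis by (simp only: euclidean_representation)
    qed
    then have "(\<lambda>v. frechet_derivative f (at (g x)) (frechet_derivative g (at x) v)) = (\<lambda>v. ?D v x)"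
      by (intro ext)
    from h[unfolded this] show ?thesis .
  qed
  have g: "Ck_on k S g" using Suc.prems Ck_on_Suc_imp by blast
  have "Ck_on k S (?D v)" for v
  proof (intro Ck_on_sum[OF assms(1)] Ck_on_scaleR[OF assms(1)] finite_Basis)
    fix b :: 'b
    show "Ck_on k S (\<lambda>x. frechet_derivative g (at x) v \<bullet> b)"
      using Suc.prems by (intro Ck_on_bounded_linear[OF assms(1) bounded_linear_inner_left]) simp
    show "Ck_on k S (\<lambda>x. frechet_derivative f (at (g x)) b)"
      using Suc.prems g by (intro Suc.IH) simp_all
  qed
  moreover have "frechet_derivative (\<lambda>x. f (g x)) (at x) v = ?D v x" if "x \<in> S" for x v
    by (rule frechet_derivative_at[OF d[OF that], THEN fun_cong, symmetric])
  ultimately have "Ck_on k S (\<lambda>x. frechet_derivative (\<lambda>x. f (g x)) (at x) v)" for v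
    by (subst Ck_on_cong[OF assms(1), of _ "?D v"]) auto
  then show ?case using d by (auto simp: differentiable_def)
qed

text \<open>Factor and exponent are both general, so that the derivative is again of this form and
  the induction closes. Used for the exponent -1/2, in the normalisation of vector fields.\<close>

lemma Ck_on_powr: "Ck_on k {0<..} (\<lambda>t :: real. c * t powr a)"
proof (induction k arbitrary: a c)
  case 0
  show ?case by (auto intro!: continuous_intros)
next
  case (Suc k)
  have d: "((\<lambda>t. c * t powr a) has_derivative (\<lambda>v. ((c * a) * x powr (a - 1)) * v)) (at x)" if "x > 0" for x
  proof -
    have "((\<lambda>t. c * t powr a) has_real_derivative (c * a) * x powr (a - 1)) (at x)"
      using that by (auto intro!: derivative_eq_intros)
    then show ?thesis by (simp only: has_field_derivative_def)
  qed
  have e: "frechet_derivative (\<lambda>t. c * t powr a) (at x) v = (v * (c * a)) * x powr (a - 1)" if "x \<in> {0<..}" for x v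
    using frechet_derivative_at[OF d[of x], THEN fun_cong, of v] that by (simp add: mult_ac)
  have "Ck_on k {0<..} (\<lambda>x. frechet_derivative (\<lambda>t. c * t powr a) (at x) v)" for v
    by (rule Ck_on_cong[OF open_greaterThan e, THEN iffD2, OF _ Suc.IH])
  then show ?case using d by (auto simp: differentiable_def)
qed

lemma smooth_on_inverse_sqrt:
  fixes f :: "'a::real_normed_vector \<Rightarrow> real"
  assumes "open S" "smooth_on S f" "\<And>x. x \<in> S \<Longrightarrow> f x > 0"
  shows "smooth_on S (\<lambda>x. 1 / sqrt (f x))"
  unfolding smooth_on_def
proof
  fix k
  have "Ck_on k S (\<lambda>x. 1 * f x powr (- 1/2))"
    using assms by (intro Ck_on_compose[OF assms(1) open_greaterThan _ Ck_on_powr]) (auto simp: smooth_on_def)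
  moreover have "1 * f x powr (- 1/2) = 1 / sqrt (f x)" if "x \<in> S" for x
    using assms(3)[OF that] by (simp add: powr_minus_divide powr_half_sqrt)
  ultimately show "Ck_on k S (\<lambda>x. 1 / sqrt (f x))"
    by (subst Ck_on_cong[OF assms(1), of _ "\<lambda>x. 1 * f x powr (- 1/2)"]) auto
qed

lemma smooth_on_frechet_derivative: "smooth_on S f \<Longrightarrow> smooth_on S (\<lambda>x. frechet_derivative f (at x) v)"
  unfolding smooth_on_def by (metis Ck_on.simps(2))

lemma smooth_on_differentiable: "smooth_on S f \<Longrightarrow> x \<in> S \<Longrightarrow> f differentiable (at x)"
  unfolding smooth_on_def by (metis Ck_on.simps(2))

lemma smooth_on_continuous: "smooth_on S f \<Longrightarrow> continuous_on S f"
  unfolding smooth_on_def by (metis Ck_on.simps(1))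

lemma smooth_on_cong: "open S \<Longrightarrow> (\<And>y. y \<in> S \<Longrightarrow> f y = g y) \<Longrightarrow> smooth_on S f \<longleftrightarrow> smooth_on S g"
  unfolding smooth_on_def by (metis Ck_on_cong)

lemma smooth_on_subset: "smooth_on S f \<Longrightarrow> T \<subseteq> S \<Longrightarrow> smooth_on T f"
  unfolding smooth_on_def using Ck_on_subset by blast

lemma smooth_on_const: "smooth_on S (\<lambda>x. c)"
  by (simp add: smooth_on_def Ck_on_const)

lemma smooth_on_add: "open S \<Longrightarrow> smooth_on S f \<Longrightarrow> smooth_on S g \<Longrightarrow> smooth_on S (\<lambda>x. f x + g x)"
  by (simp add: smooth_on_def Ck_on_add)

lemma smooth_on_scaleR:
  fixes f :: "'a::real_normed_vector \<Rightarrow> real"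
  shows "open S \<Longrightarrow> smooth_on S f \<Longrightarrow> smooth_on S g \<Longrightarrow> smooth_on S (\<lambda>x. f x *\<^sub>R g x)"
  by (simp add: smooth_on_def Ck_on_scaleR)

lemma smooth_on_compose:
  fixes f :: "'b::euclidean_space \<Rightarrow> 'c::real_normed_vector"
  shows "open S \<Longrightarrow> open T \<Longrightarrow> g ` S \<subseteq> T \<Longrightarrow> smooth_on T f \<Longrightarrow> smooth_on S g \<Longrightarrow> smooth_on S (\<lambda>x. f (g x))"
  by (simp add: smooth_on_def Ck_on_compose)

section \<open>Almost contact metric manifolds\<close>

lemma tscale_0 [simp]: "tscale 0 v = 0" "tscale a 0 = 0"
  by (simp_all add: tscale_def fun_eq_iff)

lemma tscale_1 [simp]: "tscale 1 v = v"
  by (simp add: tscale_def)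

lemma tscale_minus: "tscale (- 1) v = - v"
  by (simp add: tscale_def fun_eq_iff)

lemma tscale_distribs: "tscale (a + b) v = tscale a v + tscale b v" "tscale a (v + w) = tscale a v + tscale a w"
  "tscale a (tscale b v) = tscale (a * b) v"
  by (simp_all add: tscale_def fun_eq_iff scaleR_add_left scaleR_add_right)

lemma sum_apply_fun: "(\<Sum>i\<in>I. f i) c = (\<Sum>i\<in>I. f i c)" for f :: "'i \<Rightarrow> 'a \<Rightarrow> 'b::comm_monoid_add"
  by (induction I rule: infinite_finite_induct) simp_all

locale acm5 =
  fixes \<A> :: "'a::{t2_space, second_countable_topology} chart set"
    and g :: "'a \<Rightarrow> 'a tvec \<Rightarrow> 'a tvec \<Rightarrow> real"
    and \<xi> :: "'a \<Rightarrow> 'a tvec"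
    and \<eta> :: "'a \<Rightarrow> 'a tvec \<Rightarrow> real"
    and \<phi> :: "'a \<Rightarrow> 'a tvec \<Rightarrow> 'a tvec"
    and nabla :: "'a \<Rightarrow> 'a tvec \<Rightarrow> ('a \<Rightarrow> 'a tvec) \<Rightarrow> 'a tvec"
  assumes acm: "almost_contact_metric_5_manifold \<A> g \<xi> \<eta> \<phi>"
    and lc: "levi_civita \<A> g nabla"
begin

section \<open>Charts and tangent vectors\<close>

abbreviation T where "T \<equiv> tangent \<A>"

lemma atlas: "smooth_atlas \<A>" and metric: "riemannian_metric \<A> g" and xi_vfield: "vfield \<A> UNIV \<xi>"
  and endo: "endomorphism_field \<A> \<phi>"
  using acm by (simp_all add: almost_contact_metric_5_manifold_def)

lemma chart_exists: obtains c where "c \<in> \<A>" "p \<in> fst c"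
proof -
  have "p \<in> (\<Union>c\<in>\<A>. fst c)" using atlas by (simp add: smooth_atlas_def)
  then show thesis using that by blast
qed

context
  fixes c assumes c: "c \<in> \<A>"
begin

lemma chart_open: "open (fst c)"
  and chart_homeo: "homeomorphism (fst c) (snd c ` fst c) (snd c) (chart_inv c)"
  and chart_image_open': "open (snd c ` fst c)"
  using atlas c by (simp_all add: smooth_atlas_def)

lemma chart_inv_chart: "p \<in> fst c \<Longrightarrow> chart_inv c (snd c p) = p"
  using chart_homeo by (simp add: homeomorphism_def)

lemma chart_image_open:
  assumes "open U"
  shows "open (snd c ` (U \<inter> fst c))"
proof -
  have "openin (top_of_set (fst c)) (U \<inter> fst c)"
    using assms by (metis inf_commute openin_open_Int)
  then have "openin (top_of_set (snd c ` fst c)) (snd c ` (U \<inter> fst c))"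
    using chart_homeo homeomorphism_imp_open_map by blast
  then show ?thesis
    using chart_image_open' openin_open_trans by blast
qed

lemma chart_chart_inv: "x \<in> snd c ` (U \<inter> fst c) \<Longrightarrow> snd c (chart_inv c x) = x \<and> chart_inv c x \<in> U \<and> chart_inv c x \<in> fst c"
  using chart_inv_chart by auto

end

lemma transition_smooth:
  "c \<in> \<A> \<Longrightarrow> d \<in> \<A> \<Longrightarrow> smooth_on (snd c ` (fst c \<inter> fst d)) (snd d \<circ> chart_inv c)"
  using atlas by (simp add: smooth_atlas_def)

lemma transition_open:
  "c \<in> \<A> \<Longrightarrow> d \<in> \<A> \<Longrightarrow> open (snd c ` (fst c \<inter> fst d))"
  using chart_image_open[of c "fst d"] chart_open[of d] by (simp add: inf_commute)

lemma transition_derivative: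
  assumes "c \<in> \<A>" "d \<in> \<A>" "p \<in> fst c" "p \<in> fst d"
  shows "((snd d \<circ> chart_inv c) has_derivative frechet_derivative (snd d \<circ> chart_inv c) (at (snd c p))) (at (snd c p))"
  using smooth_on_differentiable[OF transition_smooth[OF assms(1,2)]] assms
  by (simp add: frechet_derivative_works[symmetric])

lemma transition_linear:
  assumes "c \<in> \<A>" "d \<in> \<A>" "p \<in> fst c" "p \<in> fst d"
  shows "linear (frechet_derivative (snd d \<circ> chart_inv c) (at (snd c p)))"
  using transition_derivative[OF assms] has_derivative_linear by blast

lemma tangentD:
  "u \<in> T p \<Longrightarrow> c \<in> \<A> \<Longrightarrow> d \<in> \<A> \<Longrightarrow> p \<in> fst c \<Longrightarrow> p \<in> fst d \<Longrightarrow>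
   u d = frechet_derivative (snd d \<circ> chart_inv c) (at (snd c p)) (u c)"
  unfolding tangent_def by blast

lemma tangent_outside: "u \<in> T p \<Longrightarrow> c \<notin> \<A> \<or> p \<notin> fst c \<Longrightarrow> u c = 0"
  unfolding tangent_def by blast

lemma tangentI:
  "(\<And>c. c \<notin> \<A> \<or> p \<notin> fst c \<Longrightarrow> v c = 0) \<Longrightarrow>
   (\<And>c d. c \<in> \<A> \<Longrightarrow> d \<in> \<A> \<Longrightarrow> p \<in> fst c \<Longrightarrow> p \<in> fst d \<Longrightarrow>
      v d = frechet_derivative (snd d \<circ> chart_inv c) (at (snd c p)) (v c)) \<Longrightarrow> v \<in> T p"
  unfolding tangent_def by blast

lemma tangent_add:
  assumes "u \<in> T p" "v \<in> T p"
  shows "u + v \<in> T p"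
proof (rule tangentI)
  show "(u + v) c = 0" if "c \<notin> \<A> \<or> p \<notin> fst c" for c
    using tangent_outside[OF assms(1) that] tangent_outside[OF assms(2) that] by simp
  show "(u + v) d = frechet_derivative (snd d \<circ> chart_inv c) (at (snd c p)) ((u + v) c)"
    if "c \<in> \<A>" "d \<in> \<A>" "p \<in> fst c" "p \<in> fst d" for c d
    unfolding plus_fun_def linear_add[OF transition_linear[OF that]]
    using tangentD[OF assms(1) that] tangentD[OF assms(2) that] by metis
qed

lemma tangent_scale:
  assumes "u \<in> T p"
  shows "tscale a u \<in> T p"
proof (rule tangentI)
  show "tscale a u c = 0" if "c \<notin> \<A> \<or> p \<notin> fst c" for c
    using tangent_outside[OF assms that] by (simp add: tscale_def)
  show "tscale a u d = frechet_derivative (snd d \<circ> chart_inv c) (at (snd c p)) (tscale a u c)"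
    if "c \<in> \<A>" "d \<in> \<A>" "p \<in> fst c" "p \<in> fst d" for c d
    unfolding tscale_def linear_cmul[OF transition_linear[OF that]]
    using tangentD[OF assms that] by metis
qed

lemma tangent_0: "0 \<in> T p"
  by (rule tangentI) (simp_all add: linear_0[OF transition_linear])

lemma tangent_minus: "u \<in> T p \<Longrightarrow> - u \<in> T p"
  using tangent_scale[of u p "- 1"] by (simp add: tscale_minus)

lemma tangent_diff: "u \<in> T p \<Longrightarrow> v \<in> T p \<Longrightarrow> u - v \<in> T p"
  using tangent_add[OF _ tangent_minus, of u p v] by simp

lemma tangent_sum: "(\<And>i. i \<in> I \<Longrightarrow> u i \<in> T p) \<Longrightarrow> (\<Sum>i\<in>I. u i) \<in> T p"
  by (induction I rule: infinite_finite_induct) (simp_all add: tangent_0 tangent_add)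

text \<open>One chart around p suffices: the transition differentials determine the coordinates in
  all others around p, and elsewhere the value is 0.\<close>

lemma tangent_eqI:
  assumes "u \<in> T p" "v \<in> T p" "c \<in> \<A>" "p \<in> fst c" "u c = v c"
  shows "u = v"
proof
  fix d
  show "u d = v d"
  proof (cases "d \<in> \<A> \<and> p \<in> fst d")
    case True
    then show ?thesis
      using tangentD[OF assms(1,3) _ assms(4)] tangentD[OF assms(2,3) _ assms(4)] assms(5) by metis
  next
    case False
    then show ?thesis using tangent_outside assms by metis
  qed
qed

section \<open>The metric and the endomorphism on a tangent space\<close>

lemma g_sym: "u \<in> T p \<Longrightarrow> v \<in> T p \<Longrightarrow> g p u v = g p v u"
  and g_pos: "u \<in> T p \<Longrightarrow> u \<noteq> 0 \<Longrightarrow> g p u u > 0"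
  and g_scale_left: "u \<in> T p \<Longrightarrow> v \<in> T p \<Longrightarrow> g p (tscale a u) v = a * g p u v"
  and g_add_left: "u \<in> T p \<Longrightarrow> v \<in> T p \<Longrightarrow> w \<in> T p \<Longrightarrow> g p (u + v) w = g p u w + g p v w"
  using metric unfolding riemannian_metric_def by blast+

lemma g_smooth: "open U \<Longrightarrow> vfield \<A> U X \<Longrightarrow> vfield \<A> U Y \<Longrightarrow> smooth_fun \<A> U (\<lambda>p. g p (X p) (Y p))"
  using metric unfolding riemannian_metric_def by blast

lemma g_scale_right: "u \<in> T p \<Longrightarrow> v \<in> T p \<Longrightarrow> g p u (tscale a v) = a * g p u v"
  using g_sym g_scale_left tangent_scale by metis

lemma g_add_right: "u \<in> T p \<Longrightarrow> v \<in> T p \<Longrightarrow> w \<in> T p \<Longrightarrow> g p u (v + w) = g p u v + g p u w"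
  using g_sym[of u p] g_add_left tangent_add by metis

lemma g_minus_left: "u \<in> T p \<Longrightarrow> v \<in> T p \<Longrightarrow> g p (- u) v = - g p u v"
  using g_scale_left[of u p v "- 1"] by (simp add: tscale_minus)

lemma g_minus_right: "u \<in> T p \<Longrightarrow> v \<in> T p \<Longrightarrow> g p u (- v) = - g p u v"
  using g_scale_right[of u p v "- 1"] by (simp add: tscale_minus)

lemma g_diff_right: "u \<in> T p \<Longrightarrow> v \<in> T p \<Longrightarrow> w \<in> T p \<Longrightarrow> g p u (v - w) = g p u v - g p u w"
  using g_add_right[OF _ _ tangent_minus, of u p v w] by (simp add: g_minus_right)

lemma g_0_right: "u \<in> T p \<Longrightarrow> g p u 0 = 0"
  using g_scale_right[of u p u 0] by simp

lemma g_sum_right: "u \<in> T p \<Longrightarrow> (\<And>i. i \<in> I \<Longrightarrow> v i \<in> T p) \<Longrightarrow> g p u (\<Sum>i\<in>I. v i) = (\<Sum>i\<in>I. g p u (v i))"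
  by (induction I rule: infinite_finite_induct) (simp_all add: g_0_right g_add_right tangent_sum)

lemma g_sum_left: "u \<in> T p \<Longrightarrow> (\<And>i. i \<in> I \<Longrightarrow> v i \<in> T p) \<Longrightarrow> g p (\<Sum>i\<in>I. v i) u = (\<Sum>i\<in>I. g p (v i) u)"
  using g_sum_right[of u p I v] g_sym tangent_sum by (metis (mono_tags, lifting) sum.cong)

lemma phi_tangent: "u \<in> T p \<Longrightarrow> \<phi> p u \<in> T p"
  and phi_scale: "u \<in> T p \<Longrightarrow> \<phi> p (tscale a u) = tscale a (\<phi> p u)"
  and phi_add: "u \<in> T p \<Longrightarrow> v \<in> T p \<Longrightarrow> \<phi> p (u + v) = \<phi> p u + \<phi> p v"
  and phi_vfield: "open U \<Longrightarrow> vfield \<A> U X \<Longrightarrow> vfield \<A> U (\<lambda>p. \<phi> p (X p))"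
  using endo unfolding endomorphism_field_def by blast+

lemma phi_0: "\<phi> p 0 = 0"
  using phi_scale[OF tangent_0, of p 0] by simp

lemma phi_minus: "u \<in> T p \<Longrightarrow> \<phi> p (- u) = - \<phi> p u"
  using phi_scale[of u p "- 1"] by (simp add: tscale_minus)

lemma phi_sum: "(\<And>i. i \<in> I \<Longrightarrow> v i \<in> T p) \<Longrightarrow> \<phi> p (\<Sum>i\<in>I. v i) = (\<Sum>i\<in>I. \<phi> p (v i))"
  by (induction I rule: infinite_finite_induct) (simp_all add: phi_0 phi_add tangent_sum)

lemma xi_tangent: "\<xi> p \<in> T p"
  using xi_vfield by (simp add: vfield_def)

lemma xi_unit: "g p (\<xi> p) (\<xi> p) = 1" and phi_xi: "\<phi> p (\<xi> p) = 0"
  using acm unfolding almost_contact_metric_5_manifold_def by blast+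

lemma eta_eq: "u \<in> T p \<Longrightarrow> \<eta> p u = g p (\<xi> p) u"
  using acm unfolding almost_contact_metric_5_manifold_def by blast

lemma phi_phi: "u \<in> T p \<Longrightarrow> \<phi> p (\<phi> p u) = - u + tscale (g p (\<xi> p) u) (\<xi> p)"
  using acm eta_eq unfolding almost_contact_metric_5_manifold_def by metis

lemma g_phi_phi:
  "u \<in> T p \<Longrightarrow> v \<in> T p \<Longrightarrow> g p (\<phi> p u) (\<phi> p v) = g p u v - g p (\<xi> p) u * g p (\<xi> p) v"
  using acm eta_eq unfolding almost_contact_metric_5_manifold_def by metis

text \<open>The formula for \<phi>\<phi> is applied in two ways to \<phi>\<phi>\<phi>u: to the
  vector \<phi>u, and inside the outer \<phi>, where \<phi>\<xi> = 0. The results differ by g(\<xi>,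
  \<phi>u)\<xi>.\<close>

lemma g_xi_phi:
  assumes u: "u \<in> T p"
  shows "g p (\<xi> p) (\<phi> p u) = 0"
proof -
  let ?a = "g p (\<xi> p) (\<phi> p u)"
  have "\<phi> p (\<phi> p (\<phi> p u)) = - \<phi> p u + tscale ?a (\<xi> p)"
    by (rule phi_phi[OF phi_tangent[OF u]])
  moreover have "\<phi> p (\<phi> p (\<phi> p u)) = - \<phi> p u"
    unfolding phi_phi[OF u] phi_add[OF tangent_minus[OF u] tangent_scale[OF xi_tangent]] phi_minus[OF u]
      phi_scale[OF xi_tangent] phi_xi by simp
  ultimately have "tscale ?a (\<xi> p) = 0" by simp
  then have "g p (\<xi> p) (tscale ?a (\<xi> p)) = 0" by (simp add: g_0_right[OF xi_tangent])
  then show ?thesis by (simp add: g_scale_right[OF xi_tangent xi_tangent] xi_unit)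
qed

text \<open>Evaluates g(\<phi>u, \<phi>\<phi>v) once by compatibility of g with \<phi> and once by
  the formula for \<phi>\<phi>.\<close>

lemma g_phi_left:
  assumes u: "u \<in> T p" and v: "v \<in> T p"
  shows "g p (\<phi> p u) v = - g p u (\<phi> p v)"
proof -
  note pu = phi_tangent[OF u] and pv = phi_tangent[OF v]
  have "g p (\<phi> p u) (\<phi> p (\<phi> p v)) = g p u (\<phi> p v)"
    using g_phi_phi[OF u pv] g_xi_phi[OF v] by simp
  moreover have "g p (\<phi> p u) (\<phi> p (\<phi> p v)) = - g p (\<phi> p u) v"
    unfolding phi_phi[OF v] g_add_right[OF pu tangent_minus[OF v] tangent_scale[OF xi_tangent]]
      g_minus_right[OF pu v] g_scale_right[OF pu xi_tangent] g_sym[OF pu xi_tangent] g_xi_phi[OF u] by simp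
  ultimately show ?thesis by simp
qed

section \<open>Smooth functions and vector fields\<close>

lemma smooth_fun_const: "smooth_fun \<A> U (\<lambda>p. a)"
  by (simp add: smooth_fun_def comp_def smooth_on_const)

lemma smooth_fun_subset: "smooth_fun \<A> U f \<Longrightarrow> V \<subseteq> U \<Longrightarrow> smooth_fun \<A> V f"
  unfolding smooth_fun_def by (meson Int_mono image_mono order_refl smooth_on_subset)

lemma vfield_tangent: "vfield \<A> U X \<Longrightarrow> p \<in> U \<Longrightarrow> X p \<in> T p"
  by (simp add: vfield_def)

lemma vfield_subset: "vfield \<A> U X \<Longrightarrow> V \<subseteq> U \<Longrightarrow> vfield \<A> V X"
  unfolding vfield_def by (meson Int_mono image_mono order_refl smooth_on_subset subsetD)

lemma vfield_0: "vfield \<A> U (\<lambda>p. 0)"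
  by (simp add: vfield_def tangent_0 smooth_on_const)

lemma vfield_smooth: "vfield \<A> U X \<Longrightarrow> c \<in> \<A> \<Longrightarrow> smooth_on (snd c ` (U \<inter> fst c)) (\<lambda>x. X (chart_inv c x) c)"
  by (simp add: vfield_def)

lemma vfieldI:
  "(\<And>p. p \<in> U \<Longrightarrow> X p \<in> T p) \<Longrightarrow>
   (\<And>c. c \<in> \<A> \<Longrightarrow> smooth_on (snd c ` (U \<inter> fst c)) (\<lambda>x. X (chart_inv c x) c)) \<Longrightarrow> vfield \<A> U X"
  by (simp add: vfield_def)

lemma vfield_add:
  assumes "open U" "vfield \<A> U X" "vfield \<A> U Y"
  shows "vfield \<A> U (\<lambda>p. X p + Y p)"
proof (rule vfieldI)
  show "X p + Y p \<in> T p" if "p \<in> U" for p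
    using assms that by (intro tangent_add vfield_tangent)
  show "smooth_on (snd c ` (U \<inter> fst c)) (\<lambda>x. (X (chart_inv c x) + Y (chart_inv c x)) c)" if "c \<in> \<A>" for c
    unfolding plus_fun_def using assms that by (intro smooth_on_add chart_image_open vfield_smooth)
qed

lemma vfield_tscale:
  assumes "open U" "smooth_fun \<A> U f" "vfield \<A> U X"
  shows "vfield \<A> U (\<lambda>p. tscale (f p) (X p))"
proof (rule vfieldI)
  show "tscale (f p) (X p) \<in> T p" if "p \<in> U" for p
    using assms that by (intro tangent_scale vfield_tangent)
  show "smooth_on (snd c ` (U \<inter> fst c)) (\<lambda>x. tscale (f (chart_inv c x)) (X (chart_inv c x)) c)" if "c \<in> \<A>" for c
    unfolding tscale_def using assms that
    by (intro smooth_on_scaleR chart_image_open vfield_smooth) (simp_all add: smooth_fun_def comp_def)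
qed

lemma vfield_sum:
  "open U \<Longrightarrow> (\<And>i. i \<in> I \<Longrightarrow> vfield \<A> U (X i)) \<Longrightarrow> vfield \<A> U (\<lambda>p. \<Sum>i\<in>I. X i p)"
  by (induction I rule: infinite_finite_induct) (simp_all add: vfield_0 vfield_add)

lemma dir_deriv_cong:
  assumes "open U" "p \<in> U" "\<And>q. q \<in> U \<Longrightarrow> f q = h q"
  shows "dir_deriv \<A> p v f = dir_deriv \<A> p v h"
proof -
  let ?c = "SOME c. c \<in> \<A> \<and> p \<in> fst c"
  have c: "?c \<in> \<A>" "p \<in> fst ?c"
    using someI_ex[of "\<lambda>c. c \<in> \<A> \<and> p \<in> fst c"] chart_exists by metis+
  have "frechet_derivative (f \<circ> chart_inv ?c) (at (snd ?c p)) = frechet_derivative (h \<circ> chart_inv ?c) (at (snd ?c p))"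
  proof (rule frechet_derivative_cong_open[OF chart_image_open[OF c(1) assms(1)]])
    show "snd ?c p \<in> snd ?c ` (U \<inter> fst ?c)" using c assms by blast
    show "(f \<circ> chart_inv ?c) x = (h \<circ> chart_inv ?c) x" if "x \<in> snd ?c ` (U \<inter> fst ?c)" for x
      using chart_chart_inv[OF c(1) that] assms(3) by simp
  qed
  then show ?thesis by (simp add: dir_deriv_def Let_def)
qed

lemma dir_deriv_const: "dir_deriv \<A> p v (\<lambda>q. a) = 0"
  by (simp add: dir_deriv_def Let_def comp_def)

section \<open>The Levi-Civita connection\<close>

lemma conn: "linear_connection \<A> nabla"
  using lc by (simp add: levi_civita_def)

lemma torsion_free:
  "open U \<Longrightarrow> vfield \<A> U X \<Longrightarrow> vfield \<A> U Y \<Longrightarrow> p \<in> U \<Longrightarrow>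
   lie_bracket \<A> X Y p = nabla p (X p) Y - nabla p (Y p) X"
  using lc unfolding levi_civita_def by metis

lemma metric_compat:
  "open U \<Longrightarrow> vfield \<A> U X \<Longrightarrow> vfield \<A> U Y \<Longrightarrow> p \<in> U \<Longrightarrow> v \<in> T p \<Longrightarrow>
   dir_deriv \<A> p v (\<lambda>q. g q (X q) (Y q)) = g p (nabla p v X) (Y p) + g p (X p) (nabla p v Y)"
  using lc unfolding levi_civita_def by blast

context
  fixes U Y p assumes U: "open U" "p \<in> U" and Y: "vfield \<A> U Y"
begin

lemma nabla_tangent: "u \<in> T p \<Longrightarrow> nabla p u Y \<in> T p"
  and nabla_dir_scale: "u \<in> T p \<Longrightarrow> nabla p (tscale a u) Y = tscale a (nabla p u Y)"
  and nabla_dir_add: "u \<in> T p \<Longrightarrow> v \<in> T p \<Longrightarrow> nabla p (u + v) Y = nabla p u Y + nabla p v Y"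
  and nabla_add: "u \<in> T p \<Longrightarrow> vfield \<A> U Y' \<Longrightarrow> nabla p u (\<lambda>q. Y q + Y' q) = nabla p u Y + nabla p u Y'"
  and nabla_cong: "u \<in> T p \<Longrightarrow> vfield \<A> U Y' \<Longrightarrow> (\<And>q. q \<in> U \<Longrightarrow> Y q = Y' q) \<Longrightarrow> nabla p u Y = nabla p u Y'"
  and nabla_leibniz: "u \<in> T p \<Longrightarrow> smooth_fun \<A> U f \<Longrightarrow>
    nabla p u (\<lambda>q. tscale (f q) (Y q)) = tscale (dir_deriv \<A> p u f) (Y p) + tscale (f p) (nabla p u Y)"
proof -
  have "\<forall>p\<in>U. \<forall>u\<in>tangent \<A> p.
           nabla p u Y \<in> tangent \<A> p \<and>
           (\<forall>a. nabla p (tscale a u) Y = tscale a (nabla p u Y)) \<and>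
           (\<forall>v\<in>tangent \<A> p. nabla p (u + v) Y = nabla p u Y + nabla p v Y) \<and>
           (\<forall>Y'. vfield \<A> U Y' \<longrightarrow>
              nabla p u (\<lambda>q. Y q + Y' q) = nabla p u Y + nabla p u Y' \<and>
              ((\<forall>q\<in>U. Y q = Y' q) \<longrightarrow> nabla p u Y = nabla p u Y')) \<and>
           (\<forall>f. smooth_fun \<A> U f \<longrightarrow>
              nabla p u (\<lambda>q. tscale (f q) (Y q)) =
                tscale (dir_deriv \<A> p u f) (Y p) + tscale (f p) (nabla p u Y))"
    by (rule conn[unfolded linear_connection_def, THEN spec, THEN spec, THEN mp, OF conjI[OF U(1) Y], THEN conjunct2])
  note h = this[rule_format, OF U(2)]
  show "u \<in> T p \<Longrightarrow> nabla p u Y \<in> T p"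
    "u \<in> T p \<Longrightarrow> nabla p (tscale a u) Y = tscale a (nabla p u Y)"
    "u \<in> T p \<Longrightarrow> v \<in> T p \<Longrightarrow> nabla p (u + v) Y = nabla p u Y + nabla p v Y"
    "u \<in> T p \<Longrightarrow> vfield \<A> U Y' \<Longrightarrow> nabla p u (\<lambda>q. Y q + Y' q) = nabla p u Y + nabla p u Y'"
    "u \<in> T p \<Longrightarrow> smooth_fun \<A> U f \<Longrightarrow>
      nabla p u (\<lambda>q. tscale (f q) (Y q)) = tscale (dir_deriv \<A> p u f) (Y p) + tscale (f p) (nabla p u Y)"
    using h by simp_all
  show "u \<in> T p \<Longrightarrow> vfield \<A> U Y' \<Longrightarrow> (\<And>q. q \<in> U \<Longrightarrow> Y q = Y' q) \<Longrightarrow> nabla p u Y = nabla p u Y'"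
    using h by blast
qed

lemma nabla_const_scale: "u \<in> T p \<Longrightarrow> nabla p u (\<lambda>q. tscale a (Y q)) = tscale a (nabla p u Y)"
  using nabla_leibniz[of u "\<lambda>q. a"] smooth_fun_const by (simp add: dir_deriv_const)

end

lemma nabla_0:
  assumes "u \<in> T p"
  shows "nabla p u (\<lambda>q. 0) = 0"
  using nabla_add[OF open_UNIV UNIV_I vfield_0 assms vfield_0] by simp

lemma nabla_sum:
  assumes "open U" "p \<in> U" "u \<in> T p" "\<And>i. i \<in> I \<Longrightarrow> vfield \<A> U (Y i)"
  shows "nabla p u (\<lambda>q. \<Sum>i\<in>I. Y i q) = (\<Sum>i\<in>I. nabla p u (Y i))"
  using assms(4)
proof (induction I rule: infinite_finite_induct)
  case (insert i I)
  then have "nabla p u (\<lambda>q. Y i q + (\<Sum>i\<in>I. Y i q)) = nabla p u (Y i) + nabla p u (\<lambda>q. \<Sum>i\<in>I. Y i q)"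
    by (intro nabla_add[OF assms(1,2) _ assms(3)] vfield_sum[OF assms(1)]) auto
  moreover have "nabla p u (\<lambda>q. \<Sum>i\<in>I. Y i q) = (\<Sum>i\<in>I. nabla p u (Y i))"
    using insert by simp
  ultimately show ?case
    by (simp only: sum.insert[OF insert(1,2)])
qed (simp_all add: nabla_0[OF assms(3)])

section \<open>Adapted frames and the connection form\<close>

abbreviation fv where "fv E x p \<equiv> frame_vec E x p"

lemma frame_subset:
  "adapted_frame \<A> g \<xi> \<phi> U E \<Longrightarrow> open V \<Longrightarrow> V \<subseteq> U \<Longrightarrow> adapted_frame \<A> g \<xi> \<phi> V E"
  unfolding adapted_frame_def using vfield_subset by blast

context
  fixes U E assumes frame: "adapted_frame \<A> g \<xi> \<phi> U E"
begin

lemma frame_open: "open U" and frame_vfield: "vfield \<A> U (E i)"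
  and frame_xi: "p \<in> U \<Longrightarrow> E 5 p = \<xi> p"
  and frame_orth: "p \<in> U \<Longrightarrow> g p (E i p) (E j p) = (if i = j then 1 else 0)"
  using frame unfolding adapted_frame_def by blast+

lemma frame_phi: "p \<in> U \<Longrightarrow> g p (E i p) (\<phi> p (E j p)) = phi0 (ebas j) $ i"
proof -
  assume "p \<in> U"
  then have "g p (E i p) (\<phi> p (E j p)) =
      (wedge11 (inner (ebas 1)) (inner (ebas 2)) + wedge11 (inner (ebas 3)) (inner (ebas 4))) (ebas i) (ebas j)"
    using frame unfolding adapted_frame_def by blast
  also have "\<dots> = phi0 (ebas j) $ i"
    using exhaust_5[of i] by (auto simp: wedge11_def inner_axis' ebas_nth)
  finally show ?thesis .
qed

lemma frame_tangent: "p \<in> U \<Longrightarrow> E i p \<in> T p"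
  using frame_vfield vfield_tangent by blast

lemma fv_tangent: "p \<in> U \<Longrightarrow> fv E x p \<in> T p"
  unfolding frame_vec_def by (intro tangent_sum tangent_scale frame_tangent)

lemma fv_vfield: "vfield \<A> U (frame_vec E x)"
proof -
  have "vfield \<A> U (\<lambda>p. \<Sum>i\<in>UNIV. tscale (x $ i) (E i p))"
    by (intro vfield_sum frame_open vfield_tscale smooth_fun_const frame_vfield)
  moreover have "frame_vec E x = (\<lambda>p. \<Sum>i\<in>UNIV. tscale (x $ i) (E i p))"
    by (intro ext) (simp only: frame_vec_def)
  ultimately show ?thesis by simp
qed

lemma fv_ebas: "fv E (ebas i) p = E i p"
proof -
  have "fv E (ebas i) p = (\<Sum>j\<in>UNIV. if j = i then E i p else 0)"
    unfolding frame_vec_def by (intro sum.cong) (auto simp: ebas_nth)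
  then show ?thesis by simp
qed

lemma fv_add: "fv E (x + y) p = fv E x p + fv E y p"
  by (simp only: frame_vec_def vector_add_component tscale_distribs sum.distrib)

lemma fv_scale: "fv E (a *\<^sub>R x) p = tscale a (fv E x p)"
proof -
  have "tscale a (\<Sum>i\<in>I. v i) = (\<Sum>i\<in>I. tscale a (v i))" for I :: "5 set" and v :: "5 \<Rightarrow> 'a tvec"
    by (induction I rule: infinite_finite_induct) (simp_all only: sum.infinite sum.empty sum.insert tscale_0 tscale_distribs not_False_eq_True)
  then show ?thesis
    by (simp only: frame_vec_def vector_scaleR_component tscale_distribs real_scaleR_def)
qed

lemma g_frame_fv: "p \<in> U \<Longrightarrow> g p (E i p) (fv E x p) = x $ i"
  unfolding frame_vec_def
  by (simp add: g_sum_right frame_tangent tangent_scale g_scale_right frame_orth if_distrib cong: if_cong)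

text \<open>Read in one chart, x |-> \<open>fv E x p\<close> is an injective linear map from R5 to
  itself, hence onto; injectivity comes from orthonormality.\<close>

lemma fv_exhaust:
  assumes "p \<in> U" "u \<in> T p"
  obtains x where "u = fv E x p"
proof -
  obtain c where c: "c \<in> \<A>" "p \<in> fst c" by (rule chart_exists)
  let ?f = "\<lambda>x. fv E x p c"
  have l: "linear ?f"
    by (rule linearI) (simp_all add: fv_add fv_scale tscale_def)
  have "inj ?f"
  proof (rule injI)
    fix x y assume "?f x = ?f y"
    then have "fv E x p = fv E y p"
      using tangent_eqI[OF fv_tangent fv_tangent c] assms(1) by blast
    then show "x = y" using g_frame_fv[OF assms(1)] by (metis vec_eq_iff)
  qed
  then have "surj ?f" using linear_injective_imp_surjective[OF l] by simp
  from surjD[OF this, of "u c"] obtain x where "u c = ?f x" by (rule exE)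
  then have "u = fv E x p"
    using tangent_eqI[OF assms(2) fv_tangent c] assms(1) by blast
  then show thesis by (rule that)
qed

lemma fv_eqI:
  assumes "p \<in> U" "u \<in> T p" "\<And>i. g p (E i p) u = x $ i"
  shows "u = fv E x p"
proof -
  obtain y where "u = fv E y p" using fv_exhaust[OF assms(1,2)] .
  moreover from this have "y = x" using assms(3) g_frame_fv[OF assms(1)] by (simp add: vec_eq_iff)
  ultimately show ?thesis by simp
qed

lemma phi_fv:
  assumes p: "p \<in> U"
  shows "\<phi> p (fv E x p) = fv E (phi0 x) p"
proof (rule fv_eqI[OF p phi_tangent[OF fv_tangent[OF p]]])
  fix i
  have "g p (E i p) (\<phi> p (fv E x p)) = (\<Sum>j\<in>UNIV. x $ j * phi0 (ebas j) $ i)"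
    unfolding frame_vec_def using p
    by (simp add: phi_sum tangent_scale frame_tangent phi_scale g_sum_right phi_tangent g_scale_right frame_phi)
  also have "\<dots> = phi0 x $ i"
    using exhaust_5[of i] by (auto simp: sum_5 ebas_nth)
  finally show "g p (E i p) (\<phi> p (fv E x p)) = phi0 x $ i" .
qed

abbreviation om where "om p v i j \<equiv> g p (nabla p v (E i)) (E j p)"

text \<open>Metric compatibility applied to the locally constant function g(E i, E j).\<close>

lemma om_skew:
  assumes p: "p \<in> U" and v: "v \<in> T p"
  shows "om p v j i = - om p v i j"
proof -
  have "dir_deriv \<A> p v (\<lambda>q. g q (E i q) (E j q)) = 0"
    using dir_deriv_cong[OF frame_open p, of "\<lambda>q. g q (E i q) (E j q)" "\<lambda>q. if i = j then 1 else 0" v]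
    by (simp add: frame_orth dir_deriv_const)
  moreover have "g p (E i p) (nabla p v (E j)) = om p v j i"
    by (intro g_sym frame_tangent p nabla_tangent[OF frame_open p frame_vfield v])
  ultimately show ?thesis
    using metric_compat[OF frame_open frame_vfield frame_vfield p v, of i j] by simp
qed

lemma nabla_fv:
  assumes p: "p \<in> U" and v: "v \<in> T p"
  shows "nabla p v (frame_vec E y) = (\<Sum>i\<in>UNIV. tscale (y $ i) (nabla p v (E i)))"
proof -
  have "frame_vec E y = (\<lambda>p. \<Sum>i\<in>UNIV. tscale (y $ i) (E i p))"
    by (intro ext) (simp only: frame_vec_def)
  then have "nabla p v (frame_vec E y) = nabla p v (\<lambda>p. \<Sum>i\<in>UNIV. tscale (y $ i) (E i p))"
    by simp
  also have "\<dots> = (\<Sum>i\<in>UNIV. nabla p v (\<lambda>p. tscale (y $ i) (E i p)))"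
    by (intro nabla_sum[OF frame_open p v] vfield_tscale frame_open smooth_fun_const frame_vfield)
  also have "\<dots> = (\<Sum>i\<in>UNIV. tscale (y $ i) (nabla p v (E i)))"
    by (simp only: nabla_const_scale[OF frame_open p frame_vfield v])
  finally show ?thesis .
qed

abbreviation CF where "CF \<equiv> connection_form g nabla E"

text \<open>Connection coefficients and wedge products are both skew in i, j. Their products are
  therefore symmetric, and the sum over i < j equals the full double sum.\<close>

lemma CF_eq:
  assumes p: "p \<in> U"
  shows "CF p x y z = g p (nabla p (fv E x p) (frame_vec E y)) (fv E z p)"
proof -
  let ?v = "fv E x p" and ?w = "\<lambda>i j. om p (fv E x p) i j"
  have v: "?v \<in> T p" by (rule fv_tangent[OF p])
  have n: "nabla p ?v (E i) \<in> T p" for i by (rule nabla_tangent[OF frame_open p frame_vfield v])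
  note sk = om_skew[OF p v]
  have same: "?w i i = 0" for i using sk[of i i] by simp
  have "g p (nabla p ?v (frame_vec E y)) (fv E z p) = (\<Sum>i\<in>UNIV. \<Sum>j\<in>UNIV. y $ i * (z $ j * ?w i j))"
    unfolding nabla_fv[OF p v] frame_vec_def[of E z]
    using p n
    by (simp add: g_sum_left g_sum_right tangent_scale tangent_sum frame_tangent g_scale_left g_scale_right,
        simp add: sum_5 algebra_simps)
  also have "\<dots> = CF p x y z"
  proof -
    have "CF p x y z = (\<Sum>(i, j) \<in> {(i, j). i < j}. ?w i j * (y $ i * z $ j - z $ i * y $ j))"
      unfolding connection_form_def by (simp add: wedge11_def inner_axis')
    also have "\<dots> = (let f = \<lambda>i j. ?w i j * (y $ i * z $ j - z $ i * y $ j) in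
        f 1 2 + f 1 3 + f 1 4 + f 1 5 + f 2 3 + f 2 4 + f 2 5 + f 3 4 + f 3 5 + f 4 5)"
      unfolding Let_def by (rule sum_less_symmetric) (subst sk, simp add: algebra_simps)
    also have "\<dots> = (\<Sum>i\<in>UNIV. \<Sum>j\<in>UNIV. y $ i * (z $ j * ?w i j))"
      unfolding sum_5 Let_def
      by (simp add: same sk[of 2 1] sk[of 3 1] sk[of 4 1] sk[of 5 1] sk[of 3 2] sk[of 4 2] sk[of 5 2] sk[of 4 3]
           sk[of 5 3] sk[of 5 4] algebra_simps)
    finally show ?thesis ..
  qed
  finally show ?thesis ..
qed

lemma CF_A_space:
  assumes p: "p \<in> U"
  shows "CF p \<in> A_space"
proof -
  have n: "nabla p v (frame_vec E y) \<in> T p" if "v \<in> T p" for v y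
    by (rule nabla_tangent[OF frame_open p fv_vfield that])
  note t = fv_tangent[OF p]
  have "linear (\<lambda>x. CF p x y z)" for y z
    by (rule linearI)
      (simp_all only: CF_eq[OF p] fv_add fv_scale nabla_dir_add[OF frame_open p fv_vfield t t]
        nabla_dir_scale[OF frame_open p fv_vfield t] g_add_left[OF n[OF t] n[OF t] t] g_scale_left[OF n[OF t] t] real_scaleR_def)
  moreover have skew: "CF p x y z + CF p x z y = 0" for x y z
    unfolding connection_form_def sum.distrib[symmetric]
    by (rule sum.neutral) (auto simp: wedge11_def algebra_simps)
  moreover have lz: "linear (\<lambda>z. CF p x y z)" for x y
    by (rule linearI)
      (simp_all only: CF_eq[OF p] fv_add fv_scale g_add_right[OF n[OF t] t t] g_scale_right[OF n[OF t] t] real_scaleR_def)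
  \<comment> \<open>Skewness transports linearity from the last argument.\<close>
  moreover have "linear (\<lambda>y. CF p x y z)" for x z
  proof -
    have "(\<lambda>y. CF p x y z) = (\<lambda>y. - CF p x z y)"
      using skew[of x _ z] by (simp add: fun_eq_iff eq_neg_iff_add_eq_0)
    then show ?thesis using linear_compose_neg[OF lz[of x z]] by simp
  qed
  ultimately show ?thesis
    unfolding A_space_def bilinear_def by blast
qed

text \<open>The fields X and Y are arbitrary with given values at p: vanishing of N is demanded for
  all local fields, so constant coefficients in the frame would not do.\<close>

lemma nijenhuis_eq_NT:
  assumes p: "p \<in> U" and X: "vfield \<A> U X" and Y: "vfield \<A> U Y"
    and Xp: "X p = fv E x p" and Yp: "Y p = fv E y p"
  shows "nijenhuis \<A> nabla \<xi> \<eta> \<phi> X Y p \<in> T p"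
    and "g p (fv E z p) (nijenhuis \<A> nabla \<xi> \<eta> \<phi> X Y p) = nij (CF p) z x y"
proof -
  note o = frame_open and t = fv_tangent[OF p]
  have A: "CF p \<in> A_space" by (rule CF_A_space[OF p])
  have \<phi>v: "vfield \<A> U (\<lambda>q. \<phi> q (Z q))" if "vfield \<A> U Z" for Z
    by (rule phi_vfield[OF o that])
  have n: "nabla p (fv E w p) Z \<in> T p" if "vfield \<A> U Z" for w Z
    by (rule nabla_tangent[OF o p that t])
  \<comment> \<open>Differentiating \<open>g(Z, \<phi>Y) + g(\<phi>Z, Y) = 0\<close> for a field \<open>Z\<close> with constant coefficients in the frame
    expresses \<open>(\<nabla>\<^sub>v\<phi>)Y\<close> by the value of \<open>Y\<close> at \<open>p\<close>: this is the tensoriality.\<close>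
  define G where "G w z y = CF p w (phi0 y) z + CF p w y (phi0 z)" for w z y
  have key: "g p (fv E z p) (nabla p (fv E w p) (\<lambda>q. \<phi> q (Y q))) + g p (fv E (phi0 z) p) (nabla p (fv E w p) Y) = G w z y"
    if Y: "vfield \<A> U Y" and Yp: "Y p = fv E y p" for w z y Y
  proof -
    let ?v = "fv E w p"
    \<comment> \<open>Negation is expressed as a scaling, the form in which the connection axioms
      treat it.\<close>
    let ?mY = "\<lambda>q. tscale (- 1) (Y q)"
    have mY: "vfield \<A> U ?mY" by (rule vfield_tscale[OF o smooth_fun_const Y])
    have "dir_deriv \<A> p ?v (\<lambda>q. g q (frame_vec E z q) (\<phi> q (Y q)))
        = dir_deriv \<A> p ?v (\<lambda>q. g q (frame_vec E (phi0 z) q) (?mY q))"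
    proof (rule dir_deriv_cong[OF o p])
      fix q assume q: "q \<in> U"
      show "g q (frame_vec E z q) (\<phi> q (Y q)) = g q (frame_vec E (phi0 z) q) (?mY q)"
        unfolding phi_fv[OF q, symmetric] tscale_minus
          g_minus_right[OF phi_tangent[OF fv_tangent[OF q]] vfield_tangent[OF Y q]]
          g_phi_left[OF fv_tangent[OF q] vfield_tangent[OF Y q]] by simp
    qed
    moreover have "dir_deriv \<A> p ?v (\<lambda>q. g q (frame_vec E z q) (\<phi> q (Y q))) =
        CF p w z (phi0 y) + g p (fv E z p) (nabla p ?v (\<lambda>q. \<phi> q (Y q)))"
      unfolding metric_compat[OF o fv_vfield \<phi>v[OF Y] p t] CF_eq[OF p] Yp phi_fv[OF p] ..
    moreover have "dir_deriv \<A> p ?v (\<lambda>q. g q (frame_vec E (phi0 z) q) (?mY q)) =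
        - CF p w (phi0 z) y - g p (fv E (phi0 z) p) (nabla p ?v Y)"
      unfolding metric_compat[OF o fv_vfield mY p t]
      unfolding nabla_const_scale[OF o p Y t]
      unfolding CF_eq[OF p] Yp tscale_minus
        g_minus_right[OF n[OF fv_vfield] t] g_minus_right[OF t n[OF Y]] by simp
    ultimately have "g p (fv E z p) (nabla p ?v (\<lambda>q. \<phi> q (Y q))) + g p (fv E (phi0 z) p) (nabla p ?v Y) =
        - CF p w z (phi0 y) - CF p w (phi0 z) y" by linarith
    then show ?thesis
      using A_space_skew[OF A, of w z "phi0 y"] A_space_skew[OF A, of w "phi0 z" y] by (simp add: G_def)
  qed
  \<comment> \<open>The fifth frame field agrees with \<xi> on U only, so the locality of the
    connection is used.\<close>
  have xi: "nabla p v \<xi> = nabla p v (frame_vec E xi0)" if "v \<in> T p" for v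
    by (rule nabla_cong[OF o p vfield_subset[OF xi_vfield] that fv_vfield]) (simp_all add: fv_ebas frame_xi)
  have eta: "cov_deriv_eta \<A> nabla \<eta> X Y p = CF p x xi0 y"
    if X: "vfield \<A> U X" and Y: "vfield \<A> U Y" and Xp: "X p = fv E x p" and Yp: "Y p = fv E y p" for X Y x y
  proof -
    have "dir_deriv \<A> p (X p) (\<lambda>q. \<eta> q (Y q)) = dir_deriv \<A> p (X p) (\<lambda>q. g q (\<xi> q) (Y q))"
      by (rule dir_deriv_cong[OF o p]) (rule eta_eq[OF vfield_tangent[OF Y]])
    also have "\<dots> = g p (nabla p (X p) \<xi>) (Y p) + g p (\<xi> p) (nabla p (X p) Y)"
      using metric_compat[OF o vfield_subset[OF xi_vfield] Y p vfield_tangent[OF X p]] by simp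
    finally show ?thesis
      unfolding cov_deriv_eta_def Xp Yp eta_eq[OF n[OF Y]] xi[OF t] CF_eq[OF p] by simp
  qed
  let ?a = "nabla p (fv E (phi0 x) p) (\<lambda>q. \<phi> q (Y q))" and ?b = "nabla p (fv E (phi0 y) p) (\<lambda>q. \<phi> q (X q))"
    and ?c = "nabla p (fv E x p) Y" and ?d = "nabla p (fv E y p) X"
    and ?e = "nabla p (fv E (phi0 x) p) Y" and ?f = "nabla p (fv E y p) (\<lambda>q. \<phi> q (X q))"
    and ?h = "nabla p (fv E x p) (\<lambda>q. \<phi> q (Y q))" and ?k = "nabla p (fv E (phi0 y) p) X"
    and ?s = "CF p x xi0 y - CF p y xi0 x"
  have N: "nijenhuis \<A> nabla \<xi> \<eta> \<phi> X Y p =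
      (?a - ?b) + \<phi> p (\<phi> p (?c - ?d)) - \<phi> p (?e - ?f) - \<phi> p (?h - ?k) + tscale ?s (\<xi> p)"
    unfolding nijenhuis_def d_eta_def eta[OF X Y Xp Yp] eta[OF Y X Yp Xp]
      torsion_free[OF o X Y p] torsion_free[OF o \<phi>v[OF X] Y p] torsion_free[OF o X \<phi>v[OF Y] p]
      torsion_free[OF o \<phi>v[OF X] \<phi>v[OF Y] p] Xp Yp phi_fv[OF p] ..
  have m: "?a \<in> T p" "?b \<in> T p" "?c \<in> T p" "?d \<in> T p" "?e \<in> T p" "?f \<in> T p" "?h \<in> T p" "?k \<in> T p"
    by (intro n X Y \<phi>v)+
  note tan = tangent_add tangent_diff phi_tangent tangent_scale xi_tangent m t
  show "nijenhuis \<A> nabla \<xi> \<eta> \<phi> X Y p \<in> T p"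
    unfolding N by (intro tan)
  have ph: "g p (fv E z p) (\<phi> p u) = - g p (fv E (phi0 z) p) u" if "u \<in> T p" for z u
    using g_phi_left[OF t that, of z] by (simp add: phi_fv[OF p])
  have dist: "g p (fv E z p) ((A - B) + C - D - F + H) =
      g p (fv E z p) A - g p (fv E z p) B + g p (fv E z p) C - g p (fv E z p) D - g p (fv E z p) F + g p (fv E z p) H"
    if "A \<in> T p" "B \<in> T p" "C \<in> T p" "D \<in> T p" "F \<in> T p" "H \<in> T p" for A B C D F H
    using that by (simp only: g_add_right[OF t] g_diff_right[OF t] tangent_add tangent_diff)
  have xz: "g p (fv E z p) (tscale ?s (\<xi> p)) = eta0 z * ?s"
    using g_frame_fv[OF p, of 5 z]
    by (simp add: g_scale_right[OF t xi_tangent] frame_xi[OF p] g_sym[OF t xi_tangent] eta0_nth)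
  \<comment> \<open>Moving each outer \<phi> to z, by g(z, \<phi>u) = - g(\<phi>z, u), arranges the
    eight derivatives in four pairs, each a left-hand side of \<open>key\<close>.\<close>
  have "g p (fv E z p) (nijenhuis \<A> nabla \<xi> \<eta> \<phi> X Y p) =
      (g p (fv E z p) ?a + g p (fv E (phi0 z) p) ?e) - (g p (fv E z p) ?b + g p (fv E (phi0 z) p) ?k)
    + (g p (fv E (phi0 z) p) ?h + g p (fv E (phi0 (phi0 z)) p) ?c)
    - (g p (fv E (phi0 z) p) ?f + g p (fv E (phi0 (phi0 z)) p) ?d) + eta0 z * ?s"
    unfolding N by (subst dist; (intro tan)?) (simp only: xz ph tan g_diff_right[OF t])
  also have "\<dots> = G (phi0 x) z y - G (phi0 y) z x + G x (phi0 z) y - G y (phi0 z) x + eta0 z * ?s"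
    by (simp only: key[OF Y Yp] key[OF X Xp])
  also have "\<dots> = nij (CF p) z x y"
    by (simp add: G_def nij_def)
  finally show "g p (fv E z p) (nijenhuis \<A> nabla \<xi> \<eta> \<phi> X Y p) = nij (CF p) z x y" .
qed

end

section \<open>Existence of adapted frames\<close>

text \<open>The field with constant coordinates w in the chart c, carried to the other charts by the
  transition differentials.\<close>

definition coord_field :: "'a chart \<Rightarrow> R5 \<Rightarrow> 'a \<Rightarrow> 'a tvec" where
  "coord_field c w q = (\<lambda>d. if d \<in> \<A> \<and> q \<in> fst d then frechet_derivative (snd d \<circ> chart_inv c) (at (snd c q)) w else 0)"

lemma coord_field_chart:
  assumes c: "c \<in> \<A>" and q: "q \<in> fst c"
  shows "coord_field c w q c = w"
proof -
  have "frechet_derivative (snd c \<circ> chart_inv c) (at (snd c q)) = frechet_derivative (\<lambda>x. x) (at (snd c q))"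
    by (rule frechet_derivative_cong_open[OF chart_image_open[OF c open_UNIV]])
      (use q chart_chart_inv[OF c, of _ UNIV] in auto)
  then show ?thesis using assms by (simp add: coord_field_def)
qed

lemma coord_field_vfield:
  assumes c: "c \<in> \<A>"
  shows "vfield \<A> (fst c) (coord_field c w)"
proof (rule vfieldI)
  fix q assume q: "q \<in> fst c"
  show "coord_field c w q \<in> T q"
  proof (rule tangentI)
    fix d e assume d: "d \<in> \<A>" "q \<in> fst d" and e: "e \<in> \<A>" "q \<in> fst e"
    \<comment> \<open>Compatibility between d and e is the chain rule for the transition from c to e
      through d.\<close>
    have cq: "(snd d \<circ> chart_inv c) (snd c q) = snd d q"
      using chart_inv_chart[OF c q] by simp
    have "((snd e \<circ> chart_inv d) \<circ> (snd d \<circ> chart_inv c) has_derivative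
        frechet_derivative (snd e \<circ> chart_inv d) (at (snd d q)) \<circ> frechet_derivative (snd d \<circ> chart_inv c) (at (snd c q)))
        (at (snd c q))"
      using diff_chain_at[OF transition_derivative[OF c d(1) q d(2)], unfolded cq, OF transition_derivative[OF d(1) e(1) d(2) e(2)]] .
    from frechet_derivative_at[OF this]
    have "frechet_derivative ((snd e \<circ> chart_inv d) \<circ> (snd d \<circ> chart_inv c)) (at (snd c q)) =
        frechet_derivative (snd e \<circ> chart_inv d) (at (snd d q)) \<circ> frechet_derivative (snd d \<circ> chart_inv c) (at (snd c q))"
      by (rule sym)
    moreover have "frechet_derivative (snd e \<circ> chart_inv c) (at (snd c q)) =
        frechet_derivative ((snd e \<circ> chart_inv d) \<circ> (snd d \<circ> chart_inv c)) (at (snd c q))"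
    proof (rule frechet_derivative_cong_open[OF transition_open[OF c d(1)]])
      show "snd c q \<in> snd c ` (fst c \<inter> fst d)" using q d by blast
      fix x assume "x \<in> snd c ` (fst c \<inter> fst d)"
      then have "chart_inv c x \<in> fst d" using chart_inv_chart[OF c] by auto
      then show "(snd e \<circ> chart_inv c) x = ((snd e \<circ> chart_inv d) \<circ> (snd d \<circ> chart_inv c)) x"
        using chart_inv_chart[OF d(1)] by simp
    qed
    ultimately show "coord_field c w q e = frechet_derivative (snd e \<circ> chart_inv d) (at (snd d q)) (coord_field c w q d)"
      using d e by (simp add: coord_field_def)
  qed (auto simp: coord_field_def)
next
  fix d assume d: "d \<in> \<A>"
  let ?S = "snd d ` (fst d \<inter> fst c)"
  let ?h = "\<lambda>y. frechet_derivative (snd d \<circ> chart_inv c) (at y) w"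
  have S: "open ?S" by (rule transition_open[OF d c])
  have m: "chart_inv d x \<in> fst c" "chart_inv d x \<in> fst d" if "x \<in> ?S" for x
    using that chart_inv_chart[OF d] by auto
  \<comment> \<open>In the chart d the field is a derivative of the transition from c to d, taken at
    a point that the inverse transition supplies.\<close>
  have "smooth_on ?S (\<lambda>x. ?h ((snd c \<circ> chart_inv d) x))"
  proof (rule smooth_on_compose[OF S transition_open[OF c d] _ _ transition_smooth[OF d c]])
    show "(snd c \<circ> chart_inv d) ` ?S \<subseteq> snd c ` (fst c \<inter> fst d)" using m by auto
    show "smooth_on (snd c ` (fst c \<inter> fst d)) ?h"
      by (rule smooth_on_frechet_derivative[OF transition_smooth[OF c d]])
  qed
  moreover have "coord_field c w (chart_inv d x) d = ?h ((snd c \<circ> chart_inv d) x)" if "x \<in> ?S" for x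
    using m[OF that] d by (simp add: coord_field_def)
  ultimately have "smooth_on ?S (\<lambda>x. coord_field c w (chart_inv d x) d)"
    using smooth_on_cong[OF S] by (metis (no_types, lifting))
  then show "smooth_on (snd d ` (fst c \<inter> fst d)) (\<lambda>x. coord_field c w (chart_inv d x) d)"
    by (simp only: inf_commute)
qed

text \<open>One Gram-Schmidt step: fewer than five orthonormal fields can be extended by a further
  one, after shrinking the neighbourhood.\<close>

lemma unit_field:
  fixes I :: "5 set"
  assumes U: "open U" "p \<in> U" and B: "\<And>i. i \<in> I \<Longrightarrow> vfield \<A> U (B i)"
    and orth: "\<And>q i j. q \<in> U \<Longrightarrow> i \<in> I \<Longrightarrow> j \<in> I \<Longrightarrow> g q (B i q) (B j q) = (if i = j then 1 else 0)"
    and I: "card I < 5"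
  obtains V e where "open V" "p \<in> V" "V \<subseteq> U" "vfield \<A> V e" "\<And>q. q \<in> V \<Longrightarrow> g q (e q) (e q) = 1"
    "\<And>q i. q \<in> V \<Longrightarrow> i \<in> I \<Longrightarrow> g q (B i q) (e q) = 0"
proof -
  obtain c where c: "c \<in> \<A>" "p \<in> fst c" by (rule chart_exists)
  let ?S = "(\<lambda>i. B i p c) ` I"
  \<comment> \<open>Fewer than five vectors do not span R5; a w outside their span keeps the
    orthogonalised coordinate field nonzero at p.\<close>
  have "dim (span ?S) \<le> card ?S" by (simp add: dim_le_card')
  also have "\<dots> \<le> card I" by (simp add: card_image_le)
  finally have "dim (span ?S) < DIM(R5)" using I by simp
  then have "span ?S \<noteq> UNIV" by (metis dim_UNIV less_irrefl)
  then obtain w where w: "w \<notin> span ?S" by blast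
  define U1 where "U1 = U \<inter> fst c"
  have U1: "open U1" "p \<in> U1" "U1 \<subseteq> U" "U1 \<subseteq> fst c"
    using U c chart_open[OF c(1)] by (auto simp: U1_def)
  let ?X = "coord_field c w"
  have X: "vfield \<A> U1 ?X" by (rule vfield_subset[OF coord_field_vfield[OF c(1)] U1(4)])
  have B1: "vfield \<A> U1 (B i)" if "i \<in> I" for i by (rule vfield_subset[OF B[OF that] U1(3)])
  define a where "a i q = g q (B i q) (?X q)" for i q
  define Y where "Y q = ?X q + (\<Sum>i\<in>I. tscale (- 1) (tscale (a i q) (B i q)))" for q
  have Y: "vfield \<A> U1 Y"
    unfolding Y_def a_def
    by (intro vfield_add vfield_sum vfield_tscale smooth_fun_const g_smooth U1(1) X B1)
  have YB: "g q (B j q) (Y q) = 0" if "q \<in> U1" "j \<in> I" for q j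
  proof -
    have t: "B i q \<in> T q" if "i \<in> I" for i using vfield_tangent[OF B1[OF that]] \<open>q \<in> U1\<close> .
    have tX: "?X q \<in> T q" by (rule vfield_tangent[OF X that(1)])
    have "g q (B j q) (Y q) = g q (B j q) (?X q) + (\<Sum>i\<in>I. - a i q * (if j = i then 1 else 0))"
      unfolding Y_def using t tX that orth U1(3)
      by (simp add: g_add_right g_sum_right tangent_sum tangent_scale g_scale_right subset_iff cong: sum.cong)
    then show ?thesis using that(2) by (simp add: a_def if_distrib cong: if_cong)
  qed
  have "Y p \<noteq> 0"
  proof
    assume "Y p = 0"
    then have "Y p c = 0" by simp
    then have "w = (\<Sum>i\<in>I. a i p *\<^sub>R B i p c)"
      by (simp add: Y_def coord_field_chart[OF c] sum_apply_fun tscale_def sum_negf)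
    also have "\<dots> \<in> span ?S" by (intro span_sum span_scale span_base) blast
    finally show False using w by simp
  qed
  let ?f = "\<lambda>q. g q (Y q) (Y q)"
  have f: "smooth_fun \<A> U1 ?f" by (rule g_smooth[OF U1(1) Y Y])
  \<comment> \<open>Normalisation is possible only where the field does not vanish, an open set by
    continuity in the chart.\<close>
  define V where "V = {q \<in> U1. ?f q > 0}"
  have "open V"
  proof -
    have "continuous_on (snd c ` (U1 \<inter> fst c)) (?f \<circ> chart_inv c)"
      using f c(1) by (intro smooth_on_continuous) (simp add: smooth_fun_def)
    then have "continuous_on (snd c ` U1) (?f \<circ> chart_inv c)"
      using U1(4) by (simp only: Int_absorb2)
    moreover have "continuous_on U1 (snd c)"
      using chart_homeo[OF c(1)] U1(4) continuous_on_subset by (auto simp: homeomorphism_def)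
    ultimately have "continuous_on U1 ((?f \<circ> chart_inv c) \<circ> snd c)"
      by (intro continuous_on_compose[of U1 "snd c" "?f \<circ> chart_inv c"])
    then have "continuous_on U1 ?f"
      by (rule continuous_on_eq) (use U1(4) chart_inv_chart[OF c(1)] in auto)
    then have "open (U1 \<inter> ?f -` {0<..})"
      by (rule continuous_open_preimage[OF _ U1(1) open_greaterThan])
    moreover have "V = U1 \<inter> ?f -` {0<..}" by (auto simp: V_def)
    ultimately show ?thesis by simp
  qed
  moreover have "p \<in> V"
    using \<open>Y p \<noteq> 0\<close> U1(2) g_pos[OF vfield_tangent[OF Y U1(2)]] by (simp add: V_def)
  moreover have VU: "V \<subseteq> U" and VU1: "V \<subseteq> U1" using U1(3) by (auto simp: V_def)
  moreover have h: "smooth_fun \<A> V (\<lambda>q. 1 / sqrt (?f q))"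
    unfolding smooth_fun_def
  proof
    fix d assume d: "d \<in> \<A>"
    have "smooth_on (snd d ` (V \<inter> fst d)) (?f \<circ> chart_inv d)"
      using smooth_fun_subset[OF f VU1] d by (simp add: smooth_fun_def)
    from smooth_on_inverse_sqrt[OF chart_image_open[OF d \<open>open V\<close>] this]
    show "smooth_on (snd d ` (V \<inter> fst d)) ((\<lambda>q. 1 / sqrt (?f q)) \<circ> chart_inv d)"
      using chart_chart_inv[OF d, of _ V] by (auto simp: V_def comp_def)
  qed
  then have "vfield \<A> V (\<lambda>q. tscale (1 / sqrt (?f q)) (Y q))"
    by (rule vfield_tscale[OF \<open>open V\<close> _ vfield_subset[OF Y VU1]])
  moreover have "g q (tscale (1 / sqrt (?f q)) (Y q)) (tscale (1 / sqrt (?f q)) (Y q)) = 1" if "q \<in> V" for q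
  proof -
    have "Y q \<in> T q" using vfield_tangent[OF Y] VU1 that by blast
    moreover have "?f q > 0" using that by (simp add: V_def)
    ultimately show ?thesis
      by (simp add: g_scale_left g_scale_right tangent_scale real_sqrt_mult_self field_simps flip: real_sqrt_mult)
  qed
  moreover have "g q (B i q) (tscale (1 / sqrt (?f q)) (Y q)) = 0" if "q \<in> V" "i \<in> I" for q i
  proof -
    have "Y q \<in> T q" "B i q \<in> T q" using vfield_tangent[OF Y] vfield_tangent[OF B1] VU1 that by blast+
    then show ?thesis using YB[of q i] VU1 that by (simp add: g_scale_right subset_iff)
  qed
  ultimately show thesis by (intro that[of V "\<lambda>q. tscale (1 / sqrt (?f q)) (Y q)"])
qed

text \<open>Only e_1 = u and e_3 = v are chosen, by two uses of \<open>unit_field\<close>; e_2 = -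
  \<phi>u and e_4 = - \<phi>v are forced, the sign because \<phi>(e_1) = - e_2 and \<phi>(e_3) = -
  e_4 in the local model.\<close>

lemma adapted_frame_exists:
  obtains U E where "p \<in> U" "adapted_frame \<A> g \<xi> \<phi> U E"
proof -
  obtain V1 u where V1: "open V1" "p \<in> V1" and u: "vfield \<A> V1 u"
    and uu: "\<And>q. q \<in> V1 \<Longrightarrow> g q (u q) (u q) = 1" and xu: "\<And>q. q \<in> V1 \<Longrightarrow> g q (\<xi> q) (u q) = 0"
  proof (rule unit_field[OF open_UNIV UNIV_I, of "{5}" "\<lambda>i. \<xi>" p])
    show "vfield \<A> UNIV \<xi>" by (rule xi_vfield)
  qed (auto simp: xi_unit)
  define E2 where "E2 q = tscale (- 1) (\<phi> q (u q))" for q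
  have E2: "vfield \<A> V1 E2"
    unfolding E2_def by (intro vfield_tscale V1 smooth_fun_const phi_vfield u)
  have t1: "u q \<in> T q" "\<phi> q (u q) \<in> T q" if "q \<in> V1" for q
    using vfield_tangent[OF u that] phi_tangent by blast+
  have u': "g q (u q) (\<phi> q (u q)) = 0" "g q (\<phi> q (u q)) (\<phi> q (u q)) = 1" "g q (\<xi> q) (\<phi> q (u q)) = 0" if q: "q \<in> V1" for q
    using g_phi_left[OF t1(1)[OF q] t1(1)[OF q]] g_sym[OF t1[OF q]] g_phi_phi[OF t1(1)[OF q] t1(1)[OF q]]
      g_xi_phi[OF t1(1)[OF q]] uu[OF q] xu[OF q] by simp_all
  define B where "B i = (if i = 5 then \<xi> else if i = 1 then u else E2)" for i :: 5
  have x1: "vfield \<A> V1 \<xi>" by (rule vfield_subset[OF xi_vfield]) simp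
  obtain V2 v where V2: "open V2" "p \<in> V2" "V2 \<subseteq> V1" and v: "vfield \<A> V2 v"
    and vv: "\<And>q. q \<in> V2 \<Longrightarrow> g q (v q) (v q) = 1"
    and Bv: "\<And>q i. q \<in> V2 \<Longrightarrow> i \<in> {5, 1, 2} \<Longrightarrow> g q (B i q) (v q) = 0"
  proof (rule unit_field[OF V1, of "{5, 1, 2}" B])
    show "vfield \<A> V1 (B i)" for i using x1 u E2 by (simp add: B_def)
    show "g q (B i q) (B j q) = (if i = j then 1 else 0)" if "q \<in> V1" "i \<in> {5, 1, 2}" "j \<in> {5, 1, 2}" for q i j
      using that t1[OF that(1)] u'[OF that(1)] uu xu g_sym[OF t1[OF that(1)]] g_sym[OF xi_tangent t1(1)[OF that(1)]]
        g_sym[OF xi_tangent t1(2)[OF that(1)]] xi_tangent[of q]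
      by (auto simp: B_def E2_def tscale_minus xi_unit g_minus_left g_minus_right tangent_minus)
  qed auto
  define E where "E i = (if i = 5 then \<xi> else if i = 1 then u else if i = 2 then (\<lambda>q. tscale (- 1) (\<phi> q (u q)))
      else if i = 3 then v else (\<lambda>q. tscale (- 1) (\<phi> q (v q))))" for i :: 5
  have "adapted_frame \<A> g \<xi> \<phi> V2 E"
    unfolding adapted_frame_def
  proof (intro conjI ballI)
    show "open V2" by (rule V2(1))
    show "\<forall>i. vfield \<A> V2 (E i)"
      unfolding E_def using V2 v vfield_subset[OF x1 V2(3)] vfield_subset[OF u V2(3)]
      by (auto intro!: vfield_tscale smooth_fun_const phi_vfield)
    fix q assume q: "q \<in> V2"
    then have q1: "q \<in> V1" using V2 by blast
    show "E 5 q = \<xi> q" by (simp add: E_def)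
    let ?x = "\<xi> q" and ?u = "u q" and ?v = "v q" and ?u' = "\<phi> q (u q)" and ?v' = "\<phi> q (v q)"
    note tx = xi_tangent[of q] and tu = t1[OF q1] and tv = vfield_tangent[OF v q] phi_tangent[OF vfield_tangent[OF v q]]
    have c: "g q ?x ?v = 0" "g q ?u ?v = 0" "g q ?u' ?v = 0"
      using Bv[OF q, of 5] Bv[OF q, of 1] Bv[OF q, of 2] by (simp_all add: B_def E2_def tscale_minus g_minus_left tu tv)
    \<comment> \<open>Orthogonality of \<phi>v to the other fields is inherited from that of v,
      through skewness of \<phi> and its compatibility with g.\<close>
    have d: "g q ?v ?v' = 0" "g q ?v' ?v' = 1" "g q ?x ?v' = 0" "g q ?u ?v' = 0" "g q ?u' ?v' = 0"
      using g_phi_left[OF tv(1) tv(1)] g_sym[OF tv(1,2)] g_phi_phi[OF tv(1) tv(1)] g_xi_phi[OF tv(1)] vv[OF q]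
        g_phi_left[OF tu(1) tv(1)] g_phi_phi[OF tu(1) tv(1)] c by simp_all
    note up = xi_unit[of q] uu[OF q1] xu[OF q1] u'[OF q1] vv[OF q] c d
    have low: "g q ?u ?x = 0" "g q ?u' ?x = 0" "g q ?v ?x = 0" "g q ?v' ?x = 0" "g q ?u' ?u = 0" "g q ?v' ?v = 0"
        "g q ?v ?u = 0" "g q ?v' ?u = 0" "g q ?v ?u' = 0" "g q ?v' ?u' = 0"
      using up g_sym tx tu tv by metis+
    have pp: "\<phi> q ?u' = - ?u" "\<phi> q ?v' = - ?v"
      using phi_phi[OF tu(1)] phi_phi[OF tv(1)] up by simp_all
    note all = up low g_minus_left g_minus_right tangent_minus tx tu tv phi_xi phi_minus pp g_0_right tscale_minus
    show "\<forall>i j. g q (E i q) (E j q) = (if i = j then 1 else 0)"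
      unfolding forall_5 by (simp add: E_def all)
    show "\<forall>i j. g q (E i q) (\<phi> q (E j q)) =
      (wedge11 (inner (ebas 1)) (inner (ebas 2)) + wedge11 (inner (ebas 3)) (inner (ebas 4))) (ebas i) (ebas j)"
      unfolding forall_5 by (simp add: E_def all wedge11_def inner_axis' ebas_nth)
  qed
  with V2(2) show thesis by (rule that)
qed

section \<open>Comparison of the classes\<close>

lemma nijenhuis_tensor_eq_NT:
  assumes "adapted_frame \<A> g \<xi> \<phi> U E" "p \<in> U"
  shows "nijenhuis_tensor \<A> g nabla \<xi> \<eta> \<phi> E p = nij (connection_form g nabla E p)"
  by (intro ext) (simp add: nijenhuis_tensor_def nijenhuis_eq_NT(2)[OF assms fv_vfield[OF assms(1)] fv_vfield[OF assms(1)] refl refl])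

lemma nijenhuis_class_iff:
  "nijenhuis_class \<A> g nabla \<xi> \<eta> \<phi> S \<longleftrightarrow>
   (\<forall>U E. adapted_frame \<A> g \<xi> \<phi> U E \<longrightarrow> (\<forall>p\<in>U. nij (connection_form g nabla E p) \<in> S))"
  unfolding nijenhuis_class_def using nijenhuis_tensor_eq_NT by metis

text \<open>The left side quantifies over all local fields and the right side over adapted frames;
  without a frame around each point the right side could hold vacuously.\<close>

lemma nijenhuis_vanishes_iff:
  "nijenhuis_vanishes \<A> nabla \<xi> \<eta> \<phi> \<longleftrightarrow>
   (\<forall>U E. adapted_frame \<A> g \<xi> \<phi> U E \<longrightarrow> (\<forall>p\<in>U. nij (connection_form g nabla E p) = 0))"
proof
  assume v: "nijenhuis_vanishes \<A> nabla \<xi> \<eta> \<phi>"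
  show "\<forall>U E. adapted_frame \<A> g \<xi> \<phi> U E \<longrightarrow> (\<forall>p\<in>U. nij (connection_form g nabla E p) = 0)"
  proof (intro allI impI ballI)
    fix U E p assume f: "adapted_frame \<A> g \<xi> \<phi> U E" and p: "p \<in> U"
    have "nijenhuis \<A> nabla \<xi> \<eta> \<phi> (frame_vec E y) (frame_vec E z) p = 0" for y z
      using v frame_open[OF f] fv_vfield[OF f] p unfolding nijenhuis_vanishes_def by blast
    then show "nij (connection_form g nabla E p) = 0"
      unfolding nijenhuis_tensor_eq_NT[OF f p, symmetric]
      by (intro ext) (simp add: nijenhuis_tensor_def g_0_right[OF fv_tangent[OF f p]])
  qed
next
  assume z: "\<forall>U E. adapted_frame \<A> g \<xi> \<phi> U E \<longrightarrow> (\<forall>p\<in>U. nij (connection_form g nabla E p) = 0)"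
  show "nijenhuis_vanishes \<A> nabla \<xi> \<eta> \<phi>"
    unfolding nijenhuis_vanishes_def
  proof (intro allI impI ballI, elim conjE)
    fix U X Y p assume U: "open U" and X: "vfield \<A> U X" and Y: "vfield \<A> U Y" and p: "p \<in> U"
    obtain V E where V: "p \<in> V" "adapted_frame \<A> g \<xi> \<phi> V E" by (rule adapted_frame_exists)
    let ?W = "U \<inter> V" and ?N = "nijenhuis \<A> nabla \<xi> \<eta> \<phi> X Y p"
    have f: "adapted_frame \<A> g \<xi> \<phi> ?W E"
      using U frame_open[OF V(2)] by (intro frame_subset[OF V(2)]) auto
    have W: "p \<in> ?W" using p V by simp
    have XY: "vfield \<A> ?W X" "vfield \<A> ?W Y" using vfield_subset[OF X] vfield_subset[OF Y] by simp_all
    obtain x where x: "X p = frame_vec E x p" by (rule fv_exhaust[OF f W vfield_tangent[OF XY(1) W]])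
    obtain y where y: "Y p = frame_vec E y p" by (rule fv_exhaust[OF f W vfield_tangent[OF XY(2) W]])
    note N = nijenhuis_eq_NT[OF f W XY x y]
    \<comment> \<open>With N itself expanded in the frame, the formula for its components yields
      g(N, N) = 0.\<close>
    obtain n where n: "?N = frame_vec E n p" by (rule fv_exhaust[OF f W N(1)])
    have "nij (connection_form g nabla E p) = 0" using z f W by blast
    then have "g p ?N ?N = 0" using N(2)[of n] by (simp flip: n)
    then show "?N = 0" using g_pos[OF N(1)] by force
  qed
qed

lemma torsion_class_iff:
  "torsion_class \<A> g \<xi> \<phi> nabla S \<longleftrightarrow>
   (\<forall>U E. adapted_frame \<A> g \<xi> \<phi> U E \<longrightarrow> (\<forall>p\<in>U. pr_W (connection_form g nabla E p) \<in> S))"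
  by (simp add: torsion_class_def intrinsic_torsion_def)

text \<open>At every point of every adapted frame both sides reduce to the same \<open>no_W\<close>
  conditions on the connection form, so the equivalences hold pointwise.\<close>

lemma class_equivalences:
  "nijenhuis_class \<A> g nabla \<xi> \<eta> \<phi> N2 \<longleftrightarrow> torsion_class \<A> g \<xi> \<phi> nabla (W1 + W3 + W5 + W6 + W8 + W9)"
  "nijenhuis_class \<A> g nabla \<xi> \<eta> \<phi> N3 \<longleftrightarrow> torsion_class \<A> g \<xi> \<phi> nabla (W1 + W3 + W5 + W6 + W8 + W10)"
  "nijenhuis_class \<A> g nabla \<xi> \<eta> \<phi> N4_5 \<longleftrightarrow> torsion_class \<A> g \<xi> \<phi> nabla (W1 + W3 + W4 + W5 + W6 + W7 + W8)"
  "nijenhuis_class \<A> g nabla \<xi> \<eta> \<phi> N6 \<longleftrightarrow> torsion_class \<A> g \<xi> \<phi> nabla (W1 + W2 + W3 + W5 + W6 + W8)"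
  "nijenhuis_vanishes \<A> nabla \<xi> \<eta> \<phi> \<longleftrightarrow> torsion_class \<A> g \<xi> \<phi> nabla (W1 + W3 + W5 + W6 + W8)"
  unfolding nijenhuis_class_iff nijenhuis_vanishes_iff torsion_class_iff
  by (simp_all only: nij_classes[OF CF_A_space] nij_zero_iff[OF CF_A_space] torsion_classes[OF CF_A_space] cong: imp_cong ball_cong)

end

theorem theorem3p2:
  fixes \<A> :: "'a::{t2_space, second_countable_topology} chart set"
    and g :: "'a \<Rightarrow> 'a tvec \<Rightarrow> 'a tvec \<Rightarrow> real"
    and \<xi> :: "'a \<Rightarrow> 'a tvec"
    and \<eta> :: "'a \<Rightarrow> 'a tvec \<Rightarrow> real"
    and \<phi> :: "'a \<Rightarrow> 'a tvec \<Rightarrow> 'a tvec"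
    and nabla :: "'a \<Rightarrow> 'a tvec \<Rightarrow> ('a \<Rightarrow> 'a tvec) \<Rightarrow> 'a tvec"
  assumes "almost_contact_metric_5_manifold \<A> g \<xi> \<eta> \<phi>"
    and "levi_civita \<A> g nabla"
  shows "(nijenhuis_class \<A> g nabla \<xi> \<eta> \<phi> N2 \<longleftrightarrow>
            torsion_class \<A> g \<xi> \<phi> nabla (W1 + W3 + W5 + W6 + W8 + W9)) \<and>
         (nijenhuis_class \<A> g nabla \<xi> \<eta> \<phi> N3 \<longleftrightarrow>
            torsion_class \<A> g \<xi> \<phi> nabla (W1 + W3 + W5 + W6 + W8 + W10)) \<and>
         (nijenhuis_class \<A> g nabla \<xi> \<eta> \<phi> N4_5 \<longleftrightarrow>
            torsion_class \<A> g \<xi> \<phi> nabla (W1 + W3 + W4 + W5 + W6 + W7 + W8)) \<and>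
         (nijenhuis_class \<A> g nabla \<xi> \<eta> \<phi> N6 \<longleftrightarrow>
            torsion_class \<A> g \<xi> \<phi> nabla (W1 + W2 + W3 + W5 + W6 + W8)) \<and>
         (nijenhuis_vanishes \<A> nabla \<xi> \<eta> \<phi> \<longleftrightarrow>
            torsion_class \<A> g \<xi> \<phi> nabla (W1 + W3 + W5 + W6 + W8))"
proof -
  interpret acm5 \<A> g \<xi> \<eta> \<phi> nabla
    using assms by unfold_locales
  show ?thesis
    by (intro conjI class_equivalences)
qed

end
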